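(* Let $I\subset\mathbb{R}$ be an interval closed and bounded on the left, and let $\mathbf{f}\in L^\infty(I;H)$. Then $\mathcal{U}_I$ is a $\mathcal{G}_{\delta\sigma}$-set in $\mathcal{U}_I^\sharp$, i.e. $\mathcal{U}_I$ is a countable union of sets which are countable intersections of relatively open sets in $\mathcal{U}_I^\sharp$.
   Context: Spaces. Fix $\nu>0$ and one of two cases. Periodic case: $\Omega=\prod_{i=1}^3(0,L_i)$, $L_i>0$, and $\mathcal{V}$ is the set of restrictions to $\Omega$ of fields $\mathbf{w}\in C^\infty(\mathbb{R}^3)^3$ that are divergence-free, periodic with period $L_i$ in each direction $x_i$, and satisfy $\int_\Omega\mathbf{w}\,d\mathbf{x}=0$. No-slip case: $\Omega\subset\mathbb{R}^3$ is a bounded domain with smooth boundary (at least of class $C^2$) and $\mathcal{V}$ is the set of divergence-free fields in $C_c^\infty(\Omega)^3$. $H$ (resp. $V$) is the completion of $\mathcal{V}$ in the $L^2(\Omega)^3$ (resp. $H^1(\Omega)^3$) norm. Write $(\mathbf{u},\mathbf{v})_{L^2}=\int_\Omega\mathbf{u}\cdot\mathbf{v}\,d\mathbf{x}$, $|\mathbf{u}|_{L^2}$ for its norm, $((\mathbf{u},\mathbf{v}))_{H^1}=\int_\Omega\sum_{i=1}^3\partial_{x_i}\mathbf{u}\cdot\partial_{x_i}\mathbf{v}\,d\mathbf{x}$ and $\|\mathbf{u}\|_{H^1}$ for its norm. $H$ is identified with its dual, so $V\subset H\subset V'$, with duality product $\langle\cdot,\cdot\rangle_{V',V}$. Define $A:V\to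 V'$ by $\langle A\mathbf{u},\mathbf{v}\rangle_{V',V}=((\mathbf{u},\mathbf{v}))_{H^1}$, $b(\mathbf{u},\mathbf{v},\mathbf{w})=\int_\Omega(\mathbf{u}\cdot\nabla)\mathbf{v}\cdot\mathbf{w}\,d\mathbf{x}$, and $B:V\times V\to V'$ by $\langle B(\mathbf{u},\mathbf{v}),\mathbf{w}\rangle_{V',V}=b(\mathbf{u},\mathbf{v},\mathbf{w})$. For an interval $I\subset\mathbb{R}$, the subscript "loc" on spaces over $I$ refers to compact subintervals of $I$. $H_{\mathrm{w}}$ is $H$ with its weak topology. $\mathcal{C}_{\mathrm{loc}}(I,H_{\mathrm{w}})$ is the space of weakly continuous functions $I\to H$ with the topology of uniform weak convergence on compact subintervals of $I$. Weak solution (always meaning Leray-Hopf weak solution) on an interval $I$, for a given $\mathbf{f}\in L^\infty(I;H)$: a function $\mathbf{u}:I\to H$ such that (i) $\mathbf{u}\in L^\infty_{\mathrm{loc}}(I;H)\cap L^2_{\mathrm{loc}}(I;V)$; (ii) $\partial_t\mathbf{u}\in L^{4/3}_{\mathrm{loc}}(I;V')$; (iii) $\mathbf{u}\in\mathcal{C}_{\mathrm{loc}}(I,H_{\mathrm{w}})$; (iv) $\frac{d\mathbf{u}}{dt}+\nu A\mathbf{u}+B(\mathbf{u},\mathbf{u})=\mathbf{f}$ in the distribution sense on $I$ with values in $V'$; (v) for almost all $t'\in I$ and all $t\in I$ with $t>t'$, $\frac12|\mathbf{u}(t)|_{L^2}^2+\nu\int_{t'}^t\|\mathbf{u}(s)\|_{H^1}^2ds\le\frac12|\mathbf{u}(t')|_{L^2}^2+\int_{t'}^t(\mathbf{f}(s),\mathbf{u}(s))_{L^2}ds$;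 (vi) if $I$ is closed and bounded on the left with left end point $t_0$, then $\mathbf{u}(t)\to\mathbf{u}(t_0)$ strongly in $H$ as $t\to t_0^+$. $\mathcal{U}_I$ is the set of $\mathbf{u}\in\mathcal{C}_{\mathrm{loc}}(I,H_{\mathrm{w}})$ which are weak solutions on $I$, and $\mathcal{U}_I^\sharp$ is the set of $\mathbf{u}\in\mathcal{C}_{\mathrm{loc}}(I,H_{\mathrm{w}})$ which are weak solutions on the interior $I^\circ$ of $I$, both with the topology inherited from $\mathcal{C}_{\mathrm{loc}}(I,H_{\mathrm{w}})$. *)

theory Defs
  imports "HOL-Analysis.Analysis"
begin

section \<open>The Hilbert space of square-integrable vector fields\<close>

text \<open>
  The type \<open>l2vec\<close> below is \<open>L\<^sup>2(\<real>\<^sup>3)\<^sup>3\<close>, with equality almost everywhere. The space over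
  a domain is the subspace of fields vanishing almost everywhere outside the domain
  (extension by zero).
\<close>

definition sq_integrable :: "(real^3 \<Rightarrow> real^3) \<Rightarrow> bool" where
  "sq_integrable f \<longleftrightarrow> f \<in> borel_measurable lborel \<and> integrable lborel (\<lambda>x. (norm (f x))\<^sup>2)"

definition l2_rel :: "(real^3 \<Rightarrow> real^3) \<Rightarrow> (real^3 \<Rightarrow> real^3) \<Rightarrow> bool" where
  "l2_rel f g \<longleftrightarrow> sq_integrable f \<and> sq_integrable g \<and> (AE x in lborel. f x = g x)"

lemma sq_integrable_zero: "sq_integrable (\<lambda>x. 0)"
  by (simp add: sq_integrable_def)

lemma sq_integrable_inner:
  assumes "sq_integrable f" "sq_integrable g"
  shows "integrable lborel (\<lambda>x. f x \<bullet> g x)"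
proof (rule Bochner_Integration.integrable_bound)
  show "integrable lborel (\<lambda>x. (norm (f x))\<^sup>2 + (norm (g x))\<^sup>2)"
    using assms by (auto simp: sq_integrable_def)
  show "(\<lambda>x. f x \<bullet> g x) \<in> borel_measurable lborel"
    using assms by (auto simp: sq_integrable_def)
  have "norm (f x \<bullet> g x) \<le> norm ((norm (f x))\<^sup>2 + (norm (g x))\<^sup>2)" for x
  proof -
    have "\<bar>f x \<bullet> g x\<bar> \<le> norm (f x) * norm (g x)" by (rule Cauchy_Schwarz_ineq2)
    moreover have "2 * (norm (f x) * norm (g x)) \<le> (norm (f x))\<^sup>2 + (norm (g x))\<^sup>2"
      using sum_squares_bound[of "norm (f x)" "norm (g x)"] by simp
    moreover have "0 \<le> norm (f x) * norm (g x)" by simp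
    ultimately show ?thesis unfolding real_norm_def by linarith
  qed
  then show "AE x in lborel. norm (f x \<bullet> g x) \<le> norm ((norm (f x))\<^sup>2 + (norm (g x))\<^sup>2)" by simp
qed

lemma sq_integrable_add:
  assumes "sq_integrable f" "sq_integrable g"
  shows "sq_integrable (\<lambda>x. f x + g x)"
proof -
  have "integrable lborel (\<lambda>x. (norm (f x))\<^sup>2 + 2 * (f x \<bullet> g x) + (norm (g x))\<^sup>2)"
    using assms sq_integrable_inner[OF assms] by (auto simp: sq_integrable_def)
  moreover have "(norm (f x + g x))\<^sup>2 = (norm (f x))\<^sup>2 + 2 * (f x \<bullet> g x) + (norm (g x))\<^sup>2" for x
    by (simp add: power2_norm_eq_inner inner_add inner_commute)
  ultimately show ?thesis using assms by (auto simp: sq_integrable_def)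
qed

lemma sq_integrable_scaleR:
  assumes "sq_integrable f"
  shows "sq_integrable (\<lambda>x. c *\<^sub>R f x)"
  using assms by (auto simp: sq_integrable_def power_mult_distrib)

lemma sq_integrable_uminus: "sq_integrable f \<Longrightarrow> sq_integrable (\<lambda>x. - f x)"
  using sq_integrable_scaleR[of f "-1"] by simp

lemma sq_integrable_diff:
  "sq_integrable f \<Longrightarrow> sq_integrable g \<Longrightarrow> sq_integrable (\<lambda>x. f x - g x)"
  using sq_integrable_add[of f "\<lambda>x. - g x"] sq_integrable_uminus[of g] by simp

quotient_type l2vec = "real^3 \<Rightarrow> real^3" / partial: l2_rel
proof (rule part_equivpI)
  show "\<exists>x. l2_rel x x" using sq_integrable_zero by (auto simp: l2_rel_def)
  show "symp l2_rel" by (auto simp: symp_def l2_rel_def eq_commute)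
  show "transp l2_rel" by (auto simp: transp_def l2_rel_def elim: AE_mp)
qed

instantiation l2vec :: real_inner
begin

lift_definition zero_l2vec :: l2vec is "\<lambda>x. 0"
  by (simp add: l2_rel_def sq_integrable_zero)

lift_definition plus_l2vec :: "l2vec \<Rightarrow> l2vec \<Rightarrow> l2vec" is "\<lambda>f g x. f x + g x"
  by (auto simp: l2_rel_def sq_integrable_add)

lift_definition minus_l2vec :: "l2vec \<Rightarrow> l2vec \<Rightarrow> l2vec" is "\<lambda>f g x. f x - g x"
  by (auto simp: l2_rel_def sq_integrable_diff)

lift_definition uminus_l2vec :: "l2vec \<Rightarrow> l2vec" is "\<lambda>f x. - f x"
  by (auto simp: l2_rel_def sq_integrable_uminus)

lift_definition scaleR_l2vec :: "real \<Rightarrow> l2vec \<Rightarrow> l2vec" is "\<lambda>c f x. c *\<^sub>R f x"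
  by (auto simp: l2_rel_def sq_integrable_scaleR)

lift_definition inner_l2vec :: "l2vec \<Rightarrow> l2vec \<Rightarrow> real" is "\<lambda>f g. LINT x|lborel. f x \<bullet> g x"
proof -
  fix f f' g g' assume *: "l2_rel f f'" "l2_rel g g'"
  then have [measurable]: "f \<in> borel_measurable borel" "f' \<in> borel_measurable borel"
    "g \<in> borel_measurable borel" "g' \<in> borel_measurable borel"
    by (auto simp: l2_rel_def sq_integrable_def)
  from * have "AE x in lborel. f x = f' x" "AE x in lborel. g x = g' x"
    by (auto simp: l2_rel_def)
  then have "AE x in lborel. f x \<bullet> g x = f' x \<bullet> g' x" by eventually_elim simp
  then show "(LINT x|lborel. f x \<bullet> g x) = (LINT x|lborel. f' x \<bullet> g' x)"
    by (intro integral_cong_AE) auto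
qed

definition norm_l2vec :: "l2vec \<Rightarrow> real" where "norm_l2vec u = sqrt (u \<bullet> u)"
definition sgn_l2vec :: "l2vec \<Rightarrow> l2vec" where "sgn_l2vec u = inverse (norm u) *\<^sub>R u"
definition dist_l2vec :: "l2vec \<Rightarrow> l2vec \<Rightarrow> real" where "dist_l2vec u v = norm (u - v)"
definition uniformity_l2vec :: "(l2vec \<times> l2vec) filter" where
  "uniformity_l2vec = (INF e\<in>{0<..}. principal {(u, v). dist u v < e})"
definition open_l2vec :: "l2vec set \<Rightarrow> bool" where
  "open_l2vec U \<longleftrightarrow> (\<forall>u\<in>U. \<forall>\<^sub>F (u', v) in uniformity. u' = u \<longrightarrow> v \<in> U)"

instance
proof
  fix u v w :: l2vec and a b :: real and U :: "l2vec set"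
  show "u + v + w = u + (v + w)"
    by transfer (auto simp: l2_rel_def algebra_simps intro!: sq_integrable_add)
  show "u + v = v + u"
    by transfer (auto simp: l2_rel_def algebra_simps intro!: sq_integrable_add)
  show "0 + u = u"
    by transfer (auto simp: l2_rel_def)
  show "- u + u = 0"
    by transfer (auto simp: l2_rel_def sq_integrable_zero)
  show "u - v = u + - v"
    by transfer (auto simp: l2_rel_def intro!: sq_integrable_diff)
  show "a *\<^sub>R (u + v) = a *\<^sub>R u + a *\<^sub>R v"
    by transfer (auto simp: l2_rel_def scaleR_add_right
      intro!: sq_integrable_add sq_integrable_scaleR)
  show "(a + b) *\<^sub>R u = a *\<^sub>R u + b *\<^sub>R u"
    by transfer (auto simp: l2_rel_def scaleR_add_left
      intro!: sq_integrable_add sq_integrable_scaleR)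
  show "a *\<^sub>R b *\<^sub>R u = (a * b) *\<^sub>R u"
    by transfer (auto simp: l2_rel_def intro!: sq_integrable_scaleR)
  show "1 *\<^sub>R u = u"
    by transfer (auto simp: l2_rel_def)
  show "dist u v = norm (u - v)" by (simp add: dist_l2vec_def)
  show "sgn u = inverse (norm u) *\<^sub>R u" by (simp add: sgn_l2vec_def)
  show "uniformity = (INF e\<in>{0<..}. principal {(u::l2vec, v). dist u v < e})"
    by (simp add: uniformity_l2vec_def)
  show "open U \<longleftrightarrow> (\<forall>u\<in>U. \<forall>\<^sub>F (u', v) in uniformity. u' = u \<longrightarrow> v \<in> U)"
    by (simp add: open_l2vec_def)
  show "u \<bullet> v = v \<bullet> u"
    by transfer (simp add: inner_commute)
  show "(u + v) \<bullet> w = u \<bullet> w + v \<bullet> w"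
    by transfer (simp add: l2_rel_def inner_add_left sq_integrable_inner)
  show "a *\<^sub>R u \<bullet> v = a * (u \<bullet> v)"
    by transfer (simp add: l2_rel_def)
  show "0 \<le> u \<bullet> u"
    by transfer (simp add: l2_rel_def)
  show "u \<bullet> u = 0 \<longleftrightarrow> u = 0"
  proof transfer
    fix f assume f: "l2_rel f f"
    then have "sq_integrable f" by (simp add: l2_rel_def)
    then have "integrable lborel (\<lambda>x. f x \<bullet> f x)"
      by (rule sq_integrable_inner) fact
    then have "(LINT x|lborel. f x \<bullet> f x) = 0 \<longleftrightarrow> (AE x in lborel. f x \<bullet> f x = 0)"
      by (rule integral_nonneg_eq_0_iff_AE) simp
    then show "(LINT x|lborel. f x \<bullet> f x) = 0 \<longleftrightarrow> l2_rel f (\<lambda>x. 0)"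
      using \<open>sq_integrable f\<close> by (simp add: l2_rel_def sq_integrable_zero)
  qed
  show "norm u = sqrt (u \<bullet> u)" by (simp add: norm_l2vec_def)
qed

end

definition L2_on :: "(real^3) set \<Rightarrow> l2vec set" where
  "L2_on \<Omega> = {u. AE x in lborel. x \<notin> \<Omega> \<longrightarrow> rep_l2vec u x = 0}"

definition l2_of :: "(real^3) set \<Rightarrow> (real^3 \<Rightarrow> real^3) \<Rightarrow> l2vec" where
  "l2_of \<Omega> w = abs_l2vec (\<lambda>x. indicator \<Omega> x *\<^sub>R w x)"


section \<open>Smooth functions, domains and test fields\<close>

definition pd :: "'a::euclidean_space \<Rightarrow> ('a \<Rightarrow> 'b::real_normed_vector) \<Rightarrow> 'a \<Rightarrow> 'b" where
  "pd i f x = frechet_derivative f (at x) i"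

text \<open>\<open>Ck_on k U f\<close> is meant for open \<open>U\<close>.\<close>

primrec Ck_on :: "nat \<Rightarrow> 'a::euclidean_space set \<Rightarrow> ('a \<Rightarrow> 'b::real_normed_vector) \<Rightarrow> bool" where
  "Ck_on 0 U f \<longleftrightarrow> continuous_on U f"
| "Ck_on (Suc k) U f \<longleftrightarrow> f differentiable_on U \<and> (\<forall>i\<in>Basis. Ck_on k U (pd i f))"

definition smooth :: "('a::euclidean_space \<Rightarrow> 'b::real_normed_vector) \<Rightarrow> bool" where
  "smooth f \<longleftrightarrow> (\<forall>k. Ck_on k UNIV f)"

text \<open>Elements of \<open>C\<^sub>c\<^sup>\<infinity>(U)\<close> are extended by zero to the whole space.\<close>

definition test_functions :: "'a::euclidean_space set \<Rightarrow> ('a \<Rightarrow> 'b::real_normed_vector) set" where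
  "test_functions U = {f. smooth f \<and> (\<exists>K. compact K \<and> K \<subseteq> U \<and> (\<forall>x. x \<notin> K \<longrightarrow> f x = 0))}"

definition divergence_free :: "(real^3 \<Rightarrow> real^3) \<Rightarrow> bool" where
  "divergence_free w \<longleftrightarrow> (\<forall>x. (\<Sum>i\<in>Basis. pd i w x \<bullet> i) = 0)"

text \<open>Near each boundary point the domain is the strict sublevel set of a \<open>C\<^sup>2\<close> function
  without critical points.\<close>

definition C2_boundary :: "(real^3) set \<Rightarrow> bool" where
  "C2_boundary \<Omega> \<longleftrightarrow> (\<forall>x\<in>frontier \<Omega>. \<exists>U (\<psi> :: real^3 \<Rightarrow> real).
     open U \<and> x \<in> U \<and> Ck_on 2 U \<psi> \<and> (\<forall>y\<in>U. \<exists>i\<in>Basis. pd i \<psi> y \<noteq> 0) \<and>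
     \<Omega> \<inter> U = {y\<in>U. \<psi> y < 0})"

datatype flow_case = Periodic "real^3" | NoSlip "(real^3) set"

fun admissible :: "flow_case \<Rightarrow> bool" where
  "admissible (Periodic L) \<longleftrightarrow> (\<forall>i\<in>Basis. 0 < L \<bullet> i)"
| "admissible (NoSlip \<Omega>) \<longleftrightarrow>
     open \<Omega> \<and> connected \<Omega> \<and> \<Omega> \<noteq> {} \<and> bounded \<Omega> \<and> C2_boundary \<Omega>"

fun flow_domain :: "flow_case \<Rightarrow> (real^3) set" where
  "flow_domain (Periodic L) = box 0 L"
| "flow_domain (NoSlip \<Omega>) = \<Omega>"

text \<open>The set \<open>\<V>\<close>; periodic fields are given on the whole space and restricted to the domain
  by \<^const>\<open>l2_of\<close> below.\<close>

fun test_fields :: "flow_case \<Rightarrow> (real^3 \<Rightarrow> real^3) set" where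
  "test_fields (Periodic L) =
     {w. smooth w \<and> divergence_free w \<and> (\<forall>i\<in>Basis. \<forall>x. w (x + (L \<bullet> i) *\<^sub>R i) = w x) \<and>
         (LINT x:box 0 L|lborel. w x) = 0}"
| "test_fields (NoSlip \<Omega>) = {w \<in> test_functions \<Omega>. divergence_free w}"


section \<open>The spaces \<open>H\<close>, \<open>V\<close> and \<open>V'\<close>\<close>

definition H_space :: "flow_case \<Rightarrow> l2vec set" where
  "H_space K = closure (l2_of (flow_domain K) ` test_fields K)"

definition is_weak_pd :: "(real^3) set \<Rightarrow> real^3 \<Rightarrow> l2vec \<Rightarrow> l2vec \<Rightarrow> bool" where
  "is_weak_pd \<Omega> i u g \<longleftrightarrow> g \<in> L2_on \<Omega> \<and>
     (\<forall>\<phi>\<in>test_functions \<Omega>. u \<bullet> l2_of \<Omega> (pd i \<phi>) = - (g \<bullet> l2_of \<Omega> \<phi>))"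

definition weak_pd :: "(real^3) set \<Rightarrow> real^3 \<Rightarrow> l2vec \<Rightarrow> l2vec" where
  "weak_pd \<Omega> i u = (THE g. is_weak_pd \<Omega> i u g)"

definition H1_space :: "(real^3) set \<Rightarrow> l2vec set" where
  "H1_space \<Omega> = {u \<in> L2_on \<Omega>. \<forall>i\<in>Basis. \<exists>g. is_weak_pd \<Omega> i u g}"

text \<open>\<open>H1_inner\<close> and \<open>H1_norm\<close> contain first derivatives only, \<open>H1_full_norm\<close> is the norm
  of \<open>H\<^sup>1(\<Omega>)\<^sup>3\<close>.\<close>

definition H1_inner :: "flow_case \<Rightarrow> l2vec \<Rightarrow> l2vec \<Rightarrow> real" where
  "H1_inner K u v = (\<Sum>i\<in>Basis. weak_pd (flow_domain K) i u \<bullet> weak_pd (flow_domain K) i v)"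

definition H1_norm :: "flow_case \<Rightarrow> l2vec \<Rightarrow> real" where
  "H1_norm K u = sqrt (H1_inner K u u)"

definition H1_full_norm :: "flow_case \<Rightarrow> l2vec \<Rightarrow> real" where
  "H1_full_norm K u = sqrt ((norm u)\<^sup>2 + (H1_norm K u)\<^sup>2)"

definition V_space :: "flow_case \<Rightarrow> l2vec set" where
  "V_space K = {u \<in> H1_space (flow_domain K).
     \<forall>e>0. \<exists>w\<in>test_fields K. H1_full_norm K (u - l2_of (flow_domain K) w) < e}"

text \<open>An element of \<open>V'\<close> is represented by a function on \<^typ>\<open>l2vec\<close> of which only the values
  on \<open>V\<close> matter. An element \<open>h\<close> of \<open>H\<close> is identified with \<open>\<lambda>v. h \<bullet> v\<close>.\<close>

definition V_dual :: "flow_case \<Rightarrow> (l2vec \<Rightarrow> real) set" where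
  "V_dual K = {F. (\<forall>u\<in>V_space K. \<forall>v\<in>V_space K. F (u + v) = F u + F v) \<and>
     (\<forall>c. \<forall>v\<in>V_space K. F (c *\<^sub>R v) = c * F v) \<and>
     (\<exists>C. \<forall>v\<in>V_space K. \<bar>F v\<bar> \<le> C * H1_norm K v)}"

definition V_dual_norm :: "flow_case \<Rightarrow> (l2vec \<Rightarrow> real) \<Rightarrow> real" where
  "V_dual_norm K F = (SUP v\<in>{v \<in> V_space K. H1_norm K v \<le> 1}. \<bar>F v\<bar>)"

definition A_op :: "flow_case \<Rightarrow> l2vec \<Rightarrow> l2vec \<Rightarrow> real" where
  "A_op K u = (\<lambda>v. H1_inner K u v)"

definition b_form :: "flow_case \<Rightarrow> l2vec \<Rightarrow> l2vec \<Rightarrow> l2vec \<Rightarrow> real" where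
  "b_form K u v w = (LINT x:flow_domain K|lborel.
     (\<Sum>i\<in>Basis. (rep_l2vec u x \<bullet> i) *\<^sub>R rep_l2vec (weak_pd (flow_domain K) i v) x) \<bullet> rep_l2vec w x)"

definition B_op :: "flow_case \<Rightarrow> l2vec \<Rightarrow> l2vec \<Rightarrow> l2vec \<Rightarrow> real" where
  "B_op K u v = (\<lambda>w. b_form K u v w)"


section \<open>Lebesgue--Bochner spaces and distributions in time\<close>

text \<open>In this section \<open>X\<close> is the carrier of a normed space with norm \<open>nrm\<close>; it is one of
  \<open>H\<close>, \<open>V\<close>, \<open>V'\<close>. Time carries the completed Lebesgue measure, so the values of \<open>nrm (u t)\<close> on
  the null set where \<open>u t \<notin> X\<close> are irrelevant.\<close>

definition strongly_measurable ::
    "real set \<Rightarrow> 'x::minus set \<Rightarrow> ('x \<Rightarrow> real) \<Rightarrow> (real \<Rightarrow> 'x) \<Rightarrow> bool" where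
  "strongly_measurable J X nrm u \<longleftrightarrow> (\<exists>s :: nat \<Rightarrow> real \<Rightarrow> 'x.
     (\<forall>n. simple_function (restrict_space lebesgue J) (s n) \<and> s n ` J \<subseteq> X) \<and>
     (AE t in lebesgue. t \<in> J \<longrightarrow> (\<lambda>n. nrm (s n t - u t)) \<longlonglongrightarrow> 0))"

definition Lp ::
    "real \<Rightarrow> real set \<Rightarrow> 'x::minus set \<Rightarrow> ('x \<Rightarrow> real) \<Rightarrow> (real \<Rightarrow> 'x) \<Rightarrow> bool" where
  "Lp p J X nrm u \<longleftrightarrow> (AE t in lebesgue. t \<in> J \<longrightarrow> u t \<in> X) \<and> strongly_measurable J X nrm u \<and>
     set_integrable lebesgue J (\<lambda>t. nrm (u t) powr p)"

definition Linf ::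
    "real set \<Rightarrow> 'x::minus set \<Rightarrow> ('x \<Rightarrow> real) \<Rightarrow> (real \<Rightarrow> 'x) \<Rightarrow> bool" where
  "Linf J X nrm u \<longleftrightarrow> (AE t in lebesgue. t \<in> J \<longrightarrow> u t \<in> X) \<and> strongly_measurable J X nrm u \<and>
     (\<exists>C. AE t in lebesgue. t \<in> J \<longrightarrow> nrm (u t) \<le> C)"

definition Lp_loc ::
    "real \<Rightarrow> real set \<Rightarrow> 'x::minus set \<Rightarrow> ('x \<Rightarrow> real) \<Rightarrow> (real \<Rightarrow> 'x) \<Rightarrow> bool" where
  "Lp_loc p I X nrm u \<longleftrightarrow> (\<forall>a b. {a..b} \<subseteq> I \<longrightarrow> Lp p {a..b} X nrm u)"

definition Linf_loc ::
    "real set \<Rightarrow> 'x::minus set \<Rightarrow> ('x \<Rightarrow> real) \<Rightarrow> (real \<Rightarrow> 'x) \<Rightarrow> bool" where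
  "Linf_loc I X nrm u \<longleftrightarrow> (\<forall>a b. {a..b} \<subseteq> I \<longrightarrow> Linf {a..b} X nrm u)"

text \<open>A \<open>V'\<close>-valued distribution maps a test function on the interior of \<open>I\<close> to an element
  of \<open>V'\<close>. The \<open>V'\<close>-valued integral defining a regular distribution is evaluated at \<open>v \<in> V\<close>.\<close>

type_synonym vdistribution = "(real \<Rightarrow> real) \<Rightarrow> l2vec \<Rightarrow> real"

definition regular_dist :: "real set \<Rightarrow> (real \<Rightarrow> l2vec \<Rightarrow> real) \<Rightarrow> vdistribution" where
  "regular_dist I G = (\<lambda>\<phi> v. LINT t:I|lebesgue. \<phi> t * G t v)"

definition dist_deriv :: "vdistribution \<Rightarrow> vdistribution" where
  "dist_deriv T = (\<lambda>\<phi> v. - T (deriv \<phi>) v)"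

definition dist_eq :: "flow_case \<Rightarrow> real set \<Rightarrow> vdistribution \<Rightarrow> vdistribution \<Rightarrow> bool" where
  "dist_eq K I S T \<longleftrightarrow> (\<forall>\<phi>\<in>test_functions (interior I). \<forall>v\<in>V_space K. S \<phi> v = T \<phi> v)"


section \<open>Weakly continuous functions\<close>

text \<open>Functions on \<open>I\<close> are extensional, so that equality is equality on \<open>I\<close>.\<close>

definition Cloc_Hw :: "flow_case \<Rightarrow> real set \<Rightarrow> (real \<Rightarrow> l2vec) set" where
  "Cloc_Hw K I = {u \<in> I \<rightarrow>\<^sub>E H_space K. \<forall>v\<in>H_space K. continuous_on I (\<lambda>t. u t \<bullet> v)}"

text \<open>The sets below form a subbase for the topology of uniform convergence on compact
  subintervals with respect to the weak uniformity of \<open>H\<close>. They are open, as the supremum of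
  \<open>\<bar>(u t - w t) \<bullet> v\<bar>\<close> over a compact interval is attained.\<close>

definition Cloc_Hw_top :: "flow_case \<Rightarrow> real set \<Rightarrow> (real \<Rightarrow> l2vec) topology" where
  "Cloc_Hw_top K I = topology_generated_by
     {{u \<in> Cloc_Hw K I. \<forall>t\<in>{a..b}. \<bar>(u t - w t) \<bullet> v\<bar> < e} | w a b v e.
        w \<in> Cloc_Hw K I \<and> {a..b} \<subseteq> I \<and> v \<in> H_space K \<and> 0 < e}"


section \<open>Leray--Hopf weak solutions\<close>

definition weak_solution ::
    "flow_case \<Rightarrow> real \<Rightarrow> (real \<Rightarrow> l2vec) \<Rightarrow> real set \<Rightarrow> (real \<Rightarrow> l2vec) \<Rightarrow> bool" where
  "weak_solution K \<nu> f I u \<longleftrightarrow>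
     Linf_loc I (H_space K) norm u \<and> Lp_loc 2 I (V_space K) (H1_norm K) u \<and>
     (\<exists>g. Lp_loc (4/3) I (V_dual K) (V_dual_norm K) g \<and>
        dist_eq K I (dist_deriv (regular_dist I (\<lambda>t v. u t \<bullet> v))) (regular_dist I g)) \<and>
     u \<in> Cloc_Hw K I \<and>
     dist_eq K I
       (\<lambda>\<phi> v. dist_deriv (regular_dist I (\<lambda>t v. u t \<bullet> v)) \<phi> v +
          regular_dist I (\<lambda>t v. \<nu> * A_op K (u t) v + B_op K (u t) (u t) v) \<phi> v)
       (regular_dist I (\<lambda>t v. f t \<bullet> v)) \<and>
     (AE t' in lebesgue. t' \<in> I \<longrightarrow> (\<forall>t\<in>I. t' < t \<longrightarrow>
        (norm (u t))\<^sup>2 / 2 + \<nu> * (LINT s:{t'..t}|lebesgue. (H1_norm K (u s))\<^sup>2)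
          \<le> (norm (u t'))\<^sup>2 / 2 + (LINT s:{t'..t}|lebesgue. f s \<bullet> u s))) \<and>
     (\<forall>t0. t0 \<in> I \<and> (\<forall>t\<in>I. t0 \<le> t) \<longrightarrow> (u \<longlongrightarrow> u t0) (at t0 within I))"

definition weak_solutions ::
    "flow_case \<Rightarrow> real \<Rightarrow> (real \<Rightarrow> l2vec) \<Rightarrow> real set \<Rightarrow> (real \<Rightarrow> l2vec) set" where
  "weak_solutions K \<nu> f I = {u \<in> Cloc_Hw K I. weak_solution K \<nu> f I u}"

definition interior_weak_solutions ::
    "flow_case \<Rightarrow> real \<Rightarrow> (real \<Rightarrow> l2vec) \<Rightarrow> real set \<Rightarrow> (real \<Rightarrow> l2vec) set" where
  "interior_weak_solutions K \<nu> f I =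
     {u \<in> Cloc_Hw K I. weak_solution K \<nu> f (interior I) (restrict u (interior I))}"

end

(* A weak solution on the interior of I belongs to the set of weak solutions on I as soon as two
   things hold near the left end point t0: strong continuity at t0, and integrability of the power
   4/3 of the V'-norm of its time derivative g. Both are quantified by a natural number M.

   By the energy inequality, strong continuity at t0 amounts to
   |u(t)|^2 <= |u(t0)|^2 + M (t - t0) near t0. The norm is the supremum of countably many weakly
   continuous functions, so it is lower semicontinuous with G_delta sublevel sets; separating the
   two sides by rational numbers shows that the inequality at a given t defines a G_delta set, and
   countably many t suffice.

   The increments of u over the cells of a grid are the integrals of g over the cells. By Jensen's
   inequality the discrete L^{4/3} norms of the difference quotients, taken with finitely many
   members of a countable dense subset of the unit ball of V, are bounded by the L^{4/3} norm of g.
   Conversely the cell averages converge to g, so by Fatou's lemma uniform bounds on these discrete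
   norms bound the norm of g. Each discrete norm is a continuous function of u, being built from
   finitely many weak evaluations. In this way no Sobolev inequality for the nonlinear term is
   needed.

   Separability of V in the H^1 seminorm and uniqueness of weak derivatives come from the density of
   step functions and of test functions in L^2. *)

theory Submission
  imports Defs
begin

section \<open>Smooth functions\<close>

text \<open>A weak solution on the interior satisfies the equation on \<open>I\<close> at once,
  because distributions in time are tested only with functions supported in the interior. What can
  fail is the behaviour at \<open>t0\<close>: there \<open>u\<close> is merely weakly continuous, so
  its norm may jump up right after \<open>t0\<close>, and neither the dissipation nor the size of
  the time derivative is controlled up to \<open>t0\<close>. The growth bound on the norm cures all
  of this except the derivative: together with weak continuity it gives strong continuity, it bounds
  \<open>u\<close> in \<open>H\<close>, and inserted into the interior energy inequality it bounds
  the dissipation. Its linear rate arises when the starting time of the energy inequality tends to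
  \<open>t0\<close>: the dissipation is dropped, and the work of the force is at most a constant
  times the elapsed time. A second obstacle is that a right end point of \<open>I\<close> is not
  interior either. Grids therefore keep a distance 1/(m+1) from both ends of \<open>{t0..c}\<close>,
  bounds uniform in m are passed to the limit, and the energy inequality at the right end is
  recovered by weak lower semicontinuity.\<close>

lemma pd_eqI: "(f has_derivative f') (at x) \<Longrightarrow> pd i f x = f' i"
  unfolding pd_def using frechet_derivative_at by metis

lemma pd_has_derivative:
  "f differentiable (at x) \<Longrightarrow> (f has_derivative (\<lambda>i. pd i f x)) (at x)"
  unfolding pd_def by (simp add: frechet_derivative_works)

text \<open>Smoothness proofs go by induction on \<open>k\<close> over a family closed under
  differentiation. The derivative may be given in any explicit form, so
  \<open>frechet_derivative\<close> need not be computed each time.\<close>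

lemma Ck_on_SucI:
  assumes "\<And>x. (f has_derivative f' x) (at x)" "\<And>i. i \<in> Basis \<Longrightarrow> Ck_on k UNIV (\<lambda>x. f' x i)"
  shows "Ck_on (Suc k) UNIV f"
proof -
  have "pd i f = (\<lambda>x. f' x i)" for i using assms(1) pd_eqI by blast
  then show ?thesis
    using assms by (auto simp: differentiable_on_def differentiable_def)
qed

lemma Ck_on_SucD:
  assumes "Ck_on (Suc k) UNIV f"
  shows "f differentiable (at x)" "i \<in> Basis \<Longrightarrow> Ck_on k UNIV (pd i f)"
  using assms by (auto simp: differentiable_on_def)

lemma Ck_on_lower: "Ck_on (Suc k) UNIV f \<Longrightarrow> Ck_on k UNIV f"
proof (induction k arbitrary: f)
  case 0
  then show ?case by (auto intro: differentiable_imp_continuous_on)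
next
  case (Suc k)
  then show ?case by (metis Ck_on.simps(2))
qed

lemma Ck_on_add:
  "Ck_on k UNIV f \<Longrightarrow> Ck_on k UNIV g \<Longrightarrow> Ck_on k UNIV (\<lambda>x. f x + g x)"
proof (induction k arbitrary: f g)
  case 0
  then show ?case by (simp add: continuous_on_add)
next
  case (Suc k)
  show ?case
  proof (rule Ck_on_SucI)
    show "((\<lambda>x. f x + g x) has_derivative (\<lambda>i. pd i f x + pd i g x)) (at x)" for x
      using Suc.prems[THEN Ck_on_SucD(1), THEN pd_has_derivative] by (rule has_derivative_add)
    show "Ck_on k UNIV (\<lambda>x. pd i f x + pd i g x)" if "i \<in> Basis" for i
      using Suc that Ck_on_SucD(2) by blast
  qed
qed

lemma Ck_on_const: "Ck_on k UNIV (\<lambda>x. c)"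
proof (induction k arbitrary: c)
  case (Suc k)
  show ?case by (rule Ck_on_SucI[where f' = "\<lambda>x i. 0"]) (auto simp: Suc)
qed auto

lemma Ck_on_scaleR:
  "Ck_on k UNIV f \<Longrightarrow> Ck_on k UNIV g \<Longrightarrow> Ck_on k UNIV (\<lambda>x. f x *\<^sub>R g x)"
proof (induction k arbitrary: f g)
  case 0
  then show ?case by (simp add: continuous_on_scaleR)
next
  case (Suc k)
  show ?case
  proof (rule Ck_on_SucI)
    show "((\<lambda>x. f x *\<^sub>R g x) has_derivative (\<lambda>i. f x *\<^sub>R pd i g x + pd i f x *\<^sub>R g x)) (at x)" for x
      using Suc.prems[THEN Ck_on_SucD(1), THEN pd_has_derivative] by (rule has_derivative_scaleR)
    show "Ck_on k UNIV (\<lambda>x. f x *\<^sub>R pd i g x + pd i f x *\<^sub>R g x)" if "i \<in> Basis" for i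
      using Suc.prems[THEN Ck_on_SucD(2), OF that] Suc.prems[THEN Ck_on_lower]
      by (intro Ck_on_add Suc.IH)
  qed
qed

text \<open>The derivative in direction i is the constant \<open>i \<bullet> e\<close> times the
  derivative of \<open>h\<close> composed with the same affine map, so the induction closes. This
  case of the chain rule is all that cutoffs need: on boxes they are products of one-variable
  functions of the coordinates, in time they are rescaled and shifted.\<close>

lemma Ck_on_compose_affine:
  fixes h :: "real \<Rightarrow> real"
  shows "Ck_on k UNIV h \<Longrightarrow> Ck_on k UNIV (\<lambda>x. h (x \<bullet> e + d))"
proof (induction k arbitrary: h)
  case 0
  then have "continuous_on UNIV h" by simp
  then have "continuous_on UNIV (\<lambda>x. h (x \<bullet> e + d))"
    by (rule continuous_on_compose2) (auto intro!: continuous_on_add continuous_on_inner continuous_on_const continuous_on_id)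
  then show ?case by simp
next
  case (Suc k)
  show ?case
  proof (rule Ck_on_SucI)
    fix x :: 'a
    have "((\<lambda>x. x \<bullet> e + d) has_derivative (\<lambda>i. i \<bullet> e)) (at x)"
      by (auto intro!: derivative_eq_intros)
    from diff_chain_at[OF this pd_has_derivative[OF Ck_on_SucD(1)[OF Suc.prems]]]
    have D: "((\<lambda>x. h (x \<bullet> e + d)) has_derivative (\<lambda>i. pd (i \<bullet> e) h (x \<bullet> e + d))) (at x)"
      by (simp add: o_def)
    have eq: "pd c h y = c * pd 1 h y" for c y
    proof -
      have "linear (\<lambda>c. pd c h y)"
        using pd_has_derivative[OF Ck_on_SucD(1)[OF Suc.prems], of y] has_derivative_linear by blast
      from linear_cmul[OF this, of c 1] show ?thesis by simp
    qed
    note D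
    also have "(\<lambda>i. pd (i \<bullet> e) h (x \<bullet> e + d)) = (\<lambda>i. (i \<bullet> e) * pd 1 h (x \<bullet> e + d))"
      by (rule ext) (rule eq)
    finally show "((\<lambda>x. h (x \<bullet> e + d)) has_derivative
        (\<lambda>i. (i \<bullet> e) * pd 1 h (x \<bullet> e + d))) (at x)" .
  next
    fix i :: 'a assume "i \<in> Basis"
    have "Ck_on k UNIV (\<lambda>x. (i \<bullet> e) *\<^sub>R pd 1 h (x \<bullet> e + d))"
      using Ck_on_SucD(2)[OF Suc.prems] by (intro Ck_on_scaleR Ck_on_const Suc.IH) simp
    then show "Ck_on k UNIV (\<lambda>x. (i \<bullet> e) * pd 1 h (x \<bullet> e + d))" by simp
  qed
qed

lemma smooth_add: "smooth f \<Longrightarrow> smooth g \<Longrightarrow> smooth (\<lambda>x. f x + g x)"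
  by (simp add: smooth_def Ck_on_add)

lemma smooth_const: "smooth (\<lambda>x. c)"
  by (simp add: smooth_def Ck_on_const)

lemma smooth_scaleR: "smooth f \<Longrightarrow> smooth g \<Longrightarrow> smooth (\<lambda>x. f x *\<^sub>R g x)"
  by (simp add: smooth_def Ck_on_scaleR)

lemma smooth_mult: "smooth f \<Longrightarrow> smooth g \<Longrightarrow> smooth (\<lambda>x. f x * g x :: real)"
  using smooth_scaleR[of f g] by simp

lemma smooth_prod:
  "finite S \<Longrightarrow> (\<And>i. i \<in> S \<Longrightarrow> smooth (f i)) \<Longrightarrow> smooth (\<lambda>x. \<Prod>i\<in>S. f i x :: real)"
proof (induction S rule: finite_induct)
  case empty
  show ?case by (simp add: smooth_const)
next
  case (insert i S)
  then have "smooth (\<lambda>x. f i x * (\<Prod>i\<in>S. f i x))" by (intro smooth_mult) simp_all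
  with insert.hyps show ?case by simp
qed

lemma smooth_compose_affine:
  fixes h :: "real \<Rightarrow> real"
  shows "smooth h \<Longrightarrow> smooth (\<lambda>x. h (x \<bullet> e + d))"
  by (simp add: smooth_def Ck_on_compose_affine)

lemma smooth_imp_continuous: "smooth f \<Longrightarrow> continuous_on UNIV f"
  unfolding smooth_def using Ck_on.simps(1) by blast

lemma smooth_imp_differentiable: "smooth f \<Longrightarrow> f differentiable (at x)"
  using Ck_on_SucD(1)[of 0 f x] by (simp only: smooth_def)

lemma smooth_pd: "smooth f \<Longrightarrow> i \<in> Basis \<Longrightarrow> smooth (pd i f)"
  using Ck_on_SucD(2)[of _ f i] unfolding smooth_def by blast

lemma smoothI_real:
  fixes f :: "real \<Rightarrow> real"
  assumes "\<And>x. (f has_real_derivative f' x) (at x)" "smooth f'"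
  shows "smooth f"
  unfolding smooth_def
proof
  fix k
  have "Ck_on (Suc k) UNIV f"
    using assms(1)[unfolded has_field_derivative_def] assms(2)
    by (intro Ck_on_SucI[where f' = "\<lambda>x h. f' x * h"]) (auto simp: smooth_def)
  then show "Ck_on k UNIV f" by (rule Ck_on_lower)
qed

section \<open>A smooth step function built from exp(-1/x)\<close>

text \<open>The polynomial factor in 1/x makes the family closed under differentiation, which is
  what the induction in \<open>smooth_flat_exp\<close> needs; the function exp(-1/x) itself is the
  case p = 1.\<close>

definition flat_exp :: "real poly \<Rightarrow> real \<Rightarrow> real" where
  "flat_exp p x = (if 0 < x then poly p (1 / x) * exp (- (1 / x)) else 0)"

lemma poly_times_exp_minus_tendsto_0: "((\<lambda>y. poly p y * exp (- y)) \<longlongrightarrow> (0::real)) at_top"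
proof (induction p)
  case (pCons a p)
  \<comment> \<open>The additional power \<open>y ^ k\<close> absorbs the factor y that appears when
    the constant coefficient is split off.\<close>
  have "((\<lambda>y. poly q (y::real) * y ^ k / exp y) \<longlongrightarrow> 0) at_top" for q k
  proof (induction q arbitrary: k)
    case (pCons a q)
    have "((\<lambda>y. a * (y ^ k / exp y) + poly q y * y ^ (Suc k) / exp y) \<longlongrightarrow> a * 0 + 0) at_top"
      using pCons by (intro tendsto_intros tendsto_power_div_exp_0)
    moreover have "a * (y ^ k / exp y) + poly q y * y ^ (Suc k) / exp y =
        poly (pCons a q) y * y ^ k / exp y" for y
      by (simp add: add_divide_distrib distrib_right)
    ultimately show ?case by simp
  qed simp
  from this[of "pCons a p" 0] show ?case
    by (simp only: power_0 mult_1_right exp_minus divide_inverse)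
qed auto

text \<open>For x > 0, division by x multiplies the polynomial by 1/x, that is, replaces
  \<open>p\<close> by \<open>pCons 0 p\<close>; the decay of exp(-y) at infinity then applies with y
  = 1/x. The quotient is the difference quotient at 0, where \<open>flat_exp p\<close>
  vanishes.\<close>

lemma flat_exp_tendsto_0: "((\<lambda>x. flat_exp p x / x) \<longlongrightarrow> 0) (at 0)"
proof -
  have "((\<lambda>x. poly (pCons 0 p) (inverse x) * exp (- inverse x)) \<longlongrightarrow> 0) (at_right 0)"
    by (rule filterlim_compose[OF poly_times_exp_minus_tendsto_0 filterlim_inverse_at_top_right])
  moreover have "\<forall>\<^sub>F x in at_right 0. poly (pCons 0 p) (inverse x) * exp (- inverse x) = flat_exp p x / x"
    unfolding eventually_at_filter
    by (rule always_eventually) (simp add: flat_exp_def inverse_eq_divide)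
  ultimately have "((\<lambda>x. flat_exp p x / x) \<longlongrightarrow> 0) (at_right 0)"
    by (rule Lim_transform_eventually)
  moreover have "((\<lambda>x. flat_exp p x / x) \<longlongrightarrow> 0) (at_left 0)"
    by (rule tendsto_eventually) (auto simp: flat_exp_def eventually_at_filter)
  ultimately show ?thesis by (simp add: filterlim_split_at)
qed

text \<open>With y = 1/x one has dy/dx = - y^2, so p(y) exp(-y) has derivative y^2 (p(y) - p'(y))
  exp(-y); this is the polynomial \<open>monom 1 2 * (p - pderiv p)\<close>.\<close>

lemma flat_exp_derivative:
  "(flat_exp p has_real_derivative flat_exp (monom 1 2 * (p - pderiv p)) x) (at x)"
proof -
  consider "x > 0" | "x < 0" | "x = 0" by linarith
  then show ?thesis
  proof cases
    case 1
    have d: "((\<lambda>x. 1 / x) has_real_derivative - ((1 / x)\<^sup>2)) (at x)"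
      using 1 by (auto intro!: derivative_eq_intros simp: power2_eq_square)
    have "((\<lambda>x. poly p (1 / x) * exp (- (1 / x))) has_real_derivative
        poly (pderiv p) (1 / x) * - ((1 / x)\<^sup>2) * exp (- (1 / x)) +
        exp (- (1 / x)) * - (- ((1 / x)\<^sup>2)) * poly p (1 / x)) (at x)"
      by (intro DERIV_mult DERIV_chain2[OF poly_DERIV d] DERIV_fun_exp DERIV_minus d)
    also have "poly (pderiv p) (1 / x) * - ((1 / x)\<^sup>2) * exp (- (1 / x)) +
        exp (- (1 / x)) * - (- ((1 / x)\<^sup>2)) * poly p (1 / x) =
        flat_exp (monom 1 2 * (p - pderiv p)) x"
      using 1 by (simp add: flat_exp_def poly_monom algebra_simps)
    finally have *: "((\<lambda>x. poly p (1 / x) * exp (- (1 / x))) has_real_derivative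
        flat_exp (monom 1 2 * (p - pderiv p)) x) (at x)" .
    show ?thesis
      by (rule DERIV_cong_ev[THEN iffD1, OF refl _ refl *])
        (use 1 in \<open>auto simp: flat_exp_def eventually_nhds intro!: exI[of _ "{0<..}"]\<close>)
  next
    case 2
    have *: "((\<lambda>x. 0) has_real_derivative flat_exp (monom 1 2 * (p - pderiv p)) x) (at x)"
      using 2 by (simp add: flat_exp_def)
    show ?thesis
      by (rule DERIV_cong_ev[THEN iffD1, OF refl _ refl *])
        (use 2 in \<open>auto simp: flat_exp_def eventually_nhds intro!: exI[of _ "{..<0}"]\<close>)
  next
    case 3
    then show ?thesis
      using flat_exp_tendsto_0[of p] by (simp add: has_field_derivative_iff flat_exp_def)
  qed
qed

lemma smooth_flat_exp: "smooth (flat_exp p)"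
proof -
  have "Ck_on k UNIV (flat_exp p)" for k
  proof (induction k arbitrary: p)
    case 0
    show ?case
      using DERIV_isCont[OF flat_exp_derivative] by (simp add: continuous_at_imp_continuous_on)
  next
    case (Suc k)
    let ?q = "monom 1 2 * (p - pderiv p)"
    show ?case
    proof (rule Ck_on_SucI)
      show "(flat_exp p has_derivative (\<lambda>h. flat_exp ?q x * h)) (at x)" for x
        using flat_exp_derivative unfolding has_field_derivative_def .
      show "Ck_on k UNIV (\<lambda>x. flat_exp ?q x * i)" if "i \<in> Basis" for i
        using that Suc by simp
    qed
  qed
  then show ?thesis by (simp add: smooth_def)
qed

text \<open>\<Phi> is the normalised antiderivative of a bump supported in [0,1]. It serves twice:
  \<Phi> itself as a cutoff, and its derivative \<eta>, nonnegative and of mass one, as the kernel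
  of an approximate identity.\<close>

lemma smooth_step_exists:
  obtains \<Phi> :: "real \<Rightarrow> real" and \<eta> where "smooth \<Phi>"
    "\<And>x. (\<Phi> has_real_derivative \<eta> x) (at x)" "continuous_on UNIV \<eta>" "\<And>x. 0 \<le> \<eta> x"
    "\<And>x. x \<notin> {0..1} \<Longrightarrow> \<eta> x = 0"
    "\<And>x. x \<le> 0 \<Longrightarrow> \<Phi> x = 0" "\<And>x. 1 \<le> x \<Longrightarrow> \<Phi> x = 1"
    "\<And>x. 0 \<le> \<Phi> x" "\<And>x. \<Phi> x \<le> 1"
proof -
  \<comment> \<open>The product of exp(-1/x) with its reflection exp(-1/(1-x)) is positive exactly
    on the open unit interval.\<close>
  define \<psi> where "\<psi> x = flat_exp 1 x * flat_exp 1 (x \<bullet> (-1) + 1)" for x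
  have sm: "smooth \<psi>"
    unfolding \<psi>_def by (intro smooth_mult smooth_flat_exp smooth_compose_affine)
  have nn: "0 \<le> \<psi> x" for x by (simp add: \<psi>_def flat_exp_def)
  have pos: "0 < \<psi> x" if "0 < x" "x < 1" for x using that by (simp add: \<psi>_def flat_exp_def)
  have z: "\<psi> x = 0" if "x \<le> 0 \<or> 1 \<le> x" for x using that by (auto simp: \<psi>_def flat_exp_def)
  have "isCont \<psi> x" for x
    using smooth_imp_continuous[OF sm] by (simp add: continuous_on_eq_continuous_at)
  then have "\<exists>F. \<forall>x. (F has_real_derivative \<psi> x) (at x)"
    using einterval_antiderivative[of "-\<infinity>" "\<infinity>" \<psi>]
    by (simp add: has_real_derivative_iff_has_vector_derivative)
  then obtain F where F: "\<And>x. (F has_real_derivative \<psi> x) (at x)" by blast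
  have cont: "continuous_on A F" for A
    using DERIV_isCont[OF F] by (simp add: continuous_at_imp_continuous_on)
  have mono: "F x \<le> F y" if "x \<le> y" for x y
    by (rule DERIV_nonneg_imp_nondecreasing[OF that]) (use F nn in blast)
  have const: "F x = F y" if "x < y" "y \<le> 0 \<or> 1 \<le> x" for x y
  proof -
    have "F y = F x"
    proof (rule DERIV_isconst2[OF that(1), of F y])
      show "continuous_on {x..y} F"
        by (rule cont)
      show "(F has_real_derivative 0) (at t)" if "x < t" "t < y" for t
        using F[of t] z[of t] that \<open>y \<le> 0 \<or> 1 \<le> x\<close> by (auto simp del: not_le)
    qed (use that in auto)
    then show ?thesis by simp
  qed
  have lt: "F 0 < F 1"
  proof (rule DERIV_pos_imp_increasing_open[of 0 1 F])
    show "\<exists>y. (F has_real_derivative y) (at x) \<and> 0 < y" if "0 < x" "x < 1" for x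
      using F pos[OF that] by blast
  qed (simp_all add: cont)
  define c where "c = F 1 - F 0"
  have c: "c > 0" using lt by (simp add: c_def)
  define \<Phi> where "\<Phi> x = (F x - F 0) / c" for x
  have d: "(\<Phi> has_real_derivative (1 / c) *\<^sub>R \<psi> x) (at x)" for x
    unfolding \<Phi>_def using c by (auto intro!: derivative_eq_intros F)
  have s: "smooth (\<lambda>x. (1 / c) *\<^sub>R \<psi> x)" by (intro smooth_scaleR smooth_const sm)
  show ?thesis
  proof
    show "smooth \<Phi>" by (rule smoothI_real[OF d s])
    show "(\<Phi> has_real_derivative (1 / c) *\<^sub>R \<psi> x) (at x)" for x by (rule d)
    show "continuous_on UNIV (\<lambda>x. (1 / c) *\<^sub>R \<psi> x)" using s by (rule smooth_imp_continuous)
    show "0 \<le> (1 / c) *\<^sub>R \<psi> x" for x using c nn by simp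
    show "(1 / c) *\<^sub>R \<psi> x = 0" if "x \<notin> {0..1}" for x using z that by auto
    show l: "\<Phi> x = 0" if "x \<le> 0" for x
      using const[of x 0] that by (cases "x = 0") (auto simp: \<Phi>_def)
    show r: "\<Phi> x = 1" if "1 \<le> x" for x
      using const[of 1 x] that c by (cases "x = 1") (auto simp: \<Phi>_def c_def)
    show "0 \<le> \<Phi> x" for x
      using mono[of 0 x] c l[of x] by (cases "x \<le> 0") (auto simp: \<Phi>_def)
    show "\<Phi> x \<le> 1" for x
      using mono[of x 1] c r[of x] by (cases "x \<ge> 1") (auto simp: \<Phi>_def c_def field_simps)
  qed
qed

section \<open>Density in the space of square-integrable fields\<close>

lemma sq_integrable_rep: "sq_integrable (rep_l2vec u)"
  using Quotient_rep_reflp[OF Quotient_l2vec] by (simp add: l2_rel_def)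

lemma abs_rep_l2vec: "abs_l2vec (rep_l2vec u) = u"
  by (rule Quotient_abs_rep[OF Quotient_l2vec])

lemma l2_rel_refl: "sq_integrable f \<Longrightarrow> l2_rel f f"
  by (simp add: l2_rel_def)

lemma rep_abs_l2vec: "sq_integrable f \<Longrightarrow> AE x in lborel. rep_l2vec (abs_l2vec f) x = f x"
  using Quotient_rep_abs[OF Quotient_l2vec l2_rel_refl] by (simp add: l2_rel_def)

lemma abs_l2vec_inner:
  "sq_integrable f \<Longrightarrow> sq_integrable g \<Longrightarrow>
    abs_l2vec f \<bullet> abs_l2vec g = (LINT x|lborel. f x \<bullet> g x)"
  by (simp add: inner_l2vec.abs_eq l2_rel_refl)

lemma abs_l2vec_norm:
  "sq_integrable f \<Longrightarrow> (norm (abs_l2vec f))\<^sup>2 = (LINT x|lborel. (norm (f x))\<^sup>2)"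
  by (simp add: power2_norm_eq_inner abs_l2vec_inner)

lemma abs_l2vec_add:
  "sq_integrable f \<Longrightarrow> sq_integrable g \<Longrightarrow>
    abs_l2vec (\<lambda>x. f x + g x) = abs_l2vec f + abs_l2vec g"
  by (simp add: plus_l2vec.abs_eq l2_rel_refl)

lemma abs_l2vec_diff:
  "sq_integrable f \<Longrightarrow> sq_integrable g \<Longrightarrow>
    abs_l2vec (\<lambda>x. f x - g x) = abs_l2vec f - abs_l2vec g"
  by (simp add: minus_l2vec.abs_eq l2_rel_refl)

lemma abs_l2vec_scaleR:
  "sq_integrable f \<Longrightarrow> abs_l2vec (\<lambda>x. c *\<^sub>R f x) = c *\<^sub>R abs_l2vec f"
  by (simp add: scaleR_l2vec.abs_eq l2_rel_refl)

lemma abs_l2vec_zero: "abs_l2vec (\<lambda>x. 0) = 0"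
  by (simp add: zero_l2vec_def)

lemma abs_l2vec_sum:
  assumes "finite S" "\<And>i. i \<in> S \<Longrightarrow> sq_integrable (F i)"
  shows "sq_integrable (\<lambda>x. \<Sum>i\<in>S. F i x)" (is ?A)
    and "abs_l2vec (\<lambda>x. \<Sum>i\<in>S. F i x) = (\<Sum>i\<in>S. abs_l2vec (F i))" (is ?B)
proof -
  have "?A \<and> ?B" using assms
  proof (induction S rule: finite_induct)
    case empty
    show ?case by (simp add: sq_integrable_zero abs_l2vec_zero)
  next
    case (insert i S)
    then have "sq_integrable (F i)" "sq_integrable (\<lambda>x. \<Sum>i\<in>S. F i x)"
      "abs_l2vec (\<lambda>x. \<Sum>i\<in>S. F i x) = (\<Sum>i\<in>S. abs_l2vec (F i))" by auto
    then show ?case using insert.hyps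
      by (simp add: sq_integrable_add abs_l2vec_add)
  qed
  then show ?A ?B by auto
qed

lemma sq_integrable_bound:
  assumes "f \<in> borel_measurable borel" "integrable lborel (\<lambda>x. (w x)\<^sup>2)"
    "AE x in lborel. norm (f x) \<le> w x"
  shows "sq_integrable f"
  unfolding sq_integrable_def
proof
  show "integrable lborel (\<lambda>x. (norm (f x))\<^sup>2)"
  proof (rule Bochner_Integration.integrable_bound[OF assms(2)])
    show "(\<lambda>x. (norm (f x))\<^sup>2) \<in> borel_measurable lborel" using assms(1) by simp
    show "AE x in lborel. norm ((norm (f x))\<^sup>2) \<le> norm ((w x)\<^sup>2)"
      using assms(3) by eventually_elim (simp add: power_mono)
  qed
qed (use assms(1) in simp)

lemma sq_integrable_indicator:
  assumes "sq_integrable f" "A \<in> sets borel"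
  shows "sq_integrable (\<lambda>x. indicator A x *\<^sub>R f x)"
proof (rule sq_integrable_bound)
  show "integrable lborel (\<lambda>x. (norm (f x))\<^sup>2)" using assms by (simp add: sq_integrable_def)
  have "f \<in> borel_measurable borel" using assms(1) by (simp add: sq_integrable_def)
  then show "(\<lambda>x. indicator A x *\<^sub>R f x) \<in> borel_measurable borel" using assms(2) by simp
qed (auto simp: indicator_def)

text \<open>Dominated convergence in L^2: both \<open>F n\<close> and the limit are bounded by
  \<open>w\<close>, so the squared difference is at most 4 w^2, which is integrable.\<close>

lemma tendsto_abs_l2vec:
  assumes F: "\<And>n. F n \<in> borel_measurable borel" and f: "f \<in> borel_measurable borel"
    and w: "integrable lborel (\<lambda>x. (w x)\<^sup>2)" "\<And>n. AE x in lborel. norm (F n x) \<le> w x"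
    and lim: "AE x in lborel. (\<lambda>n. F n x) \<longlonglongrightarrow> f x"
  shows "(\<lambda>n. abs_l2vec (F n)) \<longlonglongrightarrow> abs_l2vec f"
proof -
  have w': "AE x in lborel. \<forall>n. norm (F n x) \<le> w x" using w(2) by (simp add: AE_all_countable)
  then have fw: "AE x in lborel. norm (f x) \<le> w x"
    using lim by eventually_elim (auto intro: LIMSEQ_le_const2 tendsto_norm)
  have sF: "sq_integrable (F n)" for n by (rule sq_integrable_bound[OF F w])
  have sf: "sq_integrable f" by (rule sq_integrable_bound[OF f w(1) fw])
  have [measurable]: "F n \<in> borel_measurable borel" "f \<in> borel_measurable borel" for n by fact+
  have "(\<lambda>n. LINT x|lborel. (norm (F n x - f x))\<^sup>2) \<longlonglongrightarrow> (LINT x|(lborel :: (real^3) measure). 0 :: real)"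
  proof (rule integral_dominated_convergence)
    show "integrable lborel (\<lambda>x. 4 * (w x)\<^sup>2)" using w(1) by simp
    show "AE x in lborel. (\<lambda>n. (norm (F n x - f x))\<^sup>2) \<longlonglongrightarrow> 0"
      using lim
    proof eventually_elim
      case (elim x)
      then have "(\<lambda>n. (norm (F n x - f x))\<^sup>2) \<longlonglongrightarrow> (norm (f x - f x))\<^sup>2"
        by (intro tendsto_intros)
      then show ?case by simp
    qed
    show "AE x in lborel. norm ((norm (F n x - f x))\<^sup>2) \<le> 4 * (w x)\<^sup>2" for n
      using w(2)[of n] fw
    proof eventually_elim
      case (elim x)
      have "norm (F n x - f x) \<le> 2 * w x" using elim norm_triangle_ineq4[of "F n x" "f x"] by simp
      then have "(norm (F n x - f x))\<^sup>2 \<le> (2 * w x)\<^sup>2" by (intro power_mono) auto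
      then show ?case by (simp add: power_mult_distrib)
    qed
  qed measurable
  moreover have "(norm (abs_l2vec (F n) - abs_l2vec f))\<^sup>2 = (LINT x|lborel. (norm (F n x - f x))\<^sup>2)" for n
    by (simp add: abs_l2vec_diff[symmetric] abs_l2vec_norm sq_integrable_diff sF sf)
  ultimately have "(\<lambda>n. (norm (abs_l2vec (F n) - abs_l2vec f))\<^sup>2) \<longlonglongrightarrow> 0" by simp
  from tendsto_real_sqrt[OF this] have "(\<lambda>n. norm (abs_l2vec (F n) - abs_l2vec f)) \<longlonglongrightarrow> 0" by simp
  then have "(\<lambda>n. abs_l2vec (F n) - abs_l2vec f) \<longlonglongrightarrow> 0" by (rule tendsto_norm_zero_cancel)
  then show ?thesis by (rule LIM_zero_cancel)
qed

section \<open>Rational boxes and approximation from box indicators\<close>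

text \<open>One family with three properties: countable, for separability; a topological basis, so
  that it generates the Borel sets and exhausts open sets; stable under intersection, for the Dynkin
  argument.\<close>

definition rational_box_set :: "(real^3) set set" where
  "rational_box_set = {box a b | a b. (\<forall>i\<in>Basis. a \<bullet> i \<in> \<rat>) \<and> (\<forall>i\<in>Basis. b \<bullet> i \<in> \<rat>)}"

lemma countable_rational_box_set: "countable rational_box_set"
proof -
  let ?p = "\<lambda>f. \<Sum>i\<in>Basis. f i *\<^sub>R (i :: real^3)" and ?P = "Basis \<rightarrow>\<^sub>E \<rat> :: (real^3 \<Rightarrow> real) set"
  have "countable ?P" by (intro countable_PiE countable_rat) simp
  moreover have "rational_box_set \<subseteq> (\<lambda>(f, g). box (?p f) (?p g)) ` (?P \<times> ?P)"
  proof
    fix B assume "B \<in> rational_box_set"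
    then obtain a b where B: "B = box a b" "\<forall>i\<in>Basis. a \<bullet> i \<in> \<rat>" "\<forall>i\<in>Basis. b \<bullet> i \<in> \<rat>"
      by (auto simp: rational_box_set_def)
    have r: "?p (restrict (\<lambda>i. c \<bullet> i) Basis) = c" for c :: "real^3"
      by (simp add: euclidean_representation)
    have "(restrict (\<lambda>i. a \<bullet> i) Basis, restrict (\<lambda>i. b \<bullet> i) Basis) \<in> ?P \<times> ?P" using B by auto
    then have "(\<lambda>(f, g). box (?p f) (?p g)) (restrict (\<lambda>i. a \<bullet> i) Basis, restrict (\<lambda>i. b \<bullet> i) Basis)
        \<in> (\<lambda>(f, g). box (?p f) (?p g)) ` (?P \<times> ?P)" by (rule imageI)
    then show "B \<in> (\<lambda>(f, g). box (?p f) (?p g)) ` (?P \<times> ?P)"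
      unfolding prod.case r B(1) .
  qed
  ultimately show ?thesis by (meson countable_SIGMA countable_image countable_subset)
qed

lemma rational_box_basis: "topological_basis rational_box_set"
proof (rule topological_basisI)
  show "open B" if "B \<in> rational_box_set" for B
    using that by (auto simp: rational_box_set_def open_box)
next
  fix O' :: "(real^3) set" and x assume "open O'" "x \<in> O'"
  then obtain e where e: "e > 0" "ball x e \<subseteq> O'" by (auto simp: open_contains_ball)
  from e(1) have "\<exists>a b. (\<forall>i\<in>Basis. a \<bullet> i \<in> \<rat> \<and> b \<bullet> i \<in> \<rat>) \<and> x \<in> box a b \<and> box a b \<subseteq> ball x e"
    by (rule rational_boxes)
  then obtain a b where ab: "\<forall>i\<in>Basis. a \<bullet> i \<in> \<rat> \<and> b \<bullet> i \<in> \<rat>" "x \<in> box a b" "box a b \<subseteq> ball x e"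
    by auto
  then have "box a b \<in> rational_box_set" by (auto simp: rational_box_set_def)
  then show "\<exists>B'\<in>rational_box_set. x \<in> B' \<and> B' \<subseteq> O'"
    using ab e(2) by (intro bexI[of _ "box a b"]) auto
qed

lemma rational_box_Int:
  assumes "A \<in> rational_box_set" "B \<in> rational_box_set"
  shows "A \<inter> B \<in> rational_box_set"
proof -
  obtain a b c d where AB: "A = box a b" "B = box c d" and r: "\<forall>i\<in>Basis. a \<bullet> i \<in> \<rat>"
    "\<forall>i\<in>Basis. b \<bullet> i \<in> \<rat>" "\<forall>i\<in>Basis. c \<bullet> i \<in> \<rat>" "\<forall>i\<in>Basis. d \<bullet> i \<in> \<rat>"
    using assms by (auto simp: rational_box_set_def)
  let ?l = "\<Sum>i\<in>Basis. max (a \<bullet> i) (c \<bullet> i) *\<^sub>R i" and ?u = "\<Sum>i\<in>Basis. min (b \<bullet> i) (d \<bullet> i) *\<^sub>R i"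
  have "\<forall>i\<in>Basis. ?l \<bullet> i \<in> \<rat>" "\<forall>i\<in>Basis. ?u \<bullet> i \<in> \<rat>"
    using r by (simp_all add: inner_sum_left_Basis max_def min_def)
  moreover have "A \<inter> B = box ?l ?u" unfolding AB by (rule box_Int_box)
  ultimately show ?thesis unfolding rational_box_set_def by blast
qed

lemma sq_integrable_indicator_const:
  fixes A :: "(real^3) set"
  assumes "A \<in> sets borel" "bounded A"
  shows "sq_integrable (\<lambda>x. indicator A x *\<^sub>R c)"
proof (rule sq_integrable_bound)
  have "emeasure lborel A < \<infinity>" by (rule emeasure_bounded_finite[OF assms(2)])
  then have "integrable lborel (\<lambda>x. indicator A x * (norm c)\<^sup>2 :: real)"
    using assms(1) by (intro integrable_mult_left integrable_real_indicator) auto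
  moreover have "indicator A x * (norm c)\<^sup>2 = (indicator A x * norm c)\<^sup>2" for x
    by (simp add: indicator_def)
  ultimately show "integrable lborel (\<lambda>x. (indicator A x * norm c)\<^sup>2)" by simp
qed (use assms in \<open>auto simp: indicator_def\<close>)

text \<open>The class of fields lying in \<open>C\<close> is enlarged in stages: from boxes to Borel
  subsets of a box by Dynkin's theorem, from there to simple functions by linearity, to
  square-integrable fields on a box by dominated convergence, and to all of \<Omega> by exhausting
  it with countably many boxes. Both the density of test functions and separability are
  instances.\<close>

lemma L2_on_subset_closed_subspace:
  assumes "open \<Omega>" "subspace C" "closed C"
    and box: "\<And>B e. B \<in> rational_box_set \<Longrightarrow> B \<subseteq> \<Omega> \<Longrightarrow> e \<in> Basis \<Longrightarrow> l2_of B (\<lambda>_. e) \<in> C"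
  shows "L2_on \<Omega> \<subseteq> C"
proof -
  have bb: "bounded B" "B \<in> sets borel" if "B \<in> rational_box_set" for B
    using that by (auto simp: rational_box_set_def)
  have Cseq: "l \<in> C" if "\<And>n. s n \<in> C" "s \<longlonglongrightarrow> l" for s :: "nat \<Rightarrow> l2vec" and l
    using \<open>closed C\<close> that closed_sequentially by blast
  \<comment> \<open>Every set is intersected with a fixed bounded box, which keeps complements and
    countable unions of finite measure and provides the dominating function
    \<open>indicator B\<close>.\<close>
  have step1: "l2_of (B \<inter> A) (\<lambda>_. e) \<in> C"
    if B: "B \<in> rational_box_set" "B \<subseteq> \<Omega>" and e: "e \<in> Basis" and A: "A \<in> sets borel" for A B e
  proof -
    have sq: "sq_integrable (\<lambda>x. indicator (B \<inter> A) x *\<^sub>R e)" if "A \<in> sets borel" for A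
      using bb[OF B(1)] that by (intro sq_integrable_indicator_const) auto
    have gen: "sets (borel :: (real^3) measure) = sigma_sets UNIV rational_box_set"
      unfolding borel_eq_countable_basis[OF countable_rational_box_set rational_box_basis]
      by (simp add: sets_measure_of)
    have wB: "integrable lborel (\<lambda>x. (indicator B x :: real)\<^sup>2)"
    proof -
      have "(indicator B x :: real)\<^sup>2 = indicator B x" for x by (simp add: indicator_def)
      then show ?thesis using bb[OF B(1)] emeasure_bounded_finite[of B]
        by (simp add: integrable_real_indicator)
    qed
    have "Int_stable rational_box_set" using rational_box_Int by (auto simp: Int_stable_def)
    moreover have "rational_box_set \<subseteq> Pow UNIV" by simp
    moreover have "A \<in> sigma_sets UNIV rational_box_set" using A gen by simp
    ultimately show ?thesis
    proof (induction rule: sigma_sets_induct_disjoint)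
      case (basic A)
      then show ?case using rational_box_Int[OF B(1) basic] B(2) e by (intro box) auto
    next
      case empty
      show ?case using subspace_0[OF \<open>subspace C\<close>] by (simp add: l2_of_def abs_l2vec_zero)
    next
      case (compl A)
      then have "A \<in> sets borel" using gen by simp
      have "(\<lambda>x. indicator (B \<inter> (UNIV - A)) x *\<^sub>R e) =
          (\<lambda>x. indicator (B \<inter> UNIV) x *\<^sub>R e - indicator (B \<inter> A) x *\<^sub>R e)"
        by (auto simp: indicator_def)
      then have "l2_of (B \<inter> (UNIV - A)) (\<lambda>_. e) = l2_of (B \<inter> UNIV) (\<lambda>_. e) - l2_of (B \<inter> A) (\<lambda>_. e)"
        unfolding l2_of_def using abs_l2vec_diff[OF sq[of UNIV] sq[OF \<open>A \<in> sets borel\<close>]] by simp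
      moreover have "l2_of (B \<inter> UNIV) (\<lambda>_. e) \<in> C" using box[OF B e] by simp
      ultimately show ?case using compl subspace_diff[OF \<open>subspace C\<close>] by simp
    next
      case (union A)
      then have A: "A n \<in> sets borel" for n using gen by auto
      have fin: "l2_of (B \<inter> (\<Union>i<n. A i)) (\<lambda>_. e) \<in> C" for n
      proof (induction n)
        case 0
        show ?case using subspace_0[OF \<open>subspace C\<close>] by (simp add: l2_of_def abs_l2vec_zero)
      next
        case (Suc n)
        have "indicator (B \<inter> (\<Union>i<Suc n. A i)) x = (indicator (B \<inter> (\<Union>i<n. A i)) x + indicator (B \<inter> A n) x :: real)" for x
        proof -
          have "x \<notin> A i" if "x \<in> A n" "i < n" for i
            using disjoint_family_onD[OF union.hyps(1), of i n] that by auto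
          then show ?thesis by (auto simp: indicator_def lessThan_Suc)
        qed
        then have "l2_of (B \<inter> (\<Union>i<Suc n. A i)) (\<lambda>_. e) = l2_of (B \<inter> (\<Union>i<n. A i)) (\<lambda>_. e) + l2_of (B \<inter> A n) (\<lambda>_. e)"
          unfolding l2_of_def scaleR_left_distrib using A by (subst abs_l2vec_add[symmetric]) (auto intro!: sq simp: scaleR_left_distrib)
        then show ?case using Suc union.IH subspace_add[OF \<open>subspace C\<close>] by simp
      qed
      show ?case
      proof (rule Cseq[OF fin])
        show "(\<lambda>n. l2_of (B \<inter> (\<Union>i<n. A i)) (\<lambda>_. e)) \<longlonglongrightarrow> l2_of (B \<inter> \<Union>(range A)) (\<lambda>_. e)"
          unfolding l2_of_def
        proof (rule tendsto_abs_l2vec[OF _ _ wB])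
          show "(\<lambda>x. indicator (B \<inter> (\<Union>i<n. A i)) x *\<^sub>R e) \<in> borel_measurable borel" for n
            using A bb[OF B(1)] by auto
          show "(\<lambda>x. indicator (B \<inter> \<Union>(range A)) x *\<^sub>R e) \<in> borel_measurable borel"
            using A bb[OF B(1)] by auto
          show "AE x in lborel. norm (indicator (B \<inter> (\<Union>i<n. A i)) x *\<^sub>R e) \<le> indicator B x" for n
            using e by (auto simp: indicator_def)
          show "AE x in lborel. (\<lambda>n. indicator (B \<inter> (\<Union>i<n. A i)) x *\<^sub>R e) \<longlonglongrightarrow> indicator (B \<inter> \<Union>(range A)) x *\<^sub>R e"
          proof (rule AE_I2)
            fix x
            show "(\<lambda>n. indicator (B \<inter> (\<Union>i<n. A i)) x *\<^sub>R e) \<longlonglongrightarrow> indicator (B \<inter> \<Union>(range A)) x *\<^sub>R e"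
            proof (cases "x \<in> B \<inter> \<Union>(range A)")
              case True
              then obtain m where m: "x \<in> B" "x \<in> A m" by auto
              show ?thesis
                by (rule tendsto_eventually, rule eventually_sequentiallyI[of "Suc m"])
                  (use m in \<open>auto simp: indicator_def\<close>)
            next
              case False
              then show ?thesis by (intro tendsto_eventually always_eventually) (auto simp: indicator_def)
            qed
          qed
        qed
      qed
    qed
  qed
  have step2: "l2_of B f \<in> C" if B: "B \<in> rational_box_set" "B \<subseteq> \<Omega>" and f: "sq_integrable f" for B f
  proof -
    have fm: "f \<in> borel_measurable lborel" using f by (simp add: sq_integrable_def)
    from borel_measurable_implies_sequence_metric[OF this, of 0] obtain s where
      s: "\<And>i. simple_function lborel (s i)" "\<And>x. (\<lambda>i. s i x) \<longlonglongrightarrow> f x"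
        "\<And>i x. norm (s i x) \<le> 2 * norm (f x)"
      by (auto simp: dist_norm)
    have "l2_of B (s i) \<in> C" for i
    proof -
      let ?A = "\<lambda>y. s i -` {y}" and ?R = "range (s i)"
      have fin: "finite ?R" and m: "?A y \<in> sets borel" if "y \<in> ?R" for y
        using s(1)[of i] that by (auto simp: simple_function_def)
      have fin: "finite ?R" using s(1)[of i] by (auto simp: simple_function_def)
      \<comment> \<open>Each value y of the simple function is split along the basis, since
        membership in \<open>C\<close> is known only for basis vectors on measurable sets.\<close>
      let ?F = "\<lambda>(y, e) x. (y \<bullet> e) *\<^sub>R (indicator (B \<inter> ?A y) x *\<^sub>R (e :: real^3))"
      have sqF: "sq_integrable (?F p)" if "p \<in> ?R \<times> Basis" for p
      proof -
        obtain y e where ye: "p = (y, e)" by force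
        then have "sq_integrable (\<lambda>x. indicator (B \<inter> ?A y) x *\<^sub>R e)"
          using that bb[OF B(1)] m by (intro sq_integrable_indicator_const) (auto simp: bounded_Int)
        then show ?thesis unfolding ye prod.case by (rule sq_integrable_scaleR)
      qed
      have eq: "indicator B x *\<^sub>R s i x = (\<Sum>p\<in>?R \<times> Basis. ?F p x)" for x
      proof -
        have "(\<Sum>p\<in>?R \<times> Basis. ?F p x) = (\<Sum>y\<in>?R. \<Sum>e\<in>Basis. ?F (y, e) x)"
          by (simp add: sum.cartesian_product split_def)
        also have "\<dots> = (\<Sum>y\<in>?R. indicator (B \<inter> ?A y) x *\<^sub>R y)"
        proof (rule sum.cong[OF refl])
          fix y
          have "(\<Sum>e\<in>Basis. ?F (y, e) x) = indicator (B \<inter> ?A y) x *\<^sub>R (\<Sum>e\<in>Basis. (y \<bullet> e) *\<^sub>R e)"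
            by (simp add: scaleR_sum_right mult.commute)
          then show "(\<Sum>e\<in>Basis. ?F (y, e) x) = indicator (B \<inter> ?A y) x *\<^sub>R y"
            by (simp only: euclidean_representation)
        qed
        also have "\<dots> = (\<Sum>y\<in>?R. if y = s i x then indicator B x *\<^sub>R s i x else 0)"
          by (rule sum.cong) (auto simp: indicator_def)
        also have "\<dots> = indicator B x *\<^sub>R s i x" using fin by (simp add: sum.delta)
        finally show ?thesis ..
      qed
      have "l2_of B (s i) = (\<Sum>p\<in>?R \<times> Basis. abs_l2vec (?F p))"
        unfolding l2_of_def eq by (rule abs_l2vec_sum) (use fin sqF in auto)
      also have "\<dots> \<in> C"
      proof (rule subspace_sum[OF \<open>subspace C\<close>])
        fix p :: "(real^3) \<times> (real^3)" assume p: "p \<in> ?R \<times> Basis"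
        obtain y e where ye: "p = (y, e)" by force
        have "abs_l2vec (?F p) = (y \<bullet> e) *\<^sub>R l2_of (B \<inter> ?A y) (\<lambda>_. e)"
          unfolding l2_of_def ye prod.case
          by (intro abs_l2vec_scaleR sq_integrable_indicator_const)
            (use p ye bb[OF B(1)] m in \<open>auto simp: bounded_Int\<close>)
        moreover have "l2_of (B \<inter> ?A y) (\<lambda>_. e) \<in> C"
          using p ye m by (intro step1 B) auto
        ultimately show "abs_l2vec (?F p) \<in> C" using subspace_scale[OF \<open>subspace C\<close>] by simp
      qed
      finally show ?thesis .
    qed
    then show ?thesis
    proof (rule Cseq)
      have w: "integrable lborel (\<lambda>x. (2 * norm (f x))\<^sup>2)"
        using f by (simp add: sq_integrable_def power_mult_distrib)
      show "(\<lambda>i. l2_of B (s i)) \<longlonglongrightarrow> l2_of B f"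
        unfolding l2_of_def
      proof (rule tendsto_abs_l2vec[OF _ _ w])
        show "(\<lambda>x. indicator B x *\<^sub>R s n x) \<in> borel_measurable borel" for n
          using borel_measurable_simple_function[OF s(1)] bb[OF B(1)] by auto
        show "(\<lambda>x. indicator B x *\<^sub>R f x) \<in> borel_measurable borel"
          using fm bb[OF B(1)] by auto
        show "AE x in lborel. norm (indicator B x *\<^sub>R s n x) \<le> 2 * norm (f x)" for n
          using s(3) by (auto simp: indicator_def)
        show "AE x in lborel. (\<lambda>n. indicator B x *\<^sub>R s n x) \<longlonglongrightarrow> indicator B x *\<^sub>R f x"
          using s(2) by (auto intro!: tendsto_intros)
      qed
    qed
  qed
  show ?thesis
  proof
    fix u assume u: "u \<in> L2_on \<Omega>"
    let ?f = "rep_l2vec u" and ?S = "{B \<in> rational_box_set. B \<subseteq> \<Omega>}"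
    have ne: "?S \<noteq> {}"
    proof -
      have "box 0 (0 :: real^3) \<in> rational_box_set"
        unfolding rational_box_set_def by (intro CollectI exI[of _ 0] conjI refl) auto
      moreover have "box 0 (0 :: real^3) \<subseteq> \<Omega>" by simp
      ultimately show ?thesis by blast
    qed
    have cS: "countable ?S" by (rule countable_subset[OF _ countable_rational_box_set]) auto
    define B where "B = from_nat_into ?S"
    have B: "B n \<in> rational_box_set" "B n \<subseteq> \<Omega>" for n
      using from_nat_into[OF ne, of n] by (auto simp: B_def)
    have UB: "(\<Union>n. B n) = \<Omega>"
    proof -
      have "range B = ?S" unfolding B_def by (rule range_from_nat_into[OF ne cS])
      moreover have "\<Union>?S = \<Omega>"
        using topological_basisE[OF rational_box_basis \<open>open \<Omega>\<close>] by blast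
      ultimately show ?thesis by metis
    qed
    have sq: "sq_integrable ?f" by (rule sq_integrable_rep)
    then have fm: "?f \<in> borel_measurable borel" by (simp add: sq_integrable_def)
    have bm: "B n \<in> sets borel" for n using bb(2)[OF B(1)] .
    let ?U = "\<lambda>n. \<Union>i<n. B i"
    have fin: "l2_of (?U n) ?f \<in> C" for n
    proof (induction n)
      case 0
      show ?case using subspace_0[OF \<open>subspace C\<close>] by (simp add: l2_of_def abs_l2vec_zero)
    next
      case (Suc n)
      \<comment> \<open>The boxes overlap; cutting the field off on the part already covered makes
        the contribution of the n-th box additive.\<close>
      let ?g = "\<lambda>x. indicator (- ?U n) x *\<^sub>R ?f x"
      have um: "?U n \<in> sets borel" "?U (Suc n) \<in> sets borel" using bm by auto
      have sg: "sq_integrable ?g"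
        by (intro sq_integrable_indicator[OF sq]) (use um in \<open>simp only: borel_comp\<close>)
      have *: "indicator (?U (Suc n)) x *\<^sub>R ?f x = indicator (?U n) x *\<^sub>R ?f x + indicator (B n) x *\<^sub>R ?g x" for x
        by (auto simp: indicator_def lessThan_Suc)
      have "l2_of (?U (Suc n)) ?f = l2_of (?U n) ?f + l2_of (B n) ?g"
        unfolding l2_of_def *
        by (intro abs_l2vec_add sq_integrable_indicator[OF sq] sq_integrable_indicator[OF sg] um bm)
      then show ?case using Suc step2[OF B sg] subspace_add[OF \<open>subspace C\<close>] by simp
    qed
    have "(\<lambda>n. l2_of (?U n) ?f) \<longlonglongrightarrow> abs_l2vec ?f"
      unfolding l2_of_def
    proof (rule tendsto_abs_l2vec)
      show "integrable lborel (\<lambda>x. (norm (?f x))\<^sup>2)" using sq by (simp add: sq_integrable_def)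
      show "(\<lambda>x. indicator (?U n) x *\<^sub>R ?f x) \<in> borel_measurable borel" for n
        using fm bm by auto
      show "AE x in lborel. norm (indicator (?U n) x *\<^sub>R ?f x) \<le> norm (?f x)" for n
        by (auto simp: indicator_def)
      show "AE x in lborel. (\<lambda>n. indicator (?U n) x *\<^sub>R ?f x) \<longlonglongrightarrow> ?f x"
        using u[unfolded L2_on_def, simplified]
      proof eventually_elim
        case (elim x)
        show ?case
        proof (cases "x \<in> \<Omega>")
          case True
          then obtain m where m: "x \<in> B m" using UB by auto
          show ?thesis
            by (rule tendsto_eventually, rule eventually_sequentiallyI[of "Suc m"])
              (use m in \<open>auto simp: indicator_def\<close>)
        qed (use elim in simp)
      qed
    qed (use fm in auto)
    from Cseq[OF fin this] show "u \<in> C" by (simp add: abs_rep_l2vec)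
  qed
qed

section \<open>Test functions and their density\<close>

lemma sq_integrable_on_bounded:
  assumes "continuous_on UNIV w" "bounded \<Omega>" "\<Omega> \<in> sets borel"
  shows "sq_integrable (\<lambda>x. indicator \<Omega> x *\<^sub>R w x)"
proof -
  have "compact (w ` closure \<Omega>)"
    using assms by (intro compact_continuous_image) (auto intro: continuous_on_subset)
  then obtain M where "0 < M" "\<forall>y\<in>w ` closure \<Omega>. norm y \<le> M"
    using compact_imp_bounded[of "w ` closure \<Omega>"] unfolding bounded_pos by blast
  then have M: "norm (w x) \<le> M" "0 \<le> M" if "x \<in> closure \<Omega>" for x using that by auto
  have M2: "0 \<le> M" using \<open>0 < M\<close> by simp
  \<comment> \<open>A constant vector of length M, so that the constant field on the bounded set
    \<Omega> is a square-integrable majorant.\<close>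
  obtain c :: "real^3" where c: "norm c = M" using vector_choose_size[OF M2] by blast
  show ?thesis
  proof (rule sq_integrable_bound)
    show "integrable lborel (\<lambda>x. (norm (indicator \<Omega> x *\<^sub>R c))\<^sup>2)"
      using sq_integrable_indicator_const[OF assms(3,2), of c] unfolding sq_integrable_def by blast
    show "(\<lambda>x. indicator \<Omega> x *\<^sub>R w x) \<in> borel_measurable borel"
      using assms by (intro borel_measurable_scaleR borel_measurable_indicator borel_measurable_continuous_onI)
    show "AE x in lborel. norm (indicator \<Omega> x *\<^sub>R w x) \<le> norm (indicator \<Omega> x *\<^sub>R c)"
      using M(1) c closure_subset[of \<Omega>] by (auto simp: indicator_def)
  qed
qed

lemma test_functions_pd:
  assumes "\<phi> \<in> test_functions U" "i \<in> Basis"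
  shows "pd i \<phi> \<in> test_functions U"
proof -
  obtain K where K: "compact K" "K \<subseteq> U" "\<And>x. x \<notin> K \<Longrightarrow> \<phi> x = 0" and s: "smooth \<phi>"
    using assms(1) by (auto simp: test_functions_def)
  have "pd i \<phi> x = 0" if "x \<notin> K" for x
  proof -
    have "(\<phi> has_derivative (\<lambda>_. 0)) (at x)"
      by (rule has_derivative_transform_within_open[of "\<lambda>_. 0" _ x _ "- K"])
        (use that K in \<open>auto simp: compact_imp_closed\<close>)
    then show ?thesis by (rule pd_eqI)
  qed
  then show ?thesis using K smooth_pd[OF s assms(2)] unfolding test_functions_def by blast
qed

lemma test_functions_add:
  assumes "f \<in> test_functions U" "g \<in> test_functions U"
  shows "(\<lambda>x. f x + g x) \<in> test_functions U"
proof -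
  obtain K L where "compact K" "K \<subseteq> U" "\<And>x. x \<notin> K \<Longrightarrow> f x = 0"
    "compact L" "L \<subseteq> U" "\<And>x. x \<notin> L \<Longrightarrow> g x = 0" "smooth f" "smooth g"
    using assms by (auto simp: test_functions_def)
  then have "smooth (\<lambda>x. f x + g x)" "compact (K \<union> L)" "K \<union> L \<subseteq> U" "\<forall>x. x \<notin> K \<union> L \<longrightarrow> f x + g x = 0"
    by (auto intro: smooth_add)
  then show ?thesis unfolding test_functions_def by blast
qed

lemma test_functions_scaleR:
  assumes "f \<in> test_functions U"
  shows "(\<lambda>x. c *\<^sub>R f x) \<in> test_functions U"
proof -
  obtain K where K: "compact K" "K \<subseteq> U" "\<And>x. x \<notin> K \<Longrightarrow> f x = 0" and "smooth f"
    using assms by (auto simp: test_functions_def)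
  then have "smooth (\<lambda>x. c *\<^sub>R f x)" by (intro smooth_scaleR smooth_const)
  moreover have "\<forall>x. x \<notin> K \<longrightarrow> c *\<^sub>R f x = 0" using K(3) by simp
  ultimately show ?thesis using K(1,2) unfolding test_functions_def by blast
qed

lemma test_functions_zero: "(\<lambda>x. 0) \<in> test_functions U"
  by (auto simp: test_functions_def smooth_const intro!: exI[of _ "{}"])

lemma test_function_sq_integrable:
  assumes "\<phi> \<in> test_functions \<Omega>"
  shows "sq_integrable \<phi>" "(\<lambda>x. indicator \<Omega> x *\<^sub>R \<phi> x) = \<phi>" "l2_of \<Omega> \<phi> = abs_l2vec \<phi>"
proof -
  obtain K where K: "compact K" "K \<subseteq> \<Omega>" "\<And>x. x \<notin> K \<Longrightarrow> \<phi> x = 0" and s: "smooth \<phi>"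
    using assms by (auto simp: test_functions_def)
  have "\<phi> = (\<lambda>x. indicator K x *\<^sub>R \<phi> x)" using K(3) by (auto simp: indicator_def)
  moreover have "sq_integrable (\<lambda>x. indicator K x *\<^sub>R \<phi> x)"
    using K(1) by (intro sq_integrable_on_bounded smooth_imp_continuous s)
      (auto simp: compact_imp_bounded compact_imp_closed)
  ultimately show "sq_integrable \<phi>" by metis
  show eq: "(\<lambda>x. indicator \<Omega> x *\<^sub>R \<phi> x) = \<phi>"
  proof
    show "indicator \<Omega> x *\<^sub>R \<phi> x = \<phi> x" for x
      using K(2,3) by (cases "x \<in> \<Omega>") auto
  qed
  show "l2_of \<Omega> \<phi> = abs_l2vec \<phi>" by (simp add: l2_of_def eq)
qed

lemma rep_l2vec_add: "AE x in lborel. rep_l2vec (u + v) x = rep_l2vec u x + rep_l2vec v x"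
proof -
  have "u + v = abs_l2vec (\<lambda>x. rep_l2vec u x + rep_l2vec v x)"
    by (simp add: abs_l2vec_add sq_integrable_rep abs_rep_l2vec)
  then show ?thesis
    using rep_abs_l2vec[OF sq_integrable_add[OF sq_integrable_rep[of u] sq_integrable_rep[of v]]] by simp
qed

lemma rep_l2vec_scaleR: "AE x in lborel. rep_l2vec (c *\<^sub>R u) x = c *\<^sub>R rep_l2vec u x"
proof -
  have "c *\<^sub>R u = abs_l2vec (\<lambda>x. c *\<^sub>R rep_l2vec u x)"
    by (simp add: abs_l2vec_scaleR sq_integrable_rep abs_rep_l2vec)
  then show ?thesis
    using rep_abs_l2vec[OF sq_integrable_scaleR[OF sq_integrable_rep[of u], of c]] by simp
qed

lemma subspace_L2_on: "subspace (L2_on \<Omega>)"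
proof (rule subspaceI)
  show "0 \<in> L2_on \<Omega>"
    using rep_abs_l2vec[OF sq_integrable_zero] by (auto simp: L2_on_def abs_l2vec_zero elim: AE_mp)
  show "u + v \<in> L2_on \<Omega>" if "u \<in> L2_on \<Omega>" "v \<in> L2_on \<Omega>" for u v
    using that rep_l2vec_add[of u v] unfolding L2_on_def mem_Collect_eq
    by eventually_elim auto
  show "c *\<^sub>R u \<in> L2_on \<Omega>" if "u \<in> L2_on \<Omega>" for c u
    using that rep_l2vec_scaleR[of c u] unfolding L2_on_def mem_Collect_eq
    by eventually_elim auto
qed

lemma l2_of_in_L2_on:
  assumes "sq_integrable (\<lambda>x. indicator \<Omega> x *\<^sub>R w x)"
  shows "l2_of \<Omega> w \<in> L2_on \<Omega>"
  using rep_abs_l2vec[OF assms] unfolding L2_on_def l2_of_def mem_Collect_eq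
  by eventually_elim simp

lemma subspace_closure:
  fixes S :: "'a::real_normed_vector set"
  assumes "subspace S"
  shows "subspace (closure S)"
proof (rule subspaceI)
  show "0 \<in> closure S" using subspace_0[OF assms] closure_subset by blast
  show "x + y \<in> closure S" if xy: "x \<in> closure S" "y \<in> closure S" for x y
  proof -
    obtain X Y where "\<And>n. X n \<in> S" "X \<longlonglongrightarrow> x" "\<And>n. Y n \<in> S" "Y \<longlonglongrightarrow> y"
      using xy unfolding closure_sequential by blast
    then show ?thesis
      unfolding closure_sequential by (intro exI[of _ "\<lambda>n. X n + Y n"]) (auto intro: subspace_add[OF assms] tendsto_add)
  qed
  show "c *\<^sub>R x \<in> closure S" if x: "x \<in> closure S" for c x
  proof -
    obtain X where "\<And>n. X n \<in> S" "X \<longlonglongrightarrow> x"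
      using x unfolding closure_sequential by blast
    then show ?thesis
      unfolding closure_sequential by (intro exI[of _ "\<lambda>n. c *\<^sub>R X n"]) (auto intro: subspace_scale[OF assms] tendsto_scaleR)
  qed
qed

text \<open>The indicator is approximated by products of one-dimensional steps, one pair for each
  coordinate. They are bounded by the indicator itself and at each point of the open box are
  eventually equal to 1, so convergence in L^2 is dominated convergence.\<close>

lemma box_indicator_in_closure_test_functions:
  fixes a b e :: "real^3"
  assumes B: "box a b \<subseteq> \<Omega>"
  shows "l2_of (box a b) (\<lambda>_. e) \<in> closure (l2_of \<Omega> ` test_functions \<Omega>)"
proof -
  obtain \<Phi> \<eta> :: "real \<Rightarrow> real" where \<Phi>: "smooth \<Phi>" "\<And>x. x \<le> 0 \<Longrightarrow> \<Phi> x = 0" "\<And>x. 1 \<le> x \<Longrightarrow> \<Phi> x = 1"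
    "\<And>x. 0 \<le> \<Phi> x" "\<And>x. \<Phi> x \<le> 1"
    by (rule smooth_step_exists) blast
  define N where "N n = real (Suc n)" for n
  have N: "N n > 0" for n by (simp add: N_def)
  \<comment> \<open>The first factor rises from 0 to 1 between a_i + 1/N and a_i + 2/N, the second
    falls from 1 to 0 between b_i - 2/N and b_i - 1/N. The inner shift by 1/N is what makes the
    support a compact subset of the open box.\<close>
  define p where "p n i x = \<Phi> (x \<bullet> (N n *\<^sub>R i) + (- N n * (a \<bullet> i) - 1)) * \<Phi> (x \<bullet> (- N n *\<^sub>R i) + (N n * (b \<bullet> i) - 1))"
    for n and i x :: "real^3"
  define \<phi> where "\<phi> n x = (\<Prod>i\<in>Basis. p n i x) *\<^sub>R e" for n x
  define K where "K n = {x. \<forall>i\<in>Basis. a \<bullet> i + 1 / N n \<le> x \<bullet> i \<and> x \<bullet> i \<le> b \<bullet> i - 1 / N n}" for n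
  have p01: "0 \<le> p n i x" "p n i x \<le> 1" for n i x
    unfolding p_def using \<Phi>(4,5) by (auto intro: mult_le_one)
  have K: "compact (K n)" "K n \<subseteq> box a b" for n
  proof -
    have "K n = cbox (\<Sum>i\<in>Basis. (a \<bullet> i + 1 / N n) *\<^sub>R i) (\<Sum>i\<in>Basis. (b \<bullet> i - 1 / N n) *\<^sub>R i)"
      unfolding K_def mem_box by (auto simp: cbox_def)
    then show "compact (K n)" using compact_cbox by simp
    show "K n \<subseteq> box a b"
    proof
      fix x assume x: "x \<in> K n"
      have "0 < 1 / N n" using N by simp
      show "x \<in> box a b" unfolding mem_box
      proof
        fix i :: "real^3" assume "i \<in> Basis"
        then have "a \<bullet> i + 1 / N n \<le> x \<bullet> i \<and> x \<bullet> i \<le> b \<bullet> i - 1 / N n" using x by (simp add: K_def)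
        then show "a \<bullet> i < x \<bullet> i \<and> x \<bullet> i < b \<bullet> i" using \<open>0 < 1 / N n\<close> by linarith
      qed
    qed
  qed
  have out: "\<phi> n x = 0" if xK: "x \<notin> K n" for n x
  proof -
    obtain i where i: "i \<in> Basis" "x \<bullet> i < a \<bullet> i + 1 / N n \<or> b \<bullet> i - 1 / N n < x \<bullet> i"
      using xK unfolding K_def mem_Collect_eq de_Morgan_conj ball_simps not_le by blast
    have "p n i x = 0"
      using i(2)
    proof
      assume "x \<bullet> i < a \<bullet> i + 1 / N n"
      then have "N n * (x \<bullet> i) < N n * (a \<bullet> i) + 1" using N[of n] by (simp add: field_simps)
      then show ?thesis by (simp add: p_def \<Phi>(2))
    next
      assume "b \<bullet> i - 1 / N n < x \<bullet> i"
      then have "N n * (b \<bullet> i) < N n * (x \<bullet> i) + 1" using N[of n] by (simp add: field_simps)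
      then show ?thesis by (simp add: p_def \<Phi>(2))
    qed
    then have "(\<Prod>i\<in>Basis. p n i x) = 0" using i(1) by (simp add: prod_zero_iff) blast
    then show ?thesis by (simp add: \<phi>_def)
  qed
  have sm: "smooth (\<phi> n)" for n
    unfolding \<phi>_def p_def
    by (intro smooth_scaleR smooth_const smooth_prod smooth_mult smooth_compose_affine \<Phi>(1)) simp
  have test: "\<phi> n \<in> test_functions \<Omega>" for n
    unfolding test_functions_def using sm K[of n] out B by blast
  have "(\<lambda>n. abs_l2vec (\<phi> n)) \<longlonglongrightarrow> abs_l2vec (\<lambda>x. indicator (box a b) x *\<^sub>R e)"
  proof (rule tendsto_abs_l2vec)
    show "\<phi> n \<in> borel_measurable borel" for n
      by (intro borel_measurable_continuous_onI smooth_imp_continuous sm)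
    show "(\<lambda>x. indicator (box a b) x *\<^sub>R e) \<in> borel_measurable borel" by simp
    show "integrable lborel (\<lambda>x. (norm (indicator (box a b) x *\<^sub>R e))\<^sup>2)"
      using sq_integrable_indicator_const[of "box a b" e] unfolding sq_integrable_def by auto
    show "AE x in lborel. norm (\<phi> n x) \<le> norm (indicator (box a b) x *\<^sub>R e)" for n
    proof (rule AE_I2)
      fix x
      have "(\<Prod>i\<in>Basis. p n i x) \<le> 1" "0 \<le> (\<Prod>i\<in>Basis. p n i x)" by (auto intro: prod_le_1 prod_nonneg p01)
      then have "norm (\<phi> n x) \<le> 1 * norm e" unfolding \<phi>_def norm_scaleR by (intro mult_right_mono) auto
      then show "norm (\<phi> n x) \<le> norm (indicator (box a b) x *\<^sub>R e)"
        using out[of x n] K(2)[of n] by (cases "x \<in> box a b") auto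
    qed
    show "AE x in lborel. (\<lambda>n. \<phi> n x) \<longlonglongrightarrow> indicator (box a b) x *\<^sub>R e"
    proof (rule AE_I2)
      fix x
      show "(\<lambda>n. \<phi> n x) \<longlonglongrightarrow> indicator (box a b) x *\<^sub>R e"
      proof (cases "x \<in> box a b")
        case True
        have "\<forall>i\<in>Basis. eventually (\<lambda>n. p n i x = 1) sequentially"
        proof
          fix i :: "real^3" assume i: "i \<in> Basis"
          have pos: "0 < x \<bullet> i - a \<bullet> i" "0 < b \<bullet> i - x \<bullet> i" using True i by (auto simp: mem_box)
          \<comment> \<open>The threshold 2 is the shift by 1 plus the unit length on which \<Phi>
            rises: from there on both factors are exactly 1.\<close>
          have "eventually (\<lambda>n. 2 \<le> N n * c) sequentially" if "0 < c" for c
            unfolding N_def using that by real_asymp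
          from this[OF pos(1)] this[OF pos(2)]
          show "eventually (\<lambda>n. p n i x = 1) sequentially"
            by eventually_elim (simp add: p_def \<Phi>(3) algebra_simps)
        qed
        then have "eventually (\<lambda>n. \<forall>i\<in>Basis. p n i x = 1) sequentially"
          by (intro eventually_ball_finite) auto
        then have "eventually (\<lambda>n. \<phi> n x = e) sequentially"
          by eventually_elim (simp add: \<phi>_def)
        then show ?thesis using True by (simp add: tendsto_eventually)
      next
        case False
        then have "\<phi> n x = 0" for n using out[of x n] K(2)[of n] by blast
        then show ?thesis using False by simp
      qed
    qed
  qed
  then show ?thesis
    unfolding closure_sequential l2_of_def[of "box a b"]
    using test test_function_sq_integrable(3)[OF test]
    by (intro exI[of _ "\<lambda>n. abs_l2vec (\<phi> n)"]) (metis imageI)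
qed

lemma L2_on_subset_closure_test_functions:
  assumes "open \<Omega>"
  shows "L2_on \<Omega> \<subseteq> closure (l2_of \<Omega> ` test_functions \<Omega>)"
proof (rule L2_on_subset_closed_subspace[OF assms])
  have "subspace (l2_of \<Omega> ` test_functions \<Omega>)"
  proof (rule subspaceI)
    show "0 \<in> l2_of \<Omega> ` test_functions \<Omega>"
      by (rule image_eqI[OF _ test_functions_zero]) (simp add: l2_of_def abs_l2vec_zero)
    show "x + y \<in> l2_of \<Omega> ` test_functions \<Omega>"
      if xy: "x \<in> l2_of \<Omega> ` test_functions \<Omega>" "y \<in> l2_of \<Omega> ` test_functions \<Omega>" for x y
    proof -
      obtain f g where fg: "f \<in> test_functions \<Omega>" "g \<in> test_functions \<Omega>" "x = abs_l2vec f" "y = abs_l2vec g"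
        using xy by (auto simp: test_function_sq_integrable(3))
      show ?thesis
        using test_functions_add[OF fg(1,2)] fg(3,4)
        by (intro image_eqI[of _ _ "\<lambda>x. f x + g x"])
          (simp_all add: abs_l2vec_add test_function_sq_integrable(1)[OF fg(1)] test_function_sq_integrable(1)[OF fg(2)]
            test_function_sq_integrable(3)[OF test_functions_add[OF fg(1,2)]])
    qed
    show "c *\<^sub>R x \<in> l2_of \<Omega> ` test_functions \<Omega>" if x: "x \<in> l2_of \<Omega> ` test_functions \<Omega>" for c x
    proof -
      obtain f where f: "f \<in> test_functions \<Omega>" "x = abs_l2vec f"
        using x by (auto simp: test_function_sq_integrable(3))
      show ?thesis
        using test_functions_scaleR[OF f(1)] f(2)
        by (intro image_eqI[of _ _ "\<lambda>x. c *\<^sub>R f x"])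
          (simp_all add: abs_l2vec_scaleR test_function_sq_integrable(1)[OF f(1)]
            test_function_sq_integrable(3)[OF test_functions_scaleR[OF f(1)]])
    qed
  qed
  then show "subspace (closure (l2_of \<Omega> ` test_functions \<Omega>))" by (rule subspace_closure)
next
  fix B and e :: "real^3" assume "B \<in> rational_box_set" "B \<subseteq> \<Omega>"
  then show "l2_of B (\<lambda>_. e) \<in> closure (l2_of \<Omega> ` test_functions \<Omega>)"
    using box_indicator_in_closure_test_functions by (auto simp: rational_box_set_def)
qed simp

section \<open>Separability\<close>

text \<open>The dense set consists of the finite rational combinations of box indicators times basis
  vectors; coding them by lists makes countability immediate. Its closure is a real subspace because
  the rationals are dense, and so the criterion for closed subspaces applies.\<close>

lemma separable_l2vec: "\<exists>D :: l2vec set. countable D \<and> closure D = UNIV"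
proof -
  let ?S = "(\<lambda>(B, e). l2_of B (\<lambda>_. e)) ` (rational_box_set \<times> Basis)"
  define D where "D = (\<lambda>xs. \<Sum>(q, s)\<leftarrow>xs. q *\<^sub>R s) ` lists (\<rat> \<times> ?S)"
  have cD: "countable D"
    unfolding D_def
    by (intro countable_image countable_lists countable_SIGMA countable_rat countable_rational_box_set)
      (simp add: countable_finite)
  have add: "x + y \<in> D" if xy: "x \<in> D" "y \<in> D" for x y
  proof -
    obtain xs ys where "xs \<in> lists (\<rat> \<times> ?S)" "x = (\<Sum>(q, s)\<leftarrow>xs. q *\<^sub>R s)"
      "ys \<in> lists (\<rat> \<times> ?S)" "y = (\<Sum>(q, s)\<leftarrow>ys. q *\<^sub>R s)" using xy unfolding D_def by blast
    then show ?thesis unfolding D_def by (intro image_eqI[of _ _ "xs @ ys"]) auto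
  qed
  have scale: "r *\<^sub>R x \<in> D" if xr: "x \<in> D" "r \<in> \<rat>" for x r
  proof -
    obtain xs where xs: "xs \<in> lists (\<rat> \<times> ?S)" "x = (\<Sum>(q, s)\<leftarrow>xs. q *\<^sub>R s)" using xr unfolding D_def by blast
    have "r *\<^sub>R (\<Sum>(q, s)\<leftarrow>xs. q *\<^sub>R s) = (\<Sum>(q, s)\<leftarrow>map (\<lambda>(q, s). (r * q, s)) xs. q *\<^sub>R s)"
      by (induction xs) (auto simp: scaleR_add_right)
    moreover have "map (\<lambda>(q, s). (r * q, s)) xs \<in> lists (\<rat> \<times> ?S)"
      using xs(1) xr(2) by (induction xs) auto
    ultimately show ?thesis unfolding D_def xs(2) by blast
  qed
  have "subspace (closure D)"
  proof (rule subspaceI)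
    have "0 \<in> D" unfolding D_def by (intro image_eqI[of _ _ "[]"]) auto
    then show "0 \<in> closure D" using closure_subset by blast
    show "x + y \<in> closure D" if xy: "x \<in> closure D" "y \<in> closure D" for x y
    proof -
      obtain X Y where "\<And>n. X n \<in> D" "X \<longlonglongrightarrow> x" "\<And>n. Y n \<in> D" "Y \<longlonglongrightarrow> y"
        using xy unfolding closure_sequential by blast
      then show ?thesis
        unfolding closure_sequential by (intro exI[of _ "\<lambda>n. X n + Y n"]) (auto intro: add tendsto_add)
    qed
    show "c *\<^sub>R x \<in> closure D" if x: "x \<in> closure D" for c x
    proof -
      obtain X where X: "\<And>n. X n \<in> D" "X \<longlonglongrightarrow> x"
        using x unfolding closure_sequential by blast
      have "c \<in> closure \<rat>"
        unfolding closure_approachable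
      proof (intro allI impI)
        fix e :: real assume "0 < e"
        then obtain r where "r \<in> \<rat>" "c < r" "r < c + e" using Rats_dense_in_real[of c "c + e"] by auto
        then show "\<exists>y\<in>\<rat>. dist y c < e" by (intro bexI[of _ r]) (auto simp: dist_real_def)
      qed
      then obtain R where R: "\<And>n. R n \<in> \<rat>" "R \<longlonglongrightarrow> c" unfolding closure_sequential by blast
      show ?thesis
        unfolding closure_sequential using X R
        by (intro exI[of _ "\<lambda>n. R n *\<^sub>R X n"]) (auto intro: scale tendsto_scaleR)
    qed
  qed
  moreover have "l2_of B (\<lambda>_. e) \<in> closure D" if "B \<in> rational_box_set" "e \<in> Basis" for B e
  proof -
    have "l2_of B (\<lambda>_. e) \<in> D"
      unfolding D_def using that by (intro image_eqI[of _ _ "[(1, l2_of B (\<lambda>_. e))]"]) auto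
    then show ?thesis using closure_subset by blast
  qed
  ultimately have "L2_on UNIV \<subseteq> closure D"
    by (intro L2_on_subset_closed_subspace) auto
  then show ?thesis using cD by (auto simp: L2_on_def)
qed

text \<open>Separability passes to subsets, here measured through finitely many maps at once. For
  each tuple of members of the dense set and each precision, one element of \<open>X\<close> with
  nearby images is chosen if any exists. Choosing inside \<open>X\<close> matters: the approximants
  of the unit ball of V must lie in that ball.\<close>

lemma separable_family:
  fixes T :: "'i \<Rightarrow> 'a \<Rightarrow> l2vec"
  assumes "finite J"
  shows "\<exists>D\<subseteq>X. countable D \<and> (\<forall>x\<in>X. \<forall>e>0. \<exists>d\<in>D. \<forall>i\<in>J. norm (T i x - T i d) < e)"
proof -
  obtain E :: "l2vec set" where E: "countable E" "closure E = UNIV" using separable_l2vec by blast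
  define near where "near p n x \<longleftrightarrow> x \<in> X \<and> (\<forall>i\<in>J. norm (T i x - p i) < 1 / Suc n)" for p n x
  define pick where "pick = (\<lambda>(p, n :: nat). SOME x. near p n x)"
  define I where "I = {(p, n). p \<in> J \<rightarrow>\<^sub>E E \<and> (\<exists>x. near p n x)}"
  have pick: "near p n (pick (p, n))" if "(p, n) \<in> I" for p n
    using that someI_ex[of "near p n"] by (auto simp: I_def pick_def)
  have "countable ((J \<rightarrow>\<^sub>E E) \<times> (UNIV :: nat set))"
    using assms E(1) by (intro countable_SIGMA countable_PiE) auto
  then have "countable I" by (rule countable_subset[rotated]) (auto simp: I_def)
  moreover have "\<exists>d\<in>pick ` I. \<forall>i\<in>J. norm (T i x - T i d) < e" if x: "x \<in> X" and e: "0 < e" for x e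
  proof -
    obtain n where n: "1 / real (Suc n) < e / 2" using e nat_approx_posE[of "e / 2"] by auto
    have "\<exists>p\<in>E. norm (T i x - p) < 1 / Suc n" for i
    proof -
      have "T i x \<in> closure E" using E(2) by simp
      then show ?thesis unfolding closure_approachable
        by (metis dist_norm dist_commute zero_less_divide_1_iff of_nat_0_less_iff zero_less_Suc)
    qed
    then obtain q where q: "\<And>i. q i \<in> E" "\<And>i. norm (T i x - q i) < 1 / Suc n" by metis
    let ?p = "restrict q J"
    have nx: "near ?p n x" using q(2) x by (auto simp: near_def)
    then have I: "(?p, n) \<in> I" using q(1) by (auto simp: I_def)
    have "norm (T i x - T i (pick (?p, n))) < e" if i: "i \<in> J" for i
    proof -
      have "norm (T i (pick (?p, n)) - q i) < 1 / Suc n" using pick[OF I] i by (auto simp: near_def)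
      moreover have "norm (T i x - T i (pick (?p, n))) \<le> norm (T i x - q i) + norm (T i (pick (?p, n)) - q i)"
        by (metis norm_minus_commute norm_triangle_sub diff_diff_eq2 diff_add_cancel norm_triangle_ineq4 diff_diff_eq)
      ultimately show ?thesis using q(2)[of i] n by linarith
    qed
    then show ?thesis using I by blast
  qed
  ultimately show ?thesis
    using pick by (intro exI[of _ "pick ` I"]) (auto simp: near_def)
qed

section \<open>Weak derivatives and the space V\<close>

text \<open>A difference quotient in direction i has integral zero by translation invariance of
  Lebesgue measure. The quotients are bounded by the maximum of the derivative, vanish outside one
  compact set, and converge pointwise to the derivative.\<close>

lemma integral_pd_compact_support:
  fixes \<psi> :: "real^3 \<Rightarrow> real"
  assumes \<psi>: "\<psi> \<in> test_functions UNIV" and i: "i \<in> Basis"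
  shows "(LINT x|lborel. pd i \<psi> x) = 0"
proof -
  obtain K where K: "compact K" "\<And>x. x \<notin> K \<Longrightarrow> \<psi> x = 0" and s: "smooth \<psi>"
    using \<psi> by (auto simp: test_functions_def)
  have t: "pd i \<psi> \<in> test_functions UNIV" by (rule test_functions_pd[OF \<psi> i])
  obtain L where L: "compact L" "\<And>x. x \<notin> L \<Longrightarrow> pd i \<psi> x = 0" and s': "smooth (pd i \<psi>)"
    using t by (auto simp: test_functions_def)
  have "bounded (pd i \<psi> ` L)"
    by (intro compact_imp_bounded compact_continuous_image L(1) continuous_on_subset[OF smooth_imp_continuous[OF s']]) simp
  then obtain M where "0 < M" and M': "\<forall>y\<in>pd i \<psi> ` L. norm y \<le> M" unfolding bounded_pos by blast
  have M: "\<bar>pd i \<psi> x\<bar> \<le> M" for x using M' L(2)[of x] \<open>0 < M\<close> by (cases "x \<in> L") auto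
  have c: "continuous_on UNIV \<psi>" by (rule smooth_imp_continuous[OF s])
  have int: "integrable lborel \<psi>"
  proof -
    have "set_integrable lborel K \<psi>"
      unfolding set_integrable_def by (rule borel_integrable_compact) (auto intro: K continuous_on_subset[OF c])
    moreover have "(\<lambda>x. indicator K x *\<^sub>R \<psi> x) = \<psi>"
    proof
      show "indicator K x *\<^sub>R \<psi> x = \<psi> x" for x using K(2) by (cases "x \<in> K") auto
    qed
    ultimately show ?thesis by (simp add: set_integrable_def)
  qed
  have shift: "integrable lborel (\<lambda>x. \<psi> (h + x))" "(LINT x|lborel. \<psi> (h + x)) = (LINT x|lborel. \<psi> x)" for h
  proof -
    have m: "\<psi> \<in> borel_measurable borel" by (rule borel_measurable_continuous_onI[OF c])
    have "integrable (distr lborel borel ((+) h)) \<psi>" using int by (simp add: lborel_distr_plus)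
    then show "integrable lborel (\<lambda>x. \<psi> (h + x))" using m by (subst (asm) integrable_distr_eq) auto
    have "(LINT x|lborel. \<psi> x) = (LINT x|distr lborel borel ((+) h). \<psi> x)" by (simp add: lborel_distr_plus)
    also have "\<dots> = (LINT x|lborel. \<psi> (h + x))" using m by (subst integral_distr) auto
    finally show "(LINT x|lborel. \<psi> (h + x)) = (LINT x|lborel. \<psi> x)" by simp
  qed
  have der: "((\<lambda>s. \<psi> (s *\<^sub>R i + x)) has_real_derivative pd i \<psi> (s *\<^sub>R i + x)) (at s)" for s x
  proof -
    have "((\<lambda>s. s *\<^sub>R i + x) has_derivative (\<lambda>h. h *\<^sub>R i)) (at s)" by (auto intro!: derivative_eq_intros)
    from diff_chain_at[OF this pd_has_derivative[OF smooth_imp_differentiable[OF s]]]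
    have "((\<lambda>s. \<psi> (s *\<^sub>R i + x)) has_derivative (\<lambda>h. pd (h *\<^sub>R i) \<psi> (s *\<^sub>R i + x))) (at s)"
      by (simp add: o_def)
    moreover have "pd (h *\<^sub>R i) \<psi> y = pd i \<psi> y * h" for h y
      using linear_cmul[OF has_derivative_linear[OF pd_has_derivative[OF smooth_imp_differentiable[OF s]]]]
      by (simp add: mult.commute)
    ultimately show ?thesis unfolding has_field_derivative_def by simp
  qed
  define N where "N n = real (Suc n)" for n
  have N: "N n > 0" "1 \<le> N n" for n by (simp_all add: N_def)
  define D where "D n x = N n * (\<psi> ((1 / N n) *\<^sub>R i + x) - \<psi> x)" for n x
  \<comment> \<open>All points that a shift by \<open>s *\<^sub>R i\<close> with 0 \<le> s \<le> 1
    carries into the support; since 1/N \<le> 1, this compact set contains the support of every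
    quotient.\<close>
  define W where "W = (\<lambda>(s, y). y - s *\<^sub>R i) ` ({0..1::real} \<times> K)"
  have W: "compact W"
    unfolding W_def by (intro compact_continuous_image compact_Times K) (auto intro!: continuous_intros simp: split_def)
  have out: "D n x = 0" if "x \<notin> W" for n x
  proof -
    have "x \<notin> K" using that by (force simp: W_def)
    moreover have "(1 / N n) *\<^sub>R i + x \<notin> K"
    proof
      assume "(1 / N n) *\<^sub>R i + x \<in> K"
      moreover have "1 / N n \<in> {0..1}" using N[of n] by auto
      ultimately have "(\<lambda>(s, y). y - s *\<^sub>R i) (1 / N n, (1 / N n) *\<^sub>R i + x) \<in> W"
        unfolding W_def by (intro imageI) auto
      then show False using that by simp
    qed
    ultimately show ?thesis using K(2) by (simp add: D_def)
  qed
  have bd: "\<bar>D n x\<bar> \<le> M * indicator W x" for n x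
  proof (cases "x \<in> W")
    case True
    have "0 < 1 / N n" using N by simp
    from MVT2[OF this, of "\<lambda>s. \<psi> (s *\<^sub>R i + x)" "\<lambda>s. pd i \<psi> (s *\<^sub>R i + x)"] der
    obtain z where "\<psi> ((1 / N n) *\<^sub>R i + x) - \<psi> (0 *\<^sub>R i + x) = (1 / N n - 0) * pd i \<psi> (z *\<^sub>R i + x)" by blast
    then have "D n x = pd i \<psi> (z *\<^sub>R i + x)" using N[of n] by (simp add: D_def)
    then show ?thesis using True M by simp
  qed (simp add: out)
  have lim: "(\<lambda>n. D n x) \<longlonglongrightarrow> pd i \<psi> x" for x
  proof -
    have "((\<lambda>h. (\<psi> ((0 + h) *\<^sub>R i + x) - \<psi> (0 *\<^sub>R i + x)) / h) \<longlongrightarrow> pd i \<psi> (0 *\<^sub>R i + x)) (at 0)"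
      using der[of x 0] by (simp add: DERIV_def)
    moreover have "filterlim (\<lambda>n. 1 / N n) (at 0) sequentially"
      unfolding N_def filterlim_at
      by (intro conjI always_eventually LIMSEQ_Suc[OF lim_1_over_n]) auto
    ultimately have "(\<lambda>n. (\<psi> ((0 + 1 / N n) *\<^sub>R i + x) - \<psi> (0 *\<^sub>R i + x)) / (1 / N n)) \<longlonglongrightarrow> pd i \<psi> (0 *\<^sub>R i + x)"
      by (rule filterlim_compose)
    then show ?thesis by (simp add: D_def mult.commute)
  qed
  have "(\<lambda>n. LINT x|lborel. D n x) \<longlonglongrightarrow> (LINT x|lborel. pd i \<psi> x)"
  proof (rule integral_dominated_convergence)
    show "pd i \<psi> \<in> borel_measurable lborel"
      using borel_measurable_continuous_onI[OF smooth_imp_continuous[OF s']] by simp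
    show "D n \<in> borel_measurable lborel" for n
      unfolding D_def using borel_measurable_integrable[OF shift(1)] borel_measurable_integrable[OF int] by auto
    show "integrable lborel (\<lambda>x. M * indicator W x :: real)"
      using emeasure_bounded_finite[OF compact_imp_bounded[OF W]] compact_imp_closed[OF W]
      by (intro integrable_mult_right integrable_real_indicator) auto
  qed (use bd lim in auto)
  moreover have "(LINT x|lborel. D n x) = 0" for n
    unfolding D_def using shift int by simp
  ultimately show ?thesis using LIMSEQ_unique[OF _ tendsto_const] by fastforce
qed

lemma smooth_inner:
  fixes f g :: "'a::euclidean_space \<Rightarrow> real^3"
  assumes "smooth f" "smooth g"
  shows "smooth (\<lambda>x. f x \<bullet> g x)"
proof -
  have "Ck_on k UNIV f \<Longrightarrow> Ck_on k UNIV g \<Longrightarrow> Ck_on k UNIV (\<lambda>x. f x \<bullet> g x)" for k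
    and f g :: "'a \<Rightarrow> real^3"
  proof (induction k arbitrary: f g)
    case 0
    then show ?case by (simp add: continuous_on_inner)
  next
    case (Suc k)
    show ?case
    proof (rule Ck_on_SucI)
      show "((\<lambda>x. f x \<bullet> g x) has_derivative (\<lambda>i. f x \<bullet> pd i g x + pd i f x \<bullet> g x)) (at x)" for x
        using Suc.prems[THEN Ck_on_SucD(1), THEN pd_has_derivative] by (rule has_derivative_inner)
      show "Ck_on k UNIV (\<lambda>x. f x \<bullet> pd i g x + pd i f x \<bullet> g x)" if "i \<in> Basis" for i
        using Suc.prems[THEN Ck_on_SucD(2), OF that] Suc.prems[THEN Ck_on_lower]
        by (intro Ck_on_add Suc.IH)
    qed
  qed
  then show ?thesis using assms by (simp add: smooth_def)
qed

text \<open>The product \<open>w x \<bullet> \<phi> x\<close> has compact support, so its derivative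
  integrates to zero, and the product rule splits it into the two sides of the identity. The
  indicator of \<Omega> may be inserted because \<phi> and its derivatives vanish outside \<Omega>;
  no boundary values of \<open>w\<close> enter.\<close>

lemma smooth_is_weak_pd:
  assumes w: "smooth w" and \<Omega>: "open \<Omega>" "bounded \<Omega>" and i: "i \<in> Basis"
  shows "is_weak_pd \<Omega> i (l2_of \<Omega> w) (l2_of \<Omega> (pd i w))"
proof -
  have sq: "sq_integrable (\<lambda>x. indicator \<Omega> x *\<^sub>R v x)" if "smooth v" for v
    using \<Omega> by (intro sq_integrable_on_bounded smooth_imp_continuous that) auto
  note sw = sq[OF w] and sp = sq[OF smooth_pd[OF w i]]
  show ?thesis
    unfolding is_weak_pd_def
  proof (intro conjI ballI)
    show "l2_of \<Omega> (pd i w) \<in> L2_on \<Omega>" by (rule l2_of_in_L2_on[OF sp])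
    fix \<phi> :: "real^3 \<Rightarrow> real^3" assume \<phi>: "\<phi> \<in> test_functions \<Omega>"
    note p\<phi> = test_functions_pd[OF \<phi> i]
    obtain K where K: "compact K" "K \<subseteq> \<Omega>" "\<And>x. x \<notin> K \<Longrightarrow> \<phi> x = 0" and s: "smooth \<phi>"
      using \<phi> by (auto simp: test_functions_def)
    have z: "\<phi> x = 0" "pd i \<phi> x = 0" if "x \<notin> \<Omega>" for x
      using fun_cong[OF test_function_sq_integrable(2)[OF \<phi>], of x]
        fun_cong[OF test_function_sq_integrable(2)[OF p\<phi>], of x] that by auto
    have eq: "pd i (\<lambda>x. w x \<bullet> \<phi> x) x =
        (indicator \<Omega> x *\<^sub>R w x) \<bullet> pd i \<phi> x + (indicator \<Omega> x *\<^sub>R pd i w x) \<bullet> \<phi> x" for x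
    proof -
      have "((\<lambda>x. w x \<bullet> \<phi> x) has_derivative (\<lambda>i. w x \<bullet> pd i \<phi> x + pd i w x \<bullet> \<phi> x)) (at x)"
        by (intro has_derivative_inner pd_has_derivative smooth_imp_differentiable w s)
      from pd_eqI[OF this] show ?thesis using z by (cases "x \<in> \<Omega>") auto
    qed
    have "(\<lambda>x. w x \<bullet> \<phi> x) \<in> test_functions UNIV"
      unfolding test_functions_def using smooth_inner[OF w s] K by (auto intro!: exI[of _ K])
    from integral_pd_compact_support[OF this i]
    have "0 = (LINT x|lborel. (indicator \<Omega> x *\<^sub>R w x) \<bullet> pd i \<phi> x + (indicator \<Omega> x *\<^sub>R pd i w x) \<bullet> \<phi> x)"
      unfolding eq by simp
    also have "\<dots> = (LINT x|lborel. (indicator \<Omega> x *\<^sub>R w x) \<bullet> pd i \<phi> x) + (LINT x|lborel. (indicator \<Omega> x *\<^sub>R pd i w x) \<bullet> \<phi> x)"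
      by (intro Bochner_Integration.integral_add sq_integrable_inner sw sp
        test_function_sq_integrable(1)[OF \<phi>] test_function_sq_integrable(1)[OF p\<phi>])
    also have "\<dots> = l2_of \<Omega> w \<bullet> l2_of \<Omega> (pd i \<phi>) + l2_of \<Omega> (pd i w) \<bullet> l2_of \<Omega> \<phi>"
      unfolding test_function_sq_integrable(3)[OF \<phi>] test_function_sq_integrable(3)[OF p\<phi>]
      unfolding l2_of_def
      using sw sp test_function_sq_integrable(1)[OF \<phi>] test_function_sq_integrable(1)[OF p\<phi>]
      by (simp only: abs_l2vec_inner)
    finally show "l2_of \<Omega> w \<bullet> l2_of \<Omega> (pd i \<phi>) = - (l2_of \<Omega> (pd i w) \<bullet> l2_of \<Omega> \<phi>)" by simp
  qed
qed

text \<open>The difference of two weak derivatives lies in \<open>L2_on \<Omega>\<close> and is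
  orthogonal to the test functions, which are dense there; hence it is orthogonal to itself. This
  gives the definite description in \<open>weak_pd\<close> its meaning.\<close>

lemma is_weak_pd_unique:
  assumes "open \<Omega>" "is_weak_pd \<Omega> i u g" "is_weak_pd \<Omega> i u h"
  shows "g = h"
proof -
  have d: "g - h \<in> L2_on \<Omega>"
    using assms subspace_diff[OF subspace_L2_on] by (simp add: is_weak_pd_def)
  then have "g - h \<in> closure (l2_of \<Omega> ` test_functions \<Omega>)"
    using L2_on_subset_closure_test_functions[OF assms(1)] by blast
  then obtain X where X: "\<And>n. X n \<in> l2_of \<Omega> ` test_functions \<Omega>" "X \<longlonglongrightarrow> g - h"
    unfolding closure_sequential by blast
  have "(g - h) \<bullet> X n = 0" for n
    using X(1)[of n] assms(2,3) by (auto simp: is_weak_pd_def inner_diff_left)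
  moreover have "(\<lambda>n. (g - h) \<bullet> X n) \<longlonglongrightarrow> (g - h) \<bullet> (g - h)" by (intro tendsto_intros X)
  ultimately have "(\<lambda>n. 0) \<longlonglongrightarrow> (g - h) \<bullet> (g - h)" by simp
  then have "(g - h) \<bullet> (g - h) = 0" using LIMSEQ_unique[OF tendsto_const] by metis
  then show ?thesis by (simp only: inner_eq_zero_iff right_minus_eq)
qed

lemma weak_pd_eqI:
  assumes "open \<Omega>" "is_weak_pd \<Omega> i u g"
  shows "weak_pd \<Omega> i u = g"
  unfolding weak_pd_def using is_weak_pd_unique[OF assms(1)] assms(2) by (intro the_equality) auto

lemma is_weak_pd_weak_pd:
  assumes "open \<Omega>" "u \<in> H1_space \<Omega>" "i \<in> Basis"
  shows "is_weak_pd \<Omega> i u (weak_pd \<Omega> i u)"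
  using assms weak_pd_eqI[OF assms(1)] by (force simp: H1_space_def)

lemma is_weak_pd_add:
  "is_weak_pd \<Omega> i u g \<Longrightarrow> is_weak_pd \<Omega> i v h \<Longrightarrow> is_weak_pd \<Omega> i (u + v) (g + h)"
  using subspace_add[OF subspace_L2_on] by (auto simp: is_weak_pd_def inner_add_left)

lemma is_weak_pd_scaleR: "is_weak_pd \<Omega> i u g \<Longrightarrow> is_weak_pd \<Omega> i (c *\<^sub>R u) (c *\<^sub>R g)"
  using subspace_scale[OF subspace_L2_on] by (auto simp: is_weak_pd_def)

lemma H1_space_add:
  assumes "open \<Omega>" "u \<in> H1_space \<Omega>" "v \<in> H1_space \<Omega>"
  shows "u + v \<in> H1_space \<Omega>" "i \<in> Basis \<Longrightarrow> weak_pd \<Omega> i (u + v) = weak_pd \<Omega> i u + weak_pd \<Omega> i v"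
proof -
  have *: "is_weak_pd \<Omega> i (u + v) (weak_pd \<Omega> i u + weak_pd \<Omega> i v)" if "i \<in> Basis" for i
    using is_weak_pd_add is_weak_pd_weak_pd[OF assms(1)] assms that by blast
  show "i \<in> Basis \<Longrightarrow> weak_pd \<Omega> i (u + v) = weak_pd \<Omega> i u + weak_pd \<Omega> i v"
    by (rule weak_pd_eqI[OF assms(1) *])
  show "u + v \<in> H1_space \<Omega>"
    using * assms subspace_add[OF subspace_L2_on] unfolding H1_space_def by blast
qed

lemma H1_space_scaleR:
  assumes "open \<Omega>" "u \<in> H1_space \<Omega>"
  shows "c *\<^sub>R u \<in> H1_space \<Omega>" "i \<in> Basis \<Longrightarrow> weak_pd \<Omega> i (c *\<^sub>R u) = c *\<^sub>R weak_pd \<Omega> i u"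
proof -
  have *: "is_weak_pd \<Omega> i (c *\<^sub>R u) (c *\<^sub>R weak_pd \<Omega> i u)" if "i \<in> Basis" for i
    using is_weak_pd_scaleR is_weak_pd_weak_pd[OF assms that] by blast
  show "i \<in> Basis \<Longrightarrow> weak_pd \<Omega> i (c *\<^sub>R u) = c *\<^sub>R weak_pd \<Omega> i u"
    by (rule weak_pd_eqI[OF assms(1) *])
  show "c *\<^sub>R u \<in> H1_space \<Omega>"
    using * assms subspace_scale[OF subspace_L2_on] unfolding H1_space_def by blast
qed

lemma subspace_H1_space: "open \<Omega> \<Longrightarrow> subspace (H1_space \<Omega>)"
proof (rule subspaceI)
  show "0 \<in> H1_space \<Omega>"
    using subspace_0[OF subspace_L2_on] by (auto simp: H1_space_def is_weak_pd_def intro!: exI[of _ 0])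
qed (auto intro: H1_space_add H1_space_scaleR)

section \<open>The gradient seminorm and the full norm\<close>

lemma flow_domain_open_bounded:
  assumes "admissible K"
  shows "open (flow_domain K)" "bounded (flow_domain K)"
  using assms by (cases K; simp add: open_box)+

lemma H1_norm_eq: "H1_norm K u = L2_set (\<lambda>i. norm (weak_pd (flow_domain K) i u)) Basis"
  by (simp add: H1_norm_def H1_inner_def L2_set_def power2_norm_eq_inner)

lemma H1_norm_nonneg: "0 \<le> H1_norm K u"
  by (simp add: H1_norm_eq)

context
  fixes K assumes K: "admissible K"
begin

lemma H1_norm_add:
  assumes "u \<in> H1_space (flow_domain K)" "v \<in> H1_space (flow_domain K)"
  shows "H1_norm K (u + v) \<le> H1_norm K u + H1_norm K v"
proof -
  have "H1_norm K (u + v) \<le> L2_set (\<lambda>i. norm (weak_pd (flow_domain K) i u) + norm (weak_pd (flow_domain K) i v)) Basis"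
    unfolding H1_norm_eq
    by (rule L2_set_mono) (simp_all add: H1_space_add[OF flow_domain_open_bounded(1)[OF K] assms] norm_triangle_ineq)
  also have "\<dots> \<le> H1_norm K u + H1_norm K v" unfolding H1_norm_eq by (rule L2_set_triangle_ineq)
  finally show ?thesis .
qed

lemma H1_norm_scaleR:
  assumes "u \<in> H1_space (flow_domain K)"
  shows "H1_norm K (c *\<^sub>R u) = \<bar>c\<bar> * H1_norm K u"
  unfolding H1_norm_eq
  by (subst L2_set_right_distrib) (auto intro!: L2_set_cong simp: H1_space_scaleR[OF flow_domain_open_bounded(1)[OF K] assms])

lemma H1_full_norm_add:
  assumes "u \<in> H1_space (flow_domain K)" "v \<in> H1_space (flow_domain K)"
  shows "H1_full_norm K (u + v) \<le> H1_full_norm K u + H1_full_norm K v"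
proof -
  have "H1_full_norm K (u + v) \<le> sqrt ((norm u + norm v)\<^sup>2 + (H1_norm K u + H1_norm K v)\<^sup>2)"
    unfolding H1_full_norm_def
    by (intro real_sqrt_le_mono add_mono power_mono norm_triangle_ineq H1_norm_add assms H1_norm_nonneg norm_ge_zero)
  also have "\<dots> \<le> H1_full_norm K u + H1_full_norm K v"
    unfolding H1_full_norm_def by (rule real_sqrt_sum_squares_triangle_ineq)
  finally show ?thesis .
qed

lemma H1_full_norm_scaleR:
  assumes "u \<in> H1_space (flow_domain K)"
  shows "H1_full_norm K (c *\<^sub>R u) = \<bar>c\<bar> * H1_full_norm K u"
  unfolding H1_full_norm_def H1_norm_scaleR[OF assms] norm_scaleR power_mult_distrib
  by (simp add: distrib_left[symmetric] real_sqrt_mult)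

section \<open>Linear structure of the test fields\<close>

lemma test_fields_smooth: "w \<in> test_fields K \<Longrightarrow> smooth w"
  by (cases K) (auto simp: test_functions_def)

lemma test_field_sq_integrable:
  "w \<in> test_fields K \<Longrightarrow> sq_integrable (\<lambda>x. indicator (flow_domain K) x *\<^sub>R w x)"
  using flow_domain_open_bounded[OF K]
  by (intro sq_integrable_on_bounded smooth_imp_continuous test_fields_smooth) auto

lemma l2_of_test_field_H1:
  assumes "w \<in> test_fields K"
  shows "l2_of (flow_domain K) w \<in> H1_space (flow_domain K)"
  unfolding H1_space_def
  using l2_of_in_L2_on[OF test_field_sq_integrable[OF assms]]
    smooth_is_weak_pd[OF test_fields_smooth[OF assms] flow_domain_open_bounded[OF K]] by blast

lemma pd_add: "smooth f \<Longrightarrow> smooth g \<Longrightarrow> pd i (\<lambda>x. f x + g x) x = pd i f x + pd i g x"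
  by (intro pd_eqI has_derivative_add pd_has_derivative smooth_imp_differentiable)

lemma pd_scaleR: "smooth f \<Longrightarrow> pd i (\<lambda>x. c *\<^sub>R f x) x = c *\<^sub>R pd i f x"
  by (intro pd_eqI has_derivative_scaleR_right pd_has_derivative smooth_imp_differentiable)

lemma divergence_free_add:
  "smooth f \<Longrightarrow> smooth g \<Longrightarrow> divergence_free f \<Longrightarrow> divergence_free g \<Longrightarrow> divergence_free (\<lambda>x. f x + g x)"
  by (simp add: divergence_free_def pd_add inner_add_left sum.distrib)

lemma divergence_free_scaleR:
  "smooth f \<Longrightarrow> divergence_free f \<Longrightarrow> divergence_free (\<lambda>x. c *\<^sub>R f x)"
  by (simp add: divergence_free_def pd_scaleR sum_distrib_left[symmetric])

lemma smooth_set_integrable_box: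
  fixes f :: "real^3 \<Rightarrow> real^3"
  assumes "smooth f"
  shows "set_integrable lborel (box a b) f"
proof (rule set_integrable_subset)
  show "set_integrable lborel (cbox a b) f"
    unfolding set_integrable_def
    by (rule borel_integrable_compact) (auto intro: continuous_on_subset[OF smooth_imp_continuous[OF assms]])
qed (auto simp: box_subset_cbox)

lemma test_fields_add:
  assumes "f \<in> test_fields K" "g \<in> test_fields K"
  shows "(\<lambda>x. f x + g x) \<in> test_fields K"
proof (cases K)
  case (Periodic L)
  then show ?thesis
    using assms
    by (auto simp: smooth_add divergence_free_add set_integral_add smooth_set_integrable_box)
next
  case (NoSlip \<Omega>)
  then have "smooth f" "smooth g" using assms by (auto intro: test_fields_smooth)
  then show ?thesis
    using assms NoSlip by (auto simp: test_functions_add divergence_free_add)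
qed

lemma test_fields_scaleR:
  assumes "f \<in> test_fields K"
  shows "(\<lambda>x. c *\<^sub>R f x) \<in> test_fields K"
proof (cases K)
  case (Periodic L)
  then have "(LINT x:box 0 L|lborel. c *\<^sub>R f x) = c *\<^sub>R (LINT x:box 0 L|lborel. f x)"
    by (simp add: set_lebesgue_integral_def scaleR_left_commute)
  then show ?thesis
    using assms Periodic by (simp add: smooth_scaleR smooth_const divergence_free_scaleR)
next
  case (NoSlip \<Omega>)
  then have "smooth f" using assms by (auto intro: test_fields_smooth)
  then show ?thesis
    using assms NoSlip by (auto simp: test_functions_scaleR divergence_free_scaleR)
qed

lemma test_fields_zero: "(\<lambda>x. 0) \<in> test_fields K"
proof (cases K)
  have pd0: "pd i (\<lambda>x. 0 :: real^3) x = 0" for i x :: "real^3" by (rule pd_eqI) simp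
  case (Periodic L)
  then show ?thesis by (simp add: smooth_const divergence_free_def pd0 set_lebesgue_integral_def)
next
  have pd0: "pd i (\<lambda>x. 0 :: real^3) x = 0" for i x :: "real^3" by (rule pd_eqI) simp
  case (NoSlip \<Omega>)
  then show ?thesis by (simp add: test_functions_zero divergence_free_def pd0)
qed

lemma l2_of_test_field_add:
  assumes "f \<in> test_fields K" "g \<in> test_fields K"
  shows "l2_of (flow_domain K) (\<lambda>x. f x + g x) = l2_of (flow_domain K) f + l2_of (flow_domain K) g"
  unfolding l2_of_def scaleR_right_distrib by (intro abs_l2vec_add test_field_sq_integrable assms)

lemma l2_of_test_field_scaleR:
  assumes "f \<in> test_fields K"
  shows "l2_of (flow_domain K) (\<lambda>x. c *\<^sub>R f x) = c *\<^sub>R l2_of (flow_domain K) f"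
  unfolding l2_of_def using abs_l2vec_scaleR[OF test_field_sq_integrable[OF assms], of c]
  by (simp add: mult.commute)

lemma zero_in_H_space: "0 \<in> H_space K"
proof -
  have z: "l2_of (flow_domain K) (\<lambda>x. 0) = 0" by (simp add: l2_of_def abs_l2vec_zero)
  have "0 \<in> l2_of (flow_domain K) ` test_fields K"
    by (rule image_eqI[where f = "l2_of (flow_domain K)", OF z[symmetric] test_fields_zero])
  then show ?thesis unfolding H_space_def by (rule subsetD[OF closure_subset])
qed

section \<open>The spaces V and H and their countable dense sets\<close>

lemma V_space_H1: "u \<in> V_space K \<Longrightarrow> u \<in> H1_space (flow_domain K)"
  by (simp add: V_space_def)

lemma subspace_V_space: "subspace (V_space K)"
proof (rule subspaceI)
  let ?\<Omega> = "flow_domain K"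
  note sub = subspace_H1_space[OF flow_domain_open_bounded(1)[OF K]]
  have zero: "H1_full_norm K 0 = 0" using H1_full_norm_scaleR[OF subspace_0[OF sub], of 0] by simp
  show "0 \<in> V_space K"
    unfolding V_space_def using subspace_0[OF sub] zero test_fields_zero
    by (auto intro!: bexI[of _ "\<lambda>x. 0"] simp: l2_of_def abs_l2vec_zero)
  show "u + v \<in> V_space K" if uv: "u \<in> V_space K" "v \<in> V_space K" for u v
    unfolding V_space_def
  proof (intro CollectI conjI allI impI)
    show "u + v \<in> H1_space ?\<Omega>" using uv subspace_add[OF sub] V_space_H1 by blast
    fix e :: real assume "0 < e"
    then have e2: "0 < e / 2" by simp
    obtain w1 where w1: "w1 \<in> test_fields K" "H1_full_norm K (u - l2_of ?\<Omega> w1) < e / 2"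
      using uv(1) e2 unfolding V_space_def by blast
    obtain w2 where w2: "w2 \<in> test_fields K" "H1_full_norm K (v - l2_of ?\<Omega> w2) < e / 2"
      using uv(2) e2 unfolding V_space_def by blast
    note w = w1 w2
    have "H1_full_norm K ((u - l2_of ?\<Omega> w1) + (v - l2_of ?\<Omega> w2)) \<le>
        H1_full_norm K (u - l2_of ?\<Omega> w1) + H1_full_norm K (v - l2_of ?\<Omega> w2)"
      using uv w by (intro H1_full_norm_add subspace_diff[OF sub] V_space_H1 l2_of_test_field_H1)
    then have "H1_full_norm K (u + v - l2_of ?\<Omega> (\<lambda>x. w1 x + w2 x)) < e"
      using w by (simp add: l2_of_test_field_add algebra_simps)
    then show "\<exists>w\<in>test_fields K. H1_full_norm K (u + v - l2_of ?\<Omega> w) < e"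
      using test_fields_add[OF w(1,3)] by blast
  qed
  show "c *\<^sub>R u \<in> V_space K" if u: "u \<in> V_space K" for c u
    unfolding V_space_def
  proof (intro CollectI conjI allI impI)
    show "c *\<^sub>R u \<in> H1_space ?\<Omega>" using u subspace_scale[OF sub] V_space_H1 by blast
    fix e :: real assume "0 < e"
    \<comment> \<open>The summand 1 keeps the denominator positive for c = 0 and the final estimate
      strict.\<close>
    then have "0 < e / (\<bar>c\<bar> + 1)" by simp
    then obtain w where w: "w \<in> test_fields K" "H1_full_norm K (u - l2_of ?\<Omega> w) < e / (\<bar>c\<bar> + 1)"
      using u unfolding V_space_def by blast
    have "H1_full_norm K (c *\<^sub>R (u - l2_of ?\<Omega> w)) = \<bar>c\<bar> * H1_full_norm K (u - l2_of ?\<Omega> w)"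
      using u w by (intro H1_full_norm_scaleR subspace_diff[OF sub] V_space_H1 l2_of_test_field_H1)
    also have "\<dots> \<le> \<bar>c\<bar> * (e / (\<bar>c\<bar> + 1))" using w(2) by (intro mult_left_mono) auto
    also have "\<dots> < e" using \<open>0 < e\<close> by (simp add: field_simps)
    finally have "H1_full_norm K (c *\<^sub>R u - l2_of ?\<Omega> (\<lambda>x. c *\<^sub>R w x)) < e"
      using w by (simp add: l2_of_test_field_scaleR scaleR_diff_right)
    then show "\<exists>w\<in>test_fields K. H1_full_norm K (c *\<^sub>R u - l2_of ?\<Omega> w) < e"
      using test_fields_scaleR[OF w(1)] by blast
  qed
qed

lemma V_space_subset_H_space: "V_space K \<subseteq> H_space K"
proof
  fix u assume u: "u \<in> V_space K"
  show "u \<in> H_space K"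
    unfolding H_space_def closure_approachable
  proof (intro allI impI)
    fix e :: real assume "0 < e"
    then obtain w where w: "w \<in> test_fields K" "H1_full_norm K (u - l2_of (flow_domain K) w) < e"
      using u unfolding V_space_def by blast
    have "norm (u - l2_of (flow_domain K) w) \<le> H1_full_norm K (u - l2_of (flow_domain K) w)"
      unfolding H1_full_norm_def by (rule real_le_rsqrt) simp
    then show "\<exists>y\<in>l2_of (flow_domain K) ` test_fields K. dist y u < e"
      using w by (intro bexI[of _ "l2_of (flow_domain K) w"]) (auto simp: dist_norm norm_minus_commute)
  qed
qed

lemma countable_dense_H_space:
  "\<exists>D\<subseteq>H_space K. countable D \<and> (\<forall>u\<in>H_space K. \<forall>e>0. \<exists>d\<in>D. norm (u - d) < e)"
proof -
  have "finite {()}" by simp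
  from separable_family[OF this, of "H_space K" "\<lambda>_ u. u"] show ?thesis by simp
qed

text \<open>The weak derivatives embed V with its gradient seminorm into finitely many copies of the
  separable space L^2. The dual norm is a supremum over exactly this ball, so a countable dense part
  of it reduces that norm to countably many evaluations.\<close>

lemma countable_dense_V_ball:
  "\<exists>D\<subseteq>{v \<in> V_space K. H1_norm K v \<le> 1}. countable D \<and>
     (\<forall>v\<in>V_space K. H1_norm K v \<le> 1 \<longrightarrow> (\<forall>e>0. \<exists>d\<in>D. H1_norm K (v - d) < e))"
proof -
  let ?X = "{v \<in> V_space K. H1_norm K v \<le> 1}"
  have "finite (Basis :: (real^3) set)" by simp
  from separable_family[OF this, of ?X "weak_pd (flow_domain K)"]
  obtain D where D: "D \<subseteq> ?X" "countable D"
    "\<forall>x\<in>?X. \<forall>e>0. \<exists>d\<in>D. \<forall>i\<in>Basis. norm (weak_pd (flow_domain K) i x - weak_pd (flow_domain K) i d) < e"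
    by (elim exE conjE) (rule that)
  have "\<exists>d\<in>D. H1_norm K (v - d) < e" if v: "v \<in> ?X" and e: "0 < e" for v e
  proof -
    \<comment> \<open>The seminorm is at most the sum of the norms of three derivatives, which gives
      3e/4 < e.\<close>
    from e have "0 < e / 4" by simp
    then obtain d where d: "d \<in> D" "\<forall>i\<in>Basis. norm (weak_pd (flow_domain K) i v - weak_pd (flow_domain K) i d) < e / 4"
      using D(3) v by blast
    have h: "v \<in> H1_space (flow_domain K)" "d \<in> H1_space (flow_domain K)"
      using v d(1) D(1) V_space_H1 by auto
    have eq: "weak_pd (flow_domain K) i (v - d) = weak_pd (flow_domain K) i v - weak_pd (flow_domain K) i d"
      if "i \<in> Basis" for i
    proof -
      note o = flow_domain_open_bounded(1)[OF K]
      have "weak_pd (flow_domain K) i (v + (-1) *\<^sub>R d) = weak_pd (flow_domain K) i v + (-1) *\<^sub>R weak_pd (flow_domain K) i d"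
        using H1_space_add(2)[OF o h(1) H1_space_scaleR(1)[OF o h(2)] that] H1_space_scaleR(2)[OF o h(2) that] by metis
      then show ?thesis by simp
    qed
    have "H1_norm K (v - d) \<le> (\<Sum>i\<in>(Basis :: (real^3) set). \<bar>norm (weak_pd (flow_domain K) i (v - d))\<bar>)"
      unfolding H1_norm_eq by (rule L2_set_le_sum_abs)
    also have "\<dots> \<le> (\<Sum>i\<in>(Basis :: (real^3) set). e / 4)"
      by (rule sum_mono) (use d(2) eq in \<open>simp add: less_imp_le\<close>)
    also have "\<dots> < e" using e by simp
    finally show ?thesis using d(1) by blast
  qed
  then show ?thesis using D by (intro exI[of _ D]) auto
qed

end

section \<open>Distributional derivatives in time\<close>

text \<open>The kernel N \<eta>(N(t - c)) lives on [c, c + 1/N], and its integral is \<Phi>(1) -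
  \<Phi>(0) = 1 by the fundamental theorem. It averages over times to the right of c, so continuity
  of U on \<open>{c..c + \<delta>}\<close> is what the limit uses.\<close>

lemma approximate_identity:
  fixes U \<Phi> \<eta> :: "real \<Rightarrow> real"
  assumes \<Phi>: "\<And>x. (\<Phi> has_real_derivative \<eta> x) (at x)" "continuous_on UNIV \<eta>" "\<And>x. 0 \<le> \<eta> x"
    "\<And>x. x \<notin> {0..1} \<Longrightarrow> \<eta> x = 0" "\<Phi> 0 = 0" "\<Phi> 1 = 1"
  and U: "continuous_on {c..c + \<delta>} U" "0 < \<delta>" and S: "{c..c + \<delta>} \<subseteq> I"
  shows "(\<lambda>n. LINT t:I|lebesgue. (real (Suc n) * \<eta> (real (Suc n) * (t - c))) * U t) \<longlonglongrightarrow> U c"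
proof (rule LIMSEQ_I)
  fix e :: real assume "0 < e"
  then have e2: "0 < e / 2" by simp
  have "c \<in> {c..c + \<delta>}" using U(2) by simp
  then obtain d where d: "0 < d" "\<And>t. t \<in> {c..c + \<delta>} \<Longrightarrow> dist t c < d \<Longrightarrow> dist (U t) (U c) < e / 2"
    using U(1) e2 unfolding continuous_on_iff by metis
  have "0 < min d \<delta>" using d U by simp
  then obtain n0 where n0: "1 / real (Suc n0) < min d \<delta>" using nat_approx_posE by blast
  have "norm ((LINT t:I|lebesgue. (real (Suc n) * \<eta> (real (Suc n) * (t - c))) * U t) - U c) < e" if n: "n \<ge> n0" for n
  proof -
    define N where "N = real (Suc n)"
    have N: "0 < N" by (simp add: N_def)
    have "1 / N \<le> 1 / real (Suc n0)" using n by (simp add: N_def frac_le)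
    then have Nd: "1 / N < d" "1 / N < \<delta>" using n0 by auto
    define S where "S = {c..c + 1 / N}"
    define k where "k t = N * \<eta> (N * (t - c))" for t
    have k0: "k t = 0" if "t \<notin> S" for t
    proof -
      have "N * (t - c) \<notin> {0..1}" using that N by (auto simp: S_def field_simps zero_le_mult_iff)
      then show ?thesis using \<Phi>(4) by (simp add: k_def)
    qed
    have kc: "continuous_on A k" for A
      unfolding k_def by (intro continuous_intros continuous_on_compose2[OF \<Phi>(2)]) auto
    have SS: "S \<subseteq> {c..c + \<delta>}" "S \<subseteq> I" using Nd S by (auto simp: S_def)
    have ik: "set_integrable lebesgue S k"
      unfolding S_def by (intro absolutely_integrable_continuous_real kc)
    have iU: "set_integrable lebesgue S (\<lambda>t. k t * U t)"
      using SS(1) unfolding S_def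
      by (intro absolutely_integrable_continuous_real continuous_intros kc continuous_on_subset[OF U(1)])
    have iUc: "set_integrable lebesgue S (\<lambda>t. k t * U c)" using ik by (rule set_integrable_mult_left)
    have "((\<lambda>t. \<Phi> (N * (t - c))) has_real_derivative k t) (at t)" for t
    proof -
      have "((\<lambda>t. N * (t - c)) has_real_derivative N) (at t)" by (auto intro!: derivative_eq_intros)
      from DERIV_chain2[OF \<Phi>(1) this] show ?thesis by (simp add: k_def mult.commute)
    qed
    then have "(k has_integral \<Phi> (N * (c + 1 / N - c)) - \<Phi> (N * (c - c))) {c..c + 1 / N}"
      using N by (intro fundamental_theorem_of_calculus)
        (auto simp flip: has_real_derivative_iff_has_vector_derivative intro: has_field_derivative_at_within)
    then have "(k has_integral 1) S" using N \<Phi>(5,6) by (simp add: S_def)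
    then have int1: "(LINT t:S|lebesgue. k t) = 1"
      using set_lebesgue_integral_eq_integral(2)[OF ik] by (simp add: integral_unique)
    have "(LINT t:I|lebesgue. k t * U t) = (LINT t:S|lebesgue. k t * U t)"
      unfolding set_lebesgue_integral_def
      by (rule Bochner_Integration.integral_cong) (use k0 SS in \<open>auto simp: indicator_def\<close>)
    moreover have "(LINT t:S|lebesgue. k t * U t) - U c = (LINT t:S|lebesgue. k t * U t - k t * U c)"
      using int1 by (simp add: set_integral_diff(2)[OF iU iUc])
    ultimately have "norm ((LINT t:I|lebesgue. k t * U t) - U c) = norm (LINT t:S|lebesgue. k t * U t - k t * U c)"
      by (simp only:)
    also have "\<dots> \<le> (LINT t:S|lebesgue. norm (k t * U t - k t * U c))"
      by (intro set_integral_norm_bound set_integral_diff iU iUc)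
    also have "\<dots> \<le> (LINT t:S|lebesgue. (e / 2) * k t)"
    proof (rule set_integral_mono)
      show "set_integrable lebesgue S (\<lambda>t. norm (k t * U t - k t * U c))"
        using set_integral_diff(1)[OF iU iUc] by (rule set_integrable_norm)
      show "set_integrable lebesgue S (\<lambda>t. (e / 2) * k t)" using ik by (rule set_integrable_mult_right)
      fix t assume t: "t \<in> S"
      have "dist t c < d" using t Nd(1) by (auto simp: S_def dist_real_def)
      then have "\<bar>U t - U c\<bar> \<le> e / 2" using d(2)[of t] t SS(1) by (auto simp: dist_real_def)
      moreover have "0 \<le> k t" using N \<Phi>(3) by (simp add: k_def)
      ultimately have "k t * \<bar>U t - U c\<bar> \<le> k t * (e / 2)" by (rule mult_left_mono)
      moreover have "norm (k t * U t - k t * U c) = k t * \<bar>U t - U c\<bar>"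
        using \<open>0 \<le> k t\<close> by (simp add: right_diff_distrib[symmetric] abs_mult)
      ultimately show "norm (k t * U t - k t * U c) \<le> (e / 2) * k t" by (simp add: mult.commute)
    qed
    also have "\<dots> = e / 2" using int1 by simp
    finally show ?thesis using \<open>0 < e\<close> by (simp add: k_def N_def)
  qed
  then show "\<exists>no. \<forall>n\<ge>no. norm ((LINT t:I|lebesgue. (real (Suc n) * \<eta> (real (Suc n) * (t - c))) * U t) - U c) < e"
    by blast
qed

text \<open>The test functions are smoothed indicators of [a,b]. Their derivatives are differences
  of two approximate identities, at a and at b, so the left side of the distributional identity
  tends to the increment of U; the right side tends to the integral of G by dominated
  convergence.\<close>

lemma increment_eq_integral_of_distributional_derivative:
  fixes U G :: "real \<Rightarrow> real"
  assumes U: "continuous_on (interior I) U"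
    and G: "\<And>a b. {a..b} \<subseteq> interior I \<Longrightarrow> set_integrable lebesgue {a..b} G"
    and dist: "\<And>\<phi>. \<phi> \<in> test_functions (interior I) \<Longrightarrow>
      - (LINT t:I|lebesgue. deriv \<phi> t * U t) = (LINT t:I|lebesgue. \<phi> t * G t)"
    and ab: "a \<le> b" "{a..b} \<subseteq> interior I"
  shows "U b - U a = (LINT t:{a..<b}|lebesgue. G t)"
proof -
  obtain \<Phi> \<eta> :: "real \<Rightarrow> real" where \<Phi>: "smooth \<Phi>" "\<And>x. (\<Phi> has_real_derivative \<eta> x) (at x)"
    "continuous_on UNIV \<eta>" "\<And>x. 0 \<le> \<eta> x" "\<And>x. x \<notin> {0..1} \<Longrightarrow> \<eta> x = 0"
    "\<And>x. x \<le> 0 \<Longrightarrow> \<Phi> x = 0" "\<And>x. 1 \<le> x \<Longrightarrow> \<Phi> x = 1" "\<And>x. 0 \<le> \<Phi> x" "\<And>x. \<Phi> x \<le> 1"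
    by (rule smooth_step_exists) blast
  have "b \<in> interior I" using ab by auto
  \<comment> \<open>The smoothed indicators reach to b + 1/N, so room in the interior to the right
    of b is required.\<close>
  then obtain \<delta> where \<delta>: "0 < \<delta>" "cball b \<delta> \<subseteq> interior I"
    using open_interior open_contains_cball by blast
  have sub: "{a..b + \<delta>} \<subseteq> interior I"
  proof
    fix t assume "t \<in> {a..b + \<delta>}"
    then show "t \<in> interior I" using ab \<delta> by (cases "t \<le> b") (auto simp: dist_real_def subset_iff)
  qed
  have "a \<in> interior I" using ab by auto
  then obtain \<delta>' where \<delta>': "0 < \<delta>'" "cball a \<delta>' \<subseteq> interior I"
    using open_interior open_contains_cball by blast
  define N where "N n = real (Suc n)" for n
  have N: "0 < N n" for n by (simp add: N_def)
  \<comment> \<open>Rises from 0 to 1 on [a, a + 1/N] and falls back on [b, b + 1/N].\<close>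
  define \<phi> where "\<phi> n t = \<Phi> (N n * (t - a)) - \<Phi> (N n * (t - b))" for n t
  define k where "k n c t = N n * \<eta> (N n * (t - c))" for n c t
  have d\<phi>: "(\<phi> n has_real_derivative k n a t - k n b t) (at t)" for n t
    unfolding \<phi>_def k_def by (auto intro!: derivative_eq_intros DERIV_chain'[OF _ \<Phi>(2)])
  have smooth\<phi>: "smooth (\<phi> n)" for n
  proof -
    have "smooth (\<lambda>t. \<Phi> (t \<bullet> N n + - (N n * a)) + (- 1) *\<^sub>R \<Phi> (t \<bullet> N n + - (N n * b)))"
      by (intro smooth_add smooth_scaleR smooth_const smooth_compose_affine \<Phi>(1))
    then show ?thesis by (simp add: \<phi>_def[abs_def] algebra_simps)
  qed
  have \<phi>01: "\<bar>\<phi> n t\<bar> \<le> 1" for n t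
    using \<Phi>(8)[of "N n * (t - a)"] \<Phi>(9)[of "N n * (t - a)"] \<Phi>(8)[of "N n * (t - b)"] \<Phi>(9)[of "N n * (t - b)"]
    by (simp add: \<phi>_def)
  have \<phi>0: "\<phi> n t = 0" if "t \<notin> {a..b + 1 / N n}" for n t
  proof (cases "t < a")
    case True
    then have "N n * (t - a) \<le> 0" "N n * (t - b) \<le> 0" using N[of n] ab by (auto intro!: mult_nonneg_nonpos)
    then show ?thesis by (simp add: \<phi>_def \<Phi>(6))
  next
    case False
    then have t: "b + 1 / N n < t" using that by simp
    then have "1 \<le> N n * (t - b)" using N[of n] by (simp add: field_simps)
    moreover have "N n * (t - b) \<le> N n * (t - a)" using N[of n] ab by simp
    ultimately show ?thesis by (simp add: \<phi>_def \<Phi>(7))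
  qed
  obtain n0 where n0: "1 / real (Suc n0) < \<delta>" using nat_approx_posE[OF \<delta>(1)] .
  have N\<delta>: "1 / N n < \<delta>" if "n0 \<le> n" for n
  proof -
    have "1 / N n \<le> 1 / real (Suc n0)" using that by (simp add: N_def frac_le)
    then show ?thesis using n0 by linarith
  qed
  have Ua: "(\<lambda>n. LINT t:I|lebesgue. k n a t * U t) \<longlonglongrightarrow> U a"
    unfolding k_def N_def
    by (rule approximate_identity[OF \<Phi>(2-5), where \<delta> = \<delta>'])
      (use \<Phi>(6,7) \<delta>' interior_subset[of I] in \<open>auto intro!: continuous_on_subset[OF U] simp: dist_real_def subset_iff\<close>)
  have Ub: "(\<lambda>n. LINT t:I|lebesgue. k n b t * U t) \<longlonglongrightarrow> U b"
    unfolding k_def N_def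
    by (rule approximate_identity[OF \<Phi>(2-5), where \<delta> = \<delta>])
      (use \<Phi>(6,7) \<delta> interior_subset[of I] in \<open>auto intro!: continuous_on_subset[OF U] simp: dist_real_def subset_iff\<close>)
  obtain n1 where n1: "1 / real (Suc n1) < \<delta>'" using nat_approx_posE[OF \<delta>'(1)] .
  have N\<delta>': "1 / N n < \<delta>'" if "n1 \<le> n" for n
  proof -
    have "1 / N n \<le> 1 / real (Suc n1)" using that by (simp add: N_def frac_le)
    then show ?thesis using n1 by linarith
  qed
  have kint: "set_integrable lebesgue I (\<lambda>t. k n c t * U t)" if c: "{c..c + 1 / N n} \<subseteq> interior I" for n c
  proof -
    have "continuous_on {c..c + 1 / N n} (\<lambda>t. k n c t * U t)"
      unfolding k_def
      by (intro continuous_intros continuous_on_compose2[OF \<Phi>(3)] continuous_on_subset[OF U c]) auto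
    then have "set_integrable lebesgue {c..c + 1 / N n} (\<lambda>t. k n c t * U t)"
      by (rule absolutely_integrable_continuous_real)
    moreover have "indicator {c..c + 1 / N n} t *\<^sub>R (k n c t * U t) = indicator I t *\<^sub>R (k n c t * U t)" for t
    proof (cases "t \<in> {c..c + 1 / N n}")
      case True
      then show ?thesis using c interior_subset[of I] by (auto simp: indicator_def)
    next
      case False
      then have "N n * (t - c) \<notin> {0..1}" using N[of n] by (auto simp: field_simps zero_le_mult_iff)
      then show ?thesis using \<Phi>(5) by (simp add: k_def)
    qed
    ultimately show ?thesis unfolding set_integrable_def by (simp only:)
  qed
  have eq: "- ((LINT t:I|lebesgue. k n a t * U t) - (LINT t:I|lebesgue. k n b t * U t)) = (LINT t:I|lebesgue. \<phi> n t * G t)"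
    if n: "n0 \<le> n" "n1 \<le> n" for n
  proof -
    have "{a..b + 1 / N n} \<subseteq> interior I" using sub N\<delta>[OF n(1)] by auto
    then have "\<phi> n \<in> test_functions (interior I)"
      unfolding test_functions_def using smooth\<phi> \<phi>0 by (auto intro!: exI[of _ "{a..b + 1 / N n}"])
    from dist[OF this]
    have "- (LINT t:I|lebesgue. (k n a t - k n b t) * U t) = (LINT t:I|lebesgue. \<phi> n t * G t)"
      using DERIV_imp_deriv[OF d\<phi>] by simp
    moreover have "(LINT t:I|lebesgue. (k n a t - k n b t) * U t) =
        (LINT t:I|lebesgue. k n a t * U t) - (LINT t:I|lebesgue. k n b t * U t)"
    proof -
      have "{a..a + 1 / N n} \<subseteq> interior I" using \<delta>'(2) N\<delta>'[OF n(2)] by (auto simp: dist_real_def subset_iff)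
      moreover have "{b..b + 1 / N n} \<subseteq> interior I" using \<delta>(2) N\<delta>[OF n(1)] by (auto simp: dist_real_def subset_iff)
      ultimately show ?thesis
        unfolding left_diff_distrib by (intro set_integral_diff kint)
    qed
    ultimately show ?thesis by simp
  qed
  have lim1: "(\<lambda>n. - ((LINT t:I|lebesgue. k n a t * U t) - (LINT t:I|lebesgue. k n b t * U t))) \<longlonglongrightarrow> - (U a - U b)"
    by (intro tendsto_intros Ua Ub)
  have ev: "eventually (\<lambda>n. n0 \<le> n \<and> n1 \<le> n) sequentially"
    by (intro eventually_conj eventually_ge_at_top)
  have lim1': "(\<lambda>n. LINT t:I|lebesgue. \<phi> n t * G t) \<longlonglongrightarrow> - (U a - U b)"
    by (rule Lim_transform_eventually[OF lim1]) (use ev in eventually_elim, use eq in blast)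
  have iG: "set_integrable lebesgue {a..b + \<delta>} G" by (rule G[OF sub])
  have lim2: "(\<lambda>n. LINT t|lebesgue. indicator {a..b + \<delta>} t * (\<phi> n t * G t)) \<longlonglongrightarrow> (LINT t|lebesgue. indicator {a..<b} t *\<^sub>R G t)"
  proof (rule integral_dominated_convergence)
    show "integrable lebesgue (\<lambda>t. norm (indicator {a..b + \<delta>} t *\<^sub>R G t))"
      using iG unfolding set_integrable_def by (rule integrable_norm)
    have mG: "(\<lambda>t. indicator {a..b + \<delta>} t *\<^sub>R G t) \<in> borel_measurable lebesgue"
      using iG unfolding set_integrable_def by (rule borel_measurable_integrable)
    have "\<phi> n \<in> borel_measurable lebesgue" for n
      using borel_measurable_continuous_onI[OF smooth_imp_continuous[OF smooth\<phi>]] by (simp add: measurable_completion)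
    from borel_measurable_times[OF this mG]
    show "(\<lambda>t. indicator {a..b + \<delta>} t * (\<phi> n t * G t)) \<in> borel_measurable lebesgue" for n
      by (simp only: real_scaleR_def mult.left_commute)
    have "(\<lambda>t. indicator {a..<b} t *\<^sub>R (indicator {a..b + \<delta>} t *\<^sub>R G t)) \<in> borel_measurable lebesgue"
      by (intro borel_measurable_scaleR borel_measurable_indicator mG) auto
    moreover have "indicator {a..<b} t *\<^sub>R (indicator {a..b + \<delta>} t *\<^sub>R G t) = indicator {a..<b} t *\<^sub>R G t" for t
      using \<delta>(1) by (auto simp: indicator_def)
    ultimately show "(\<lambda>t. indicator {a..<b} t *\<^sub>R G t) \<in> borel_measurable lebesgue" by (simp only:)
    show "AE t in lebesgue. norm (indicator {a..b + \<delta>} t * (\<phi> n t * G t)) \<le> norm (indicator {a..b + \<delta>} t *\<^sub>R G t)" for n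
      using \<phi>01[of n] by (auto simp: abs_mult intro!: mult_left_le_one_le mult_left_mono)
    \<comment> \<open>The value at t = a is always 0 and at t = b need not tend to 0; as a null set
      the two points do not affect the limit integral.\<close>
    have "AE t in lebesgue. t \<noteq> a \<and> t \<noteq> b"
      by (intro AE_conjI AE_completion) (auto intro: AE_lborel_singleton)
    then show "AE t in lebesgue. (\<lambda>n. indicator {a..b + \<delta>} t * (\<phi> n t * G t)) \<longlonglongrightarrow> indicator {a..<b} t *\<^sub>R G t"
    proof eventually_elim
      case (elim t)
      have big: "eventually (\<lambda>n. 1 \<le> N n * c) sequentially" if "0 < c" for c
        unfolding N_def using that by real_asymp
      consider "t < a" | "a < t" "t < b" | "b < t" using elim by linarith
      then show ?case
      proof cases
        case 1
        then show ?thesis by simp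
      next
        case 2
        have "0 < t - a" using 2 by simp
        from big[OF this] have "eventually (\<lambda>n. \<phi> n t = 1) sequentially"
        proof eventually_elim
          case (elim n)
          have "N n * (t - b) \<le> 0" using 2 N[of n] by (intro mult_nonneg_nonpos) auto
          then show ?case using elim by (simp add: \<phi>_def \<Phi>(6,7))
        qed
        then have "eventually (\<lambda>n. indicator {a..b + \<delta>} t * (\<phi> n t * G t) = indicator {a..<b} t *\<^sub>R G t) sequentially"
          by eventually_elim (use 2 \<delta> in simp)
        then show ?thesis by (rule tendsto_eventually)
      next
        case 3
        have "0 < t - b" using 3 by simp
        from big[OF this] have "eventually (\<lambda>n. \<phi> n t = 0) sequentially"
        proof eventually_elim
          case (elim n)
          have "N n * (t - b) \<le> N n * (t - a)" using N[of n] ab by simp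
          then show ?case using elim by (simp add: \<phi>_def \<Phi>(7))
        qed
        then have "eventually (\<lambda>n. indicator {a..b + \<delta>} t * (\<phi> n t * G t) = indicator {a..<b} t *\<^sub>R G t) sequentially"
          by eventually_elim (use 3 in simp)
        then show ?thesis by (rule tendsto_eventually)
      qed
    qed
  qed
  have lim2': "(\<lambda>n. LINT t:I|lebesgue. \<phi> n t * G t) \<longlonglongrightarrow> (LINT t:{a..<b}|lebesgue. G t)"
    unfolding set_lebesgue_integral_def
  proof (rule Lim_transform_eventually[OF lim2])
    show "\<forall>\<^sub>F n in sequentially. (LINT t|lebesgue. indicator {a..b + \<delta>} t * (\<phi> n t * G t)) = (LINT t|lebesgue. indicator I t *\<^sub>R (\<phi> n t * G t))"
      using ev
    proof eventually_elim
      case (elim n)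
      have "indicator {a..b + \<delta>} t * (\<phi> n t * G t) = indicator I t *\<^sub>R (\<phi> n t * G t)" for t
      proof (cases "t \<in> {a..b + 1 / N n}")
        case True
        then have "t \<in> {a..b + \<delta>}" using N\<delta>[of n] elim by auto
        moreover from this have "t \<in> I" using sub interior_subset[of I] by blast
        ultimately show ?thesis by simp
      qed (use \<phi>0 in simp)
      then show ?case by (simp only:)
    qed
  qed
  show ?thesis using LIMSEQ_unique[OF lim1' lim2'] by simp
qed

section \<open>Averages over the cells of a grid\<close>

lemma integrable_indicator_Ico:
  fixes a b :: real
  shows "integrable lebesgue (indicat_real {a..<b})"
proof -
  have "{a..<b} \<in> lmeasurable"
    by (rule bounded_set_imp_lmeasurable) (auto intro: bounded_subset[OF bounded_closed_interval])
  then show ?thesis by (simp only: lmeasurable_iff_integrable)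
qed

lemma set_integral_const_Ico:
  fixes a b :: real
  shows "set_integrable lebesgue {a..<b} (\<lambda>t. c :: real)"
  "a \<le> b \<Longrightarrow> (LINT t:{a..<b}|lebesgue. c) = (b - a) * (c :: real)"
proof -
  have eq: "(\<lambda>t. indicator {a..<b} t *\<^sub>R c) = (\<lambda>t. indicat_real {a..<b} t * c)" by simp
  show "set_integrable lebesgue {a..<b} (\<lambda>t. c)"
    unfolding set_integrable_def eq by (intro integrable_mult_left integrable_indicator_Ico)
  show "a \<le> b \<Longrightarrow> (LINT t:{a..<b}|lebesgue. c) = (b - a) * c"
    unfolding set_lebesgue_integral_def eq by (simp add: measure_completion measure_def)
qed

text \<open>Truncation at a high level costs little in L^1 by dominated convergence. Once truncated,
  almost everywhere convergent continuous approximations, truncated at the same level B, differ from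
  the function by at most 2B, so dominated convergence applies a second time.\<close>

lemma L1_approx_continuous:
  fixes G :: "real \<Rightarrow> real"
  assumes G: "set_integrable lebesgue {a..<b} G" and e: "0 < e"
  shows "\<exists>g. continuous_on UNIV g \<and> (LINT t:{a..<b}|lebesgue. \<bar>G t - g t\<bar>) < e"
proof -
  define F where "F t = indicator {a..<b} t *\<^sub>R G t" for t
  have iF: "integrable lebesgue F" using G by (simp add: set_integrable_def F_def[abs_def])
  then have mF: "F \<in> borel_measurable lebesgue" by (rule borel_measurable_integrable)
  define c where "c B x = max (- B) (min B x)" for B x :: real
  have cont_c: "continuous_on UNIV (c B)" for B unfolding c_def by (intro continuous_intros)
  have c_bd: "\<bar>c B x\<bar> \<le> B" if "0 \<le> B" for B x using that by (auto simp: c_def)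
  have c_le: "\<bar>c B x - x\<bar> \<le> \<bar>x\<bar>" if "0 \<le> B" for B x using that by (auto simp: c_def)
  have mc: "(\<lambda>t. c B (F t)) \<in> borel_measurable lebesgue" for B
    using mF unfolding c_def by measurable
  have "(\<lambda>n. LINT t|lebesgue. \<bar>c (real n) (F t) - F t\<bar>) \<longlonglongrightarrow> (LINT t|(lebesgue :: real measure). (0::real))"
  proof (rule integral_dominated_convergence)
    show "integrable lebesgue (\<lambda>t. \<bar>F t\<bar>)" using iF by simp
    show "AE t in lebesgue. (\<lambda>n. \<bar>c (real n) (F t) - F t\<bar>) \<longlonglongrightarrow> 0"
    proof (rule AE_I2)
      fix t
      obtain m where m: "\<bar>F t\<bar> \<le> real m" using real_arch_simple by blast
      show "(\<lambda>n. \<bar>c (real n) (F t) - F t\<bar>) \<longlonglongrightarrow> 0"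
        by (rule tendsto_eventually, rule eventually_sequentiallyI[of m]) (use m in \<open>auto simp: c_def\<close>)
    qed
  qed (use mc mF c_le in auto)
  then have "(\<lambda>n. LINT t|lebesgue. \<bar>c (real n) (F t) - F t\<bar>) \<longlonglongrightarrow> 0" by simp
  then have "eventually (\<lambda>n. (LINT t|lebesgue. \<bar>c (real n) (F t) - F t\<bar>) < e / 2) sequentially"
    using e by (intro order_tendstoD) auto
  then obtain n0 where n0: "(LINT t|lebesgue. \<bar>c (real n0) (F t) - F t\<bar>) < e / 2"
    unfolding eventually_sequentially by blast
  define B where "B = real n0"
  have B: "0 \<le> B" by (simp add: B_def)
  \<comment> \<open>This form of measurability provides the continuous functions that converge to
    \<open>F\<close> outside a negligible set.\<close>
  have "F measurable_on UNIV"
    by (rule lebesgue_measurable_imp_measurable_on_real[OF mF]) simp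
  then obtain Z g where Z: "negligible Z" and g: "\<And>n. continuous_on UNIV (g n)"
    and lim: "\<And>x. x \<notin> Z \<Longrightarrow> (\<lambda>n. g n x) \<longlonglongrightarrow> F x"
    unfolding measurable_on_def by auto
  have cg: "continuous_on UNIV (\<lambda>t. c B (g n t))" for n
    using continuous_on_compose2[OF cont_c g[of n]] by simp
  have mg: "(\<lambda>t. c B (g n t)) \<in> borel_measurable lebesgue" for n
    using borel_measurable_continuous_onI[OF cg] by (simp add: measurable_completion)
  have "(\<lambda>n. LINT t|lebesgue. indicator {a..<b} t * \<bar>c B (F t) - c B (g n t)\<bar>) \<longlonglongrightarrow> (LINT t|(lebesgue :: real measure). (0::real))"
  proof (rule integral_dominated_convergence)
    show "integrable lebesgue (\<lambda>t. indicator {a..<b} t * (2 * B))"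
      by (intro integrable_mult_left integrable_indicator_Ico)
    have "AE t in lebesgue. t \<notin> Z"
      using Z by (auto simp: negligible_iff_null_sets intro: AE_not_in)
    then show "AE t in lebesgue. (\<lambda>n. indicator {a..<b} t * \<bar>c B (F t) - c B (g n t)\<bar>) \<longlonglongrightarrow> 0"
    proof eventually_elim
      case (elim t)
      have "(\<lambda>n. c B (g n t)) \<longlonglongrightarrow> c B (F t)"
        unfolding c_def by (intro tendsto_intros lim elim)
      then have "(\<lambda>n. indicator {a..<b} t * \<bar>c B (F t) - c B (g n t)\<bar>) \<longlonglongrightarrow> indicator {a..<b} t * \<bar>c B (F t) - c B (F t)\<bar>"
        by (intro tendsto_intros)
      then show ?case by simp
    qed
    show "AE t in lebesgue. norm (indicator {a..<b} t * \<bar>c B (F t) - c B (g n t)\<bar>) \<le> indicator {a..<b} t * (2 * B)" for n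
    proof (rule AE_I2)
      fix t
      have "\<bar>c B (F t) - c B (g n t)\<bar> \<le> 2 * B" using c_bd[OF B, of "F t"] c_bd[OF B, of "g n t"] by linarith
      then show "norm (indicator {a..<b} t * \<bar>c B (F t) - c B (g n t)\<bar>) \<le> indicator {a..<b} t * (2 * B)"
        by (simp add: indicator_def)
    qed
    show "(\<lambda>t. indicator {a..<b} t * \<bar>c B (F t) - c B (g n t)\<bar>) \<in> borel_measurable lebesgue" for n
      by (intro borel_measurable_times borel_measurable_abs borel_measurable_diff borel_measurable_indicator mc mg) auto
  qed simp
  then have "(\<lambda>n. LINT t|lebesgue. indicator {a..<b} t * \<bar>c B (F t) - c B (g n t)\<bar>) \<longlonglongrightarrow> 0" by simp
  then have "eventually (\<lambda>n. (LINT t|lebesgue. indicator {a..<b} t * \<bar>c B (F t) - c B (g n t)\<bar>) < e / 2) sequentially"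
    using e by (intro order_tendstoD) auto
  then obtain n1 where n1: "(LINT t|lebesgue. indicator {a..<b} t * \<bar>c B (F t) - c B (g n1 t)\<bar>) < e / 2"
    unfolding eventually_sequentially by blast
  have i1: "integrable lebesgue (\<lambda>t. \<bar>c B (F t) - F t\<bar>)"
    by (rule Bochner_Integration.integrable_bound[OF iF]) (use mc mF c_le[OF B] in auto)
  have i2: "integrable lebesgue (\<lambda>t. indicator {a..<b} t * \<bar>c B (F t) - c B (g n1 t)\<bar>)"
  proof (rule Bochner_Integration.integrable_bound)
    show "integrable lebesgue (\<lambda>t. indicator {a..<b} t * (2 * B))"
      by (intro integrable_mult_left integrable_indicator_Ico)
    show "AE t in lebesgue. norm (indicator {a..<b} t * \<bar>c B (F t) - c B (g n1 t)\<bar>) \<le> norm (indicator {a..<b} t * (2 * B))"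
    proof (rule AE_I2)
      fix t
      have "\<bar>c B (F t) - c B (g n1 t)\<bar> \<le> 2 * B" using c_bd[OF B, of "F t"] c_bd[OF B, of "g n1 t"] by linarith
      then show "norm (indicator {a..<b} t * \<bar>c B (F t) - c B (g n1 t)\<bar>) \<le> norm (indicator {a..<b} t * (2 * B))"
        by (simp add: indicator_def)
    qed
    show "(\<lambda>t. indicator {a..<b} t * \<bar>c B (F t) - c B (g n1 t)\<bar>) \<in> borel_measurable lebesgue"
      by (intro borel_measurable_times borel_measurable_abs borel_measurable_diff borel_measurable_indicator mc mg) auto
  qed
  have "(LINT t:{a..<b}|lebesgue. \<bar>G t - c B (g n1 t)\<bar>) \<le>
      (LINT t|lebesgue. \<bar>c B (F t) - F t\<bar> + indicator {a..<b} t * \<bar>c B (F t) - c B (g n1 t)\<bar>)"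
    unfolding set_lebesgue_integral_def
  proof (rule integral_mono')
    show "integrable lebesgue (\<lambda>t. \<bar>c B (F t) - F t\<bar> + indicator {a..<b} t * \<bar>c B (F t) - c B (g n1 t)\<bar>)"
      by (intro Bochner_Integration.integrable_add i1 i2)
    show "indicator {a..<b} t *\<^sub>R \<bar>G t - c B (g n1 t)\<bar> \<le> \<bar>c B (F t) - F t\<bar> + indicator {a..<b} t * \<bar>c B (F t) - c B (g n1 t)\<bar>" for t
      by (cases "t \<in> {a..<b}") (auto simp: F_def)
  qed auto
  also have "\<dots> < e" using n0 n1 by (simp add: i1 i2 B_def[symmetric])
  finally show ?thesis using cg by blast
qed

section \<open>Uniform grids and cell averages\<close>

definition grid :: "real \<Rightarrow> real \<Rightarrow> nat \<Rightarrow> nat \<Rightarrow> real" where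
  "grid a b n i = a + real i * ((b - a) / real n)"

text \<open>Half-open cells partition \<open>{a..<b}\<close> without overlaps, so identities between
  step functions hold at every point and not only almost everywhere.\<close>

definition cell :: "real \<Rightarrow> real \<Rightarrow> nat \<Rightarrow> nat \<Rightarrow> real set" where
  "cell a b n i = {grid a b n i..<grid a b n (Suc i)}"

lemma grid_0: "grid a b n 0 = a"
  by (simp add: grid_def)

lemma grid_n: "0 < n \<Longrightarrow> grid a b n n = b"
  by (simp add: grid_def)

lemma grid_mono: "a \<le> b \<Longrightarrow> i \<le> j \<Longrightarrow> grid a b n i \<le> grid a b n j"
  unfolding grid_def by (intro add_left_mono mult_right_mono) auto

lemma grid_Suc: "grid a b n (Suc i) = grid a b n i + (b - a) / real n"
  by (simp add: grid_def distrib_right add_divide_distrib)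

lemma grid_in: "a \<le> b \<Longrightarrow> i \<le> n \<Longrightarrow> 0 < n \<Longrightarrow> grid a b n i \<in> {a..b}"
  using grid_mono[of a b 0 i n] grid_mono[of a b i n n] by (simp add: grid_0 grid_n)

lemma cell_sub: "a \<le> b \<Longrightarrow> i < n \<Longrightarrow> cell a b n i \<subseteq> {a..<b}"
  using grid_mono[of a b 0 i n] grid_mono[of a b "Suc i" n n] by (auto simp: cell_def grid_0 grid_n)

text \<open>The first m cells together fill the interval from a to the m-th grid point, which is the
  induction; the last grid point is b.\<close>

lemma sum_indicator_cell:
  assumes "a \<le> b" "0 < n"
  shows "(\<Sum>i<n. indicator (cell a b n i) t) = (indicator {a..<b} t :: real)"
proof -
  have "(\<Sum>i<m. indicator (cell a b n i) t) = (indicator {a..<grid a b n m} t :: real)" for m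
  proof (induction m)
    case 0
    show ?case by (simp add: grid_0)
  next
    case (Suc m)
    show ?case
      using grid_mono[OF assms(1), of 0 m n] grid_mono[OF assms(1), of m "Suc m" n]
      by (simp add: Suc) (auto simp: cell_def grid_0 indicator_def)
  qed
  from this[of n] show ?thesis using grid_n[OF assms(2)] by simp
qed

lemma sum_cell_integral:
  fixes f :: "real \<Rightarrow> real"
  assumes "a \<le> b" "0 < n" "set_integrable lebesgue {a..<b} f"
  shows "(\<Sum>i<n. (LINT t:cell a b n i|lebesgue. f t)) = (LINT t:{a..<b}|lebesgue. f t)"
proof -
  have si: "set_integrable lebesgue (cell a b n i) f" if "i < n" for i
    by (rule set_integrable_subset[OF assms(3)]) (use cell_sub[OF assms(1) that] in \<open>auto simp: cell_def\<close>)
  have "(\<Sum>i<n. (LINT t:cell a b n i|lebesgue. f t)) =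
      (LINT t|lebesgue. (\<Sum>i<n. indicator (cell a b n i) t *\<^sub>R f t))"
    unfolding set_lebesgue_integral_def
    by (subst Bochner_Integration.integral_sum) (use si in \<open>auto simp: set_integrable_def\<close>)
  also have "\<dots> = (LINT t:{a..<b}|lebesgue. f t)"
    unfolding set_lebesgue_integral_def
    by (rule Bochner_Integration.integral_cong)
      (simp_all add: sum_distrib_right[symmetric] sum_indicator_cell[OF assms(1,2)])
  finally show ?thesis .
qed

definition cell_avg :: "real \<Rightarrow> real \<Rightarrow> nat \<Rightarrow> (real \<Rightarrow> real) \<Rightarrow> nat \<Rightarrow> real" where
  "cell_avg a b n G i = (LINT s:cell a b n i|lebesgue. G s) / ((b - a) / real n)"

lemma sum_cell_pick:
  assumes "a \<le> b" "0 < n" "i < n" "t \<in> cell a b n i"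
  shows "(\<Sum>j<n. indicator (cell a b n j) t * x j) = (x i :: real)"
proof -
  have "t \<notin> cell a b n j" if "j < n" "j \<noteq> i" for j
  proof -
    consider "Suc j \<le> i" | "Suc i \<le> j" using \<open>j \<noteq> i\<close> by linarith
    then show ?thesis
      using grid_mono[OF assms(1), of "Suc j" i n] grid_mono[OF assms(1), of "Suc i" j n] assms(4)
      by cases (auto simp: cell_def)
  qed
  then have "(\<Sum>j<n. indicator (cell a b n j) t * x j) = (\<Sum>j<n. if j = i then x i else 0)"
    using assms(4) by (intro sum.cong) auto
  then show ?thesis using assms(3) by simp
qed

lemma ex_cell:
  assumes "a \<le> b" "0 < n" "t \<in> {a..<b}"
  shows "\<exists>i<n. t \<in> cell a b n i"
proof (rule ccontr)
  assume "\<not> ?thesis"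
  then have "(\<Sum>i<n. indicator (cell a b n i) t) = (0::real)" by (intro sum.neutral) auto
  then show False using sum_indicator_cell[OF assms(1,2), of t] assms(3) by simp
qed

lemma integral_cell_const:
  assumes "a \<le> b"
  shows "(LINT t:cell a b n i|lebesgue. (c::real)) = ((b - a) / real n) * c"
    "set_integrable lebesgue (cell a b n i) (\<lambda>t. c)"
proof -
  have "grid a b n i \<le> grid a b n (Suc i)" using grid_mono[OF assms] by simp
  then show "(LINT t:cell a b n i|lebesgue. c) = ((b - a) / real n) * c"
    unfolding cell_def by (subst set_integral_const_Ico(2)) (simp_all add: grid_Suc)
  show "set_integrable lebesgue (cell a b n i) (\<lambda>t. c)"
    unfolding cell_def by (rule set_integral_const_Ico(1))
qed

text \<open>For a continuous function the averages converge uniformly, and averaging does not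
  increase the L^1 norm; hence the convergence carries over from continuous functions to all of L^1
  by density. The limit is stated for \<open>Suc n\<close> because the mesh divides by the number of
  cells.\<close>

lemma L1_cell_avg:
  fixes G :: "real \<Rightarrow> real"
  assumes ab: "a < b" and G: "set_integrable lebesgue {a..<b} G"
  defines "A n t \<equiv> (\<Sum>i<n. indicator (cell a b n i) t * cell_avg a b n G i)"
  shows "\<And>n. set_integrable lebesgue {a..<b} (A n)"
    and "(\<lambda>n. LINT t:{a..<b}|lebesgue. \<bar>A (Suc n) t - G t\<bar>) \<longlonglongrightarrow> 0"
proof -
  have ab': "a \<le> b" using ab by simp
  have iA: "set_integrable lebesgue {a..<b} (\<lambda>t. \<Sum>i<n. indicator (cell a b n i) t * x i)" for n and x :: "nat \<Rightarrow> real"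
    unfolding set_integrable_def scaleR_sum_right
  proof (intro Bochner_Integration.integrable_sum)
    fix i assume "i \<in> {..<n}"
    then have "indicator {a..<b} t *\<^sub>R (indicator (cell a b n i) t * x i) = indicator (cell a b n i) t *\<^sub>R x i" for t
      using cell_sub[OF ab', of i n] by (auto simp: indicator_def)
    then show "integrable lebesgue (\<lambda>t. indicator {a..<b} t *\<^sub>R (indicator (cell a b n i) t * x i))"
      using integral_cell_const(2)[OF ab', of n i "x i"] by (simp only: set_integrable_def)
  qed
  then show iAn: "set_integrable lebesgue {a..<b} (A n)" for n unfolding A_def by simp
  show "(\<lambda>n. LINT t:{a..<b}|lebesgue. \<bar>A (Suc n) t - G t\<bar>) \<longlonglongrightarrow> 0"
  proof (rule LIMSEQ_I)
    fix e :: real assume "0 < e"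
    \<comment> \<open>The approximation error of G enters twice, directly and after averaging, and
      the uniform error is integrated over length b - a; the total is below (4 + (b - a)) e' =
      e.\<close>
    define e' where "e' = e / (4 + (b - a))"
    have e': "0 < e'" using \<open>0 < e\<close> ab by (simp add: e'_def)
    obtain g where g: "continuous_on UNIV g" "(LINT t:{a..<b}|lebesgue. \<bar>G t - g t\<bar>) < e'"
      using L1_approx_continuous[OF G e'] by blast
    have ig: "set_integrable lebesgue {a..<b} g"
    proof (rule set_integrable_subset)
      show "set_integrable lebesgue {a..b} g"
        by (intro absolutely_integrable_continuous_real continuous_on_subset[OF g(1)]) simp
    qed auto
    have iGg: "set_integrable lebesgue {a..<b} (\<lambda>t. \<bar>G t - g t\<bar>)"
      by (intro set_integrable_abs set_integral_diff G ig)
    have "uniformly_continuous_on {a..b} g"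
      by (intro compact_uniformly_continuous continuous_on_subset[OF g(1)]) auto
    then obtain d where d: "0 < d" "\<And>s t. s \<in> {a..b} \<Longrightarrow> t \<in> {a..b} \<Longrightarrow> dist s t < d \<Longrightarrow> dist (g s) (g t) < e'"
      using e' unfolding uniformly_continuous_on_def by metis
    have "0 < d / (b - a)" using d ab by simp
    then obtain n0 where n0: "1 / real (Suc n0) < d / (b - a)" using nat_approx_posE by blast
    have "norm ((LINT t:{a..<b}|lebesgue. \<bar>A (Suc n) t - G t\<bar>) - 0) < e" if "n0 \<le> n" for n
    proof -
      let ?m = "Suc n"
      define h where "h = (b - a) / real ?m"
      have h: "0 < h" using ab by (simp add: h_def)
      have "1 / real ?m \<le> 1 / real (Suc n0)" using that by (simp add: frac_le)
      then have "1 / real ?m < d / (b - a)" using n0 by linarith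
      then have hd: "h < d" using ab by (simp add: h_def field_simps)
      define Ag where "Ag t = (\<Sum>i<?m. indicator (cell a b ?m i) t * cell_avg a b ?m g i)" for t
      have csub: "set_integrable lebesgue (cell a b ?m i) f" if "i < ?m" "set_integrable lebesgue {a..<b} f" for i and f :: "real \<Rightarrow> real"
        by (rule set_integrable_subset[OF that(2)]) (use cell_sub[OF ab' that(1)] in \<open>auto simp: cell_def\<close>)
      have avg: "\<bar>cell_avg a b ?m g i - g t\<bar> \<le> e'" if i: "i < ?m" and t: "t \<in> cell a b ?m i" for i t
      proof -
        have "\<bar>(LINT s:cell a b ?m i|lebesgue. g s) - h * g t\<bar> = \<bar>LINT s:cell a b ?m i|lebesgue. g s - g t\<bar>"
          using set_integral_diff(2)[OF csub[OF i ig] integral_cell_const(2)[OF ab', of ?m i "g t"]]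
          by (simp add: integral_cell_const(1)[OF ab'] h_def)
        also have "\<dots> \<le> (LINT s:cell a b ?m i|lebesgue. \<bar>g s - g t\<bar>)"
          using set_integral_norm_bound[OF set_integral_diff(1)[OF csub[OF i ig] integral_cell_const(2)[OF ab', of ?m i "g t"]]]
          by simp
        also have "\<dots> \<le> (LINT s:cell a b ?m i|lebesgue. e')"
        proof (rule set_integral_mono)
          show "set_integrable lebesgue (cell a b ?m i) (\<lambda>s. \<bar>g s - g t\<bar>)"
            by (intro set_integrable_abs set_integral_diff csub[OF i ig] integral_cell_const[OF ab'])
          fix s assume s: "s \<in> cell a b ?m i"
          have "dist s t < h" using s t by (auto simp: cell_def grid_Suc h_def dist_real_def)
          then show "\<bar>g s - g t\<bar> \<le> e'"
            using d(2)[of s t] hd s t cell_sub[OF ab' i] by (force simp: dist_real_def)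
        qed (rule integral_cell_const[OF ab'])
        also have "\<dots> = h * e'" by (simp only: integral_cell_const(1)[OF ab'] h_def)
        finally have "\<bar>(LINT s:cell a b ?m i|lebesgue. g s) - h * g t\<bar> / h \<le> e'" using h by (simp add: field_simps)
        moreover have "\<bar>(LINT s:cell a b ?m i|lebesgue. g s) - h * g t\<bar> / h = \<bar>cell_avg a b ?m g i - g t\<bar>"
        proof -
          have "cell_avg a b ?m g i - g t = ((LINT s:cell a b ?m i|lebesgue. g s) - h * g t) / h"
            using h unfolding cell_avg_def h_def[symmetric] by (simp add: field_simps)
          then show ?thesis using h by (simp add: abs_divide)
        qed
        ultimately show ?thesis by simp
      qed
      have p1: "\<bar>Ag t - g t\<bar> \<le> e'" if "t \<in> {a..<b}" for t
      proof -
        have "\<exists>i<?m. t \<in> cell a b ?m i" by (rule ex_cell[OF ab' _ that]) simp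
        then obtain i where i: "i < ?m" "t \<in> cell a b ?m i" by blast
        have "Ag t = cell_avg a b ?m g i" unfolding Ag_def by (rule sum_cell_pick[OF ab' _ i]) simp
        then show ?thesis using avg[OF i] by simp
      qed
      \<comment> \<open>Averaging is a contraction in L^1: on each cell the difference of the
        averages is the absolute value of an integral and is bounded by the integral of the absolute
        value.\<close>
      have p2: "(LINT t:{a..<b}|lebesgue. \<bar>A ?m t - Ag t\<bar>) \<le> (LINT t:{a..<b}|lebesgue. \<bar>G t - g t\<bar>)"
      proof -
        have "(LINT t:{a..<b}|lebesgue. \<bar>A ?m t - Ag t\<bar>) = (\<Sum>i<?m. (LINT t:cell a b ?m i|lebesgue. \<bar>A ?m t - Ag t\<bar>))"
          by (rule sum_cell_integral[symmetric, OF ab'])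
            (simp_all only: Ag_def[abs_def] set_integrable_abs set_integral_diff(1)[OF iAn iA] zero_less_Suc)
        also have "\<dots> \<le> (\<Sum>i<?m. (LINT t:cell a b ?m i|lebesgue. \<bar>G t - g t\<bar>))"
        proof (rule sum_mono)
          fix i assume "i \<in> {..<?m}"
          then have i: "i < ?m" by simp
          let ?x = "\<bar>cell_avg a b ?m G i - cell_avg a b ?m g i\<bar>"
          have "(LINT t:cell a b ?m i|lebesgue. \<bar>A ?m t - Ag t\<bar>) = (LINT t:cell a b ?m i|lebesgue. ?x)"
          proof (rule set_lebesgue_integral_cong)
            have "A ?m t = cell_avg a b ?m G i" "Ag t = cell_avg a b ?m g i" if "t \<in> cell a b ?m i" for t
              unfolding A_def Ag_def by (rule sum_cell_pick[OF ab' _ i that], simp)+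
            then show "\<forall>t. t \<in> cell a b ?m i \<longrightarrow> \<bar>A ?m t - Ag t\<bar> = ?x" by simp
          qed (simp add: cell_def)
          also have "\<dots> = h * ?x" by (simp only: integral_cell_const(1)[OF ab'] h_def)
          also have "\<dots> = \<bar>(LINT t:cell a b ?m i|lebesgue. G t) - (LINT t:cell a b ?m i|lebesgue. g t)\<bar>"
            using h unfolding cell_avg_def h_def[symmetric] diff_divide_distrib[symmetric] abs_divide by simp
          also have "\<dots> = \<bar>LINT t:cell a b ?m i|lebesgue. G t - g t\<bar>"
            by (simp add: set_integral_diff(2)[OF csub[OF i G] csub[OF i ig]])
          also have "\<dots> \<le> (LINT t:cell a b ?m i|lebesgue. \<bar>G t - g t\<bar>)"
            using set_integral_norm_bound[OF set_integral_diff(1)[OF csub[OF i G] csub[OF i ig]]] by simp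
          finally show "(LINT t:cell a b ?m i|lebesgue. \<bar>A ?m t - Ag t\<bar>) \<le> (LINT t:cell a b ?m i|lebesgue. \<bar>G t - g t\<bar>)" .
        qed
        also have "\<dots> = (LINT t:{a..<b}|lebesgue. \<bar>G t - g t\<bar>)"
          by (rule sum_cell_integral[OF ab' _ iGg]) simp
        finally show ?thesis .
      qed
      have i3: "set_integrable lebesgue {a..<b} (\<lambda>t. \<bar>A ?m t - Ag t\<bar>)"
        unfolding Ag_def[abs_def] by (intro set_integrable_abs set_integral_diff iAn iA)
      have i4: "set_integrable lebesgue {a..<b} (\<lambda>t. e')"
        by (rule set_integral_const_Ico)
      have "(LINT t:{a..<b}|lebesgue. \<bar>A ?m t - G t\<bar>) \<le>
          (LINT t:{a..<b}|lebesgue. (\<bar>A ?m t - Ag t\<bar> + e') + \<bar>G t - g t\<bar>)"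
      proof (rule set_integral_mono)
        show "set_integrable lebesgue {a..<b} (\<lambda>t. \<bar>A ?m t - G t\<bar>)"
          by (intro set_integrable_abs set_integral_diff iAn G)
        show "set_integrable lebesgue {a..<b} (\<lambda>t. (\<bar>A ?m t - Ag t\<bar> + e') + \<bar>G t - g t\<bar>)"
          by (intro set_integral_add i3 i4 iGg)
        show "\<bar>A ?m t - G t\<bar> \<le> (\<bar>A ?m t - Ag t\<bar> + e') + \<bar>G t - g t\<bar>" if "t \<in> {a..<b}" for t
          using p1[OF that] by linarith
      qed
      also have "\<dots> = (LINT t:{a..<b}|lebesgue. \<bar>A ?m t - Ag t\<bar>) + (b - a) * e' + (LINT t:{a..<b}|lebesgue. \<bar>G t - g t\<bar>)"
      proof -
        have "(LINT t:{a..<b}|lebesgue. e') = (b - a) * e'"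
          by (rule set_integral_const_Ico(2)[OF ab'])
        then show ?thesis
          by (simp only: set_integral_add(2)[OF set_integral_add(1)[OF i3 i4] iGg] set_integral_add(2)[OF i3 i4])
      qed
      also have "\<dots> < 4 * e' + (b - a) * e'" using p2 g(2) e' by linarith
      also have "\<dots> = (4 + (b - a)) * e'" by (rule distrib_right[symmetric])
      also have "\<dots> = e" using ab by (simp add: e'_def)
      finally have "(LINT t:{a..<b}|lebesgue. \<bar>A ?m t - G t\<bar>) < e" .
      moreover have "0 \<le> (LINT t:{a..<b}|lebesgue. \<bar>A ?m t - G t\<bar>)"
        unfolding set_lebesgue_integral_def by (intro integral_nonneg_AE AE_I2) simp
      ultimately show ?thesis by simp
    qed
    then show "\<exists>no. \<forall>n\<ge>no. norm ((LINT t:{a..<b}|lebesgue. \<bar>A (Suc n) t - G t\<bar>) - 0) < e" by blast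
  qed
qed

section \<open>Measurability of almost everywhere limits and Fatou's lemma\<close>

text \<open>Completeness of Lebesgue measure: preimages that differ by a null set are measurable
  together. This is used wherever a function is known only as an almost everywhere limit.\<close>

lemma borel_measurable_lebesgue_AE:
  fixes f g :: "real \<Rightarrow> real"
  assumes f: "f \<in> borel_measurable lebesgue" and eq: "AE t in lebesgue. f t = g t"
  shows "g \<in> borel_measurable lebesgue"
proof (rule measurableI)
  fix A :: "real set" assume "A \<in> sets borel"
  then have m: "f -` A \<inter> space lebesgue \<in> sets lebesgue" using f by (rule measurable_sets[rotated])
  have ae: "AE t in lebesgue. t \<in> f -` A \<inter> space lebesgue \<longleftrightarrow> t \<in> g -` A \<inter> space lebesgue"
    using eq by eventually_elim simp
  show "g -` A \<inter> space lebesgue \<in> sets lebesgue"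
    by (rule completion.in_sets_AE[OF ae m]) simp
qed simp

lemma borel_measurable_lebesgue_AE_limit:
  fixes F :: "nat \<Rightarrow> real \<Rightarrow> real"
  assumes F: "\<And>n. F n \<in> borel_measurable lebesgue" and lim: "AE t in lebesgue. (\<lambda>n. F n t) \<longlonglongrightarrow> g t"
  shows "g \<in> borel_measurable lebesgue"
proof (rule borel_measurable_lebesgue_AE)
  show "(\<lambda>t. lim (\<lambda>n. F n t)) \<in> borel_measurable lebesgue"
    by (rule borel_measurable_lim_metric[OF F])
  show "AE t in lebesgue. lim (\<lambda>n. F n t) = g t"
    using lim by eventually_elim (rule limI)
qed

text \<open>Besides the bound, integrability and measurability of the limit are conclusions:
  measurability by completeness of the measure, integrability because the nonnegative integral of g
  is at most M.\<close>

lemma lebesgue_integral_fatou: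
  fixes F :: "nat \<Rightarrow> real \<Rightarrow> real"
  assumes F: "\<And>n. integrable lebesgue (F n)" "\<And>n t. 0 \<le> F n t" "\<And>n. (LINT t|lebesgue. F n t) \<le> M"
    and lim: "AE t in lebesgue. (\<lambda>n. F n t) \<longlonglongrightarrow> g t"
  shows "integrable lebesgue g" "(LINT t|lebesgue. g t) \<le> M"
proof -
  have "0 \<le> (LINT t|lebesgue. F 0 t)" using F(2) by (intro integral_nonneg_AE AE_I2)
  then have M: "0 \<le> M" using F(3)[of 0] by linarith
  have mF: "F n \<in> borel_measurable lebesgue" for n using F(1) by (rule borel_measurable_integrable)
  have mg: "g \<in> borel_measurable lebesgue" by (rule borel_measurable_lebesgue_AE_limit[OF mF lim])
  have g0: "AE t in lebesgue. 0 \<le> g t"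
    using lim by eventually_elim (use F(2) in \<open>auto intro: LIMSEQ_le_const\<close>)
  have "(\<integral>\<^sup>+ t. ennreal (g t) \<partial>lebesgue) = (\<integral>\<^sup>+ t. liminf (\<lambda>n. ennreal (F n t)) \<partial>lebesgue)"
  proof (rule nn_integral_cong_AE)
    show "AE t in lebesgue. ennreal (g t) = liminf (\<lambda>n. ennreal (F n t))"
      using lim
    proof eventually_elim
      case (elim t)
      then have "(\<lambda>n. ennreal (F n t)) \<longlonglongrightarrow> ennreal (g t)" by (rule tendsto_ennrealI)
      from lim_imp_Liminf[OF _ this] show ?case by simp
    qed
  qed
  also have "\<dots> \<le> liminf (\<lambda>n. \<integral>\<^sup>+ t. ennreal (F n t) \<partial>lebesgue)"
    using mF by (intro nn_integral_liminf) auto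
  also have "\<dots> \<le> liminf (\<lambda>n::nat. ennreal M)"
  proof (rule Liminf_mono, rule always_eventually, rule allI)
    fix n
    have "(\<integral>\<^sup>+ t. ennreal (F n t) \<partial>lebesgue) = ennreal (LINT t|lebesgue. F n t)"
      using F by (intro nn_integral_eq_integral) auto
    then show "(\<integral>\<^sup>+ t. ennreal (F n t) \<partial>lebesgue) \<le> ennreal M" using F(3) by (simp add: ennreal_leI)
  qed
  also have "\<dots> = ennreal M" by (rule Liminf_const) simp
  finally have le: "(\<integral>\<^sup>+ t. ennreal (g t) \<partial>lebesgue) \<le> ennreal M" .
  show ig: "integrable lebesgue g"
    by (rule integrableI_nonneg[OF mg g0]) (use le in \<open>simp add: order.strict_trans1\<close>)
  have "ennreal (LINT t|lebesgue. g t) \<le> ennreal M"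
    using nn_integral_eq_integral[OF ig g0] le by simp
  then show "(LINT t|lebesgue. g t) \<le> M" using M by (simp add: ennreal_le_iff)
qed

section \<open>Discrete L^p norms of increments\<close>

text \<open>The maximum over the indices 0 to k inclusive. As a recursion it inherits limits and
  continuity from \<open>max\<close> and the absolute value by induction.\<close>

primrec max_abs :: "(nat \<Rightarrow> real) \<Rightarrow> nat \<Rightarrow> real" where
  "max_abs x 0 = \<bar>x 0\<bar>"
| "max_abs x (Suc k) = max (max_abs x k) \<bar>x (Suc k)\<bar>"

lemma max_abs_nonneg: "0 \<le> max_abs x k"
  by (induction k) auto

lemma max_abs_ge: "j \<le> k \<Longrightarrow> \<bar>x j\<bar> \<le> max_abs x k"
  by (induction k) (auto simp: le_Suc_eq)

lemma max_abs_le: "(\<And>j. j \<le> k \<Longrightarrow> \<bar>x j\<bar> \<le> c) \<Longrightarrow> max_abs x k \<le> c"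
  by (induction k) auto

lemma max_abs_tendsto:
  "(\<And>j. j \<le> k \<Longrightarrow> (\<lambda>n. X n j) \<longlonglongrightarrow> x j) \<Longrightarrow> (\<lambda>n. max_abs (X n) k) \<longlonglongrightarrow> max_abs x k"
  by (induction k) (auto intro!: tendsto_max tendsto_rabs)

lemma max_abs_divide: "0 < h \<Longrightarrow> max_abs (\<lambda>j. x j / h) k = max_abs x k / h"
  by (induction k) (auto simp: max_def divide_le_cancel abs_divide)

text \<open>With X i the size of an increment over the i-th cell, this is the integral of the p-th
  power of the step function of difference quotients, mesh width times quotient to the power
  p.\<close>

definition grid_power_sum :: "real \<Rightarrow> real \<Rightarrow> real \<Rightarrow> nat \<Rightarrow> (nat \<Rightarrow> real) \<Rightarrow> real" where
  "grid_power_sum p a b n X = (\<Sum>i<n. ((b - a) / real n) * (X i / ((b - a) / real n)) powr p)"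

text \<open>On a bounded interval x \<le> 1 + x^p gives the majorant; measurability of \<Gamma> is
  recovered from that of its p-th power by taking the power 1/p.\<close>

lemma set_integrable_of_powr:
  fixes \<Gamma> :: "real \<Rightarrow> real" and a b p :: real
  assumes "\<And>t. 0 \<le> \<Gamma> t" "1 < p" "set_integrable lebesgue {a..<b} (\<lambda>t. \<Gamma> t powr p)"
  shows "set_integrable lebesgue {a..<b} \<Gamma>"
  unfolding set_integrable_def
proof (rule Bochner_Integration.integrable_bound)
  show "integrable lebesgue (\<lambda>t. indicator {a..<b} t *\<^sub>R (1 + \<Gamma> t powr p))"
    using set_integral_add(1)[OF set_integral_const_Ico(1)[of a b 1] assms(3)] by (simp add: set_integrable_def)
  have m: "(\<lambda>t. indicator {a..<b} t *\<^sub>R (\<Gamma> t powr p)) \<in> borel_measurable lebesgue"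
    using assms(3) unfolding set_integrable_def by (rule borel_measurable_integrable)
  have "indicator {a..<b} t *\<^sub>R \<Gamma> t = (indicator {a..<b} t *\<^sub>R (\<Gamma> t powr p)) powr (1 / p)" for t
    using assms(1)[of t] assms(2) by (auto simp: indicator_def powr_powr)
  moreover have "(\<lambda>t. f t powr (1 / p)) \<in> borel_measurable lebesgue"
    if "f \<in> borel_measurable lebesgue" for f :: "real \<Rightarrow> real"
    using that by measurable
  ultimately show "(\<lambda>t. indicator {a..<b} t *\<^sub>R \<Gamma> t) \<in> borel_measurable lebesgue"
    using m by presburger
  show "AE t in lebesgue. norm (indicator {a..<b} t *\<^sub>R \<Gamma> t) \<le> norm (indicator {a..<b} t *\<^sub>R (1 + \<Gamma> t powr p))"
  proof (rule AE_I2)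
    fix t
    have "\<Gamma> t \<le> 1 + \<Gamma> t powr p"
    proof (cases "\<Gamma> t \<le> 1")
      case False
      then have "\<Gamma> t powr 1 \<le> \<Gamma> t powr p" using assms(2) by (intro powr_mono) auto
      then show ?thesis using False by simp
    qed (simp add: add_increasing2)
    then show "norm (indicator {a..<b} t *\<^sub>R \<Gamma> t) \<le> norm (indicator {a..<b} t *\<^sub>R (1 + \<Gamma> t powr p))"
      using assms(1)[of t] by (simp add: indicator_def)
  qed
qed

text \<open>Jensen's inequality on each cell, obtained from Young's inequality: with m the mean of
  \<Gamma> on the cell, \<Gamma> m^(p-1) is at most \<Gamma>^p / p + m^p / q. After integration the
  left side is h m^p, and the part h m^p / q of the right side is absorbed.\<close>

lemma grid_power_sum_le_integral:
  fixes \<Gamma> :: "real \<Rightarrow> real"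
  assumes ab: "a < b" and n: "0 < n" and p: "1 < p" and \<Gamma>: "\<And>t. 0 \<le> \<Gamma> t"
    and int: "set_integrable lebesgue {a..<b} (\<lambda>t. \<Gamma> t powr p)"
    and X: "\<And>i. i < n \<Longrightarrow> 0 \<le> X i" "\<And>i. i < n \<Longrightarrow> X i \<le> (LINT t:cell a b n i|lebesgue. \<Gamma> t)"
  shows "grid_power_sum p a b n X \<le> (LINT t:{a..<b}|lebesgue. \<Gamma> t powr p)"
proof -
  have ab': "a \<le> b" using ab by simp
  define h where "h = (b - a) / real n"
  have h: "0 < h" using ab n by (simp add: h_def)
  note i\<Gamma> = set_integrable_of_powr[OF \<Gamma> p int]
  \<comment> \<open>The conjugate exponent, for which (p - 1) q = p.\<close>
  define q where "q = p / (p - 1)"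
  have q: "1 < q" "1 / p + 1 / q = 1" using p by (auto simp: q_def field_simps)
  have "h * (X i / h) powr p \<le> (LINT t:cell a b n i|lebesgue. \<Gamma> t powr p)" if i: "i < n" for i
  proof -
    have sub: "set_integrable lebesgue (cell a b n i) f" if "set_integrable lebesgue {a..<b} f" for f :: "real \<Rightarrow> real"
      by (rule set_integrable_subset[OF that]) (use cell_sub[OF ab' i] in \<open>auto simp: cell_def\<close>)
    define m where "m = (LINT t:cell a b n i|lebesgue. \<Gamma> t) / h"
    have m0: "0 \<le> m"
      unfolding m_def set_lebesgue_integral_def using h \<Gamma> by (intro divide_nonneg_pos integral_nonneg_AE AE_I2) auto
    have "(LINT t:cell a b n i|lebesgue. \<Gamma> t * m powr (p - 1)) \<le>
        (LINT t:cell a b n i|lebesgue. (1 / p) * \<Gamma> t powr p + m powr p / q)"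
    proof (rule set_integral_mono)
      show "set_integrable lebesgue (cell a b n i) (\<lambda>t. \<Gamma> t * m powr (p - 1))"
        by (rule set_integrable_mult_left[OF sub[OF i\<Gamma>]])
      show "set_integrable lebesgue (cell a b n i) (\<lambda>t. (1 / p) * \<Gamma> t powr p + m powr p / q)"
        by (intro set_integral_add set_integrable_mult_right sub[OF int] integral_cell_const(2)[OF ab'])
      fix t
      have "\<Gamma> t * m powr (p - 1) \<le> \<Gamma> t powr p / p + (m powr (p - 1)) powr q / q"
        by (rule Youngs_inequality[OF p q \<Gamma>]) simp
      moreover have "(m powr (p - 1)) powr q = m powr p" using p by (simp add: powr_powr q_def)
      ultimately show "\<Gamma> t * m powr (p - 1) \<le> (1 / p) * \<Gamma> t powr p + m powr p / q" by simp
    qed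
    also have "\<dots> = (1 / p) * (LINT t:cell a b n i|lebesgue. \<Gamma> t powr p) + h * (m powr p / q)"
      by (simp only: set_integral_add(2)[OF set_integrable_mult_right[OF sub[OF int]] integral_cell_const(2)[OF ab']]
        integral_cell_const(1)[OF ab'] set_integral_mult_right h_def)
    finally have "(h * m) * m powr (p - 1) \<le> (1 / p) * (LINT t:cell a b n i|lebesgue. \<Gamma> t powr p) + h * (m powr p / q)"
      using h by (simp add: m_def)
    moreover have "(h * m) * m powr (p - 1) = h * m powr p"
      using powr_mult_base[OF m0, of "p - 1"] by simp
    moreover have "h * m powr p = h * (m powr p) * (1 / p) + h * (m powr p / q)"
    proof -
      have "h * m powr p = h * m powr p * (1 / p + 1 / q)" using q by simp
      then show ?thesis by (simp add: distrib_left)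
    qed
    ultimately have "h * (m powr p) * (1 / p) \<le> (1 / p) * (LINT t:cell a b n i|lebesgue. \<Gamma> t powr p)" by linarith
    then have "h * m powr p \<le> (LINT t:cell a b n i|lebesgue. \<Gamma> t powr p)"
      using p by (simp add: field_simps)
    moreover have "h * (X i / h) powr p \<le> h * m powr p"
      using h X[OF i] p unfolding m_def
      by (intro mult_left_mono powr_mono2 divide_right_mono) auto
    ultimately show ?thesis by linarith
  qed
  then have "grid_power_sum p a b n X \<le> (\<Sum>i<n. (LINT t:cell a b n i|lebesgue. \<Gamma> t powr p))"
    unfolding grid_power_sum_def h_def[symmetric] by (intro sum_mono) auto
  then show ?thesis using sum_cell_integral[OF ab' n int] by simp
qed

text \<open>Two applications of Fatou's lemma. For fixed k the grid is refined, and the cell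
  averages of finitely many functions G j converge almost everywhere along a subsequence; only then
  k grows and the finite maxima tend to \<Gamma>.\<close>

lemma integral_powr_le_of_grid_power_sums:
  fixes G :: "nat \<Rightarrow> real \<Rightarrow> real"
  assumes ab: "a < b" and p: "0 < p" and G: "\<And>j. set_integrable lebesgue {a..<b} (G j)"
    and M: "\<And>n k. grid_power_sum p a b (Suc n) (\<lambda>i. max_abs (\<lambda>j. LINT t:cell a b (Suc n) i|lebesgue. G j t) k) \<le> M"
    and lim: "AE t in lebesgue. t \<in> {a..<b} \<longrightarrow> (\<lambda>k. max_abs (\<lambda>j. G j t) k) \<longlonglongrightarrow> \<Gamma> t"
  shows "set_integrable lebesgue {a..<b} (\<lambda>t. \<Gamma> t powr p)" "(LINT t:{a..<b}|lebesgue. \<Gamma> t powr p) \<le> M"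
proof -
  have ab': "a \<le> b" using ab by simp
  define A where "A j n t = (\<Sum>i<n. indicator (cell a b n i) t * cell_avg a b n (G j) i)" for j n t
  have iA: "set_integrable lebesgue {a..<b} (A j n)" for j n
    unfolding A_def by (rule L1_cell_avg(1)[OF ab G])
  have LA: "(\<lambda>n. LINT t:{a..<b}|lebesgue. \<bar>A j (Suc n) t - G j t\<bar>) \<longlonglongrightarrow> 0" for j
    unfolding A_def by (rule L1_cell_avg(2)[OF ab G])
  \<comment> \<open>A step function, constant on each cell, whose integral is exactly the grid power
    sum in the hypothesis.\<close>
  define F where "F k n t = indicator {a..<b} t * (max_abs (\<lambda>j. A j (Suc n) t) k) powr p" for k n t
  have F: "integrable lebesgue (F k n)" "(LINT t|lebesgue. F k n t) \<le> M" for k n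
  proof -
    let ?m = "Suc n"
    define y where "y i = (max_abs (\<lambda>j. cell_avg a b ?m (G j) i) k) powr p" for i
    have Feq: "F k n t = (\<Sum>i<?m. indicator (cell a b ?m i) t * y i)" for t
    proof (cases "t \<in> {a..<b}")
      case True
      have "\<exists>i<?m. t \<in> cell a b ?m i" by (rule ex_cell[OF ab' _ True]) simp
      then obtain i where i: "i < ?m" "t \<in> cell a b ?m i" by blast
      have pick: "(\<Sum>j<?m. indicator (cell a b ?m j) t * x j) = x i" for x :: "nat \<Rightarrow> real"
        by (rule sum_cell_pick[OF ab' _ i]) simp
      show ?thesis using True unfolding F_def A_def pick y_def by simp
    next
      case False
      then have "t \<notin> cell a b ?m i" if "i < ?m" for i using cell_sub[OF ab' that] by blast
      then have "(\<Sum>i<?m. indicator (cell a b ?m i) t * y i) = 0" by (intro sum.neutral) auto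
      then show ?thesis using False unfolding F_def by simp
    qed
    have ic: "integrable lebesgue (\<lambda>t. indicator (cell a b ?m i) t * y i)" for i
      using integral_cell_const(2)[OF ab', of ?m i "y i"] by (simp add: set_integrable_def)
    show "integrable lebesgue (F k n)"
      unfolding Feq by (intro Bochner_Integration.integrable_sum ic)
    have "(LINT t|lebesgue. F k n t) = (\<Sum>i<?m. (LINT t|lebesgue. indicator (cell a b ?m i) t * y i))"
      unfolding Feq by (intro Bochner_Integration.integral_sum ic)
    also have "\<dots> = (\<Sum>i<?m. ((b - a) / real ?m) * y i)"
      using integral_cell_const(1)[OF ab', of ?m] by (intro sum.cong) (simp_all only: set_lebesgue_integral_def real_scaleR_def)
    also have "\<dots> = grid_power_sum p a b ?m (\<lambda>i. max_abs (\<lambda>j. LINT t:cell a b ?m i|lebesgue. G j t) k)"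
    proof -
      have "0 < (b - a) / real ?m" using ab by simp
      then show ?thesis unfolding grid_power_sum_def y_def cell_avg_def by (simp only: max_abs_divide)
    qed
    also have "\<dots> \<le> M" by (rule M)
    finally show "(LINT t|lebesgue. F k n t) \<le> M" .
  qed
  define H where "H k t = indicator {a..<b} t * (max_abs (\<lambda>j. G j t) k) powr p" for k t
  have H: "integrable lebesgue (H k)" "(LINT t|lebesgue. H k t) \<le> M" for k
  proof -
    \<comment> \<open>Adding up the errors for all j \<le> k yields one subsequence along which all
      these averages converge simultaneously.\<close>
    define E where "E n t = (\<Sum>j\<le>k. indicator {a..<b} t * \<bar>A j (Suc n) t - G j t\<bar>)" for n t
    have iE1: "integrable lebesgue (\<lambda>t. indicator {a..<b} t * \<bar>A j (Suc n) t - G j t\<bar>)" for j n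
      using set_integrable_abs[OF set_integral_diff(1)[OF iA G]] unfolding set_integrable_def by simp
    have iE: "integrable lebesgue (E n)" for n
      unfolding E_def by (intro Bochner_Integration.integrable_sum iE1)
    have "(LINT t|lebesgue. norm (E n t)) = (\<Sum>j\<le>k. (LINT t:{a..<b}|lebesgue. \<bar>A j (Suc n) t - G j t\<bar>))" for n
    proof -
      have "norm (E n t) = E n t" for t by (simp add: E_def sum_nonneg)
      then have "(LINT t|lebesgue. norm (E n t)) = (LINT t|lebesgue. E n t)" by simp
      also have "\<dots> = (\<Sum>j\<le>k. (LINT t|lebesgue. indicator {a..<b} t * \<bar>A j (Suc n) t - G j t\<bar>))"
        unfolding E_def by (intro Bochner_Integration.integral_sum iE1)
      finally show ?thesis by (simp add: set_lebesgue_integral_def)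
    qed
    moreover have "(\<lambda>n. \<Sum>j\<le>k. (LINT t:{a..<b}|lebesgue. \<bar>A j (Suc n) t - G j t\<bar>)) \<longlonglongrightarrow> (\<Sum>j\<le>k. 0)"
      by (intro tendsto_sum LA)
    ultimately have "(\<lambda>n. LINT t|lebesgue. norm (E n t)) \<longlonglongrightarrow> 0" by simp
    from tendsto_L1_AE_subseq[OF iE this]
    obtain r where r: "strict_mono r" "AE t in lebesgue. (\<lambda>n. E (r n) t) \<longlonglongrightarrow> 0" by blast
    have "AE t in lebesgue. (\<lambda>n. F k (r n) t) \<longlonglongrightarrow> H k t"
      using r(2)
    proof eventually_elim
      case (elim t)
      show ?case
      proof (cases "t \<in> {a..<b}")
        case True
        have "(\<lambda>n. A j (Suc (r n)) t) \<longlonglongrightarrow> G j t" if "j \<le> k" for j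
        proof (rule LIM_zero_cancel, rule Lim_null_comparison[OF always_eventually elim], rule allI)
          fix n
          have "\<bar>A j (Suc (r n)) t - G j t\<bar> \<le> (\<Sum>j\<le>k. \<bar>A j (Suc (r n)) t - G j t\<bar>)"
            by (rule member_le_sum) (use that in auto)
          then show "norm (A j (Suc (r n)) t - G j t) \<le> E (r n) t" using True by (simp add: E_def)
        qed
        then have "(\<lambda>n. max_abs (\<lambda>j. A j (Suc (r n)) t) k) \<longlonglongrightarrow> max_abs (\<lambda>j. G j t) k"
          by (rule max_abs_tendsto)
        then have "(\<lambda>n. (max_abs (\<lambda>j. A j (Suc (r n)) t) k) powr p) \<longlonglongrightarrow> (max_abs (\<lambda>j. G j t) k) powr p"
          by (rule tendsto_powr') (use p in \<open>auto simp: max_abs_nonneg\<close>)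
        then show ?thesis using True by (simp add: F_def H_def)
      qed (simp add: F_def H_def)
    qed
    from lebesgue_integral_fatou[OF F(1) _ F(2) this]
    show "integrable lebesgue (H k)" "(LINT t|lebesgue. H k t) \<le> M" by (auto simp: F_def)
  qed
  have "AE t in lebesgue. (\<lambda>k. H k t) \<longlonglongrightarrow> indicator {a..<b} t *\<^sub>R (\<Gamma> t powr p)"
    using lim
  proof eventually_elim
    case (elim t)
    show ?case
    proof (cases "t \<in> {a..<b}")
      case True
      then have "(\<lambda>k. max_abs (\<lambda>j. G j t) k) \<longlonglongrightarrow> \<Gamma> t" using elim by blast
      then have "(\<lambda>k. (max_abs (\<lambda>j. G j t) k) powr p) \<longlonglongrightarrow> \<Gamma> t powr p"
        by (rule tendsto_powr') (use p in \<open>auto simp: max_abs_nonneg\<close>)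
      then show ?thesis using True by (simp add: H_def)
    qed (simp add: H_def)
  qed
  from lebesgue_integral_fatou[OF H(1) _ H(2) this]
  show "set_integrable lebesgue {a..<b} (\<lambda>t. \<Gamma> t powr p)" "(LINT t:{a..<b}|lebesgue. \<Gamma> t powr p) \<le> M"
    by (auto simp: H_def set_integrable_def set_lebesgue_integral_def)
qed

section \<open>Exhaustion of an interval from inside\<close>

text \<open>Strong measurability provides simple functions on a restricted space. A default value
  off \<open>J\<close> turns them into simple functions on the whole line, where they can be glued
  or combined with others.\<close>

lemma simple_function_extend:
  assumes f: "simple_function (restrict_space M J) f" and J: "J \<in> sets M"
  shows "simple_function M (\<lambda>t. if t \<in> J then f t else x)"
  unfolding simple_function_def
proof (intro conjI ballI)
  have sp: "space (restrict_space M J) = J" using sets.sets_into_space[OF J] by (simp add: space_restrict_space Int_absorb2)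
  have "(\<lambda>t. if t \<in> J then f t else x) ` space M \<subseteq> insert x (f ` J)" by auto
  moreover have fin: "finite (f ` J)" using f sp by (simp add: simple_function_def)
  ultimately show "finite ((\<lambda>t. if t \<in> J then f t else x) ` space M)" by (meson finite_insert finite_subset)
  fix y
  have "f -` {y} \<inter> J \<in> sets M"
  proof (cases "y \<in> f ` J")
    case True
    then have "f -` {y} \<inter> J \<in> sets (restrict_space M J)" using f sp by (auto simp: simple_function_def)
    then show ?thesis using sets_restrict_space_iff[of J M] J sets.Int_space_eq2[OF J] by auto
  next
    case False
    then have "f -` {y} \<inter> J = {}" by auto
    then show ?thesis by simp
  qed
  moreover have "(\<lambda>t. if t \<in> J then f t else x) -` {y} \<inter> space M =
      (f -` {y} \<inter> J) \<union> (if x = y then space M - J else {})"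
    using sets.sets_into_space[OF J] by (auto split: if_splits)
  ultimately show "(\<lambda>t. if t \<in> J then f t else x) -` {y} \<inter> space M \<in> sets M" using J by auto
qed

lemma simple_function_restrict_lebesgue:
  assumes f: "simple_function lebesgue f" and J: "J \<in> sets lebesgue"
  shows "simple_function (restrict_space lebesgue J) f"
  unfolding simple_function_def
proof (intro conjI ballI)
  have "finite (range f)" using f by (simp add: simple_function_def)
  then show "finite (f ` space (restrict_space lebesgue J))" by (rule finite_subset[rotated]) auto
  fix y assume "y \<in> f ` space (restrict_space lebesgue J)"
  then have "f -` {y} \<in> sets lebesgue" using f by (auto simp: simple_function_def space_restrict_space)
  then show "f -` {y} \<inter> space (restrict_space lebesgue J) \<in> sets (restrict_space lebesgue J)"
    using J by (auto simp: sets_restrict_space_iff space_restrict_space)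
qed

text \<open>Increasing compact intervals whose union is the open interval from a to b; they may be
  empty for small n.\<close>

definition inner_interval :: "real \<Rightarrow> real \<Rightarrow> nat \<Rightarrow> real set" where
  "inner_interval a b n = {a + 1 / real (Suc n)..b - 1 / real (Suc n)}"

lemma inner_interval_mono: "m \<le> n \<Longrightarrow> inner_interval a b m \<subseteq> inner_interval a b n"
  unfolding inner_interval_def by (auto intro: order_trans[OF _ diff_left_mono] order_trans[OF add_left_mono] simp: frac_le)

lemma inner_interval_eventually:
  assumes "a < t" "t < b"
  shows "\<exists>n. t \<in> inner_interval a b n"
proof -
  have "0 < min (t - a) (b - t)" using assms by simp
  then obtain n where "1 / real (Suc n) < min (t - a) (b - t)" using nat_approx_posE by blast
  then show ?thesis by (intro exI[of _ n]) (auto simp: inner_interval_def)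
qed

lemma AE_not_endpoints: "AE t in lebesgue. t \<noteq> (a::real) \<and> t \<noteq> b"
  by (intro AE_conjI AE_completion) (auto intro: AE_lborel_singleton)

text \<open>The approximants on the exhausting intervals are glued on the disjoint differences, so no
  diagonal argument is needed.\<close>

lemma strongly_measurable_exhaust:
  assumes x0: "x0 \<in> X"
    and sm: "\<And>c d. a < c \<Longrightarrow> d < b \<Longrightarrow> strongly_measurable {c..d} X nrm u"
  shows "strongly_measurable {a..b} X nrm u"
proof -
  let ?J = "inner_interval a b"
  have "\<forall>n. \<exists>s. (\<forall>k. simple_function (restrict_space lebesgue (?J n)) (s k) \<and> s k ` ?J n \<subseteq> X) \<and>
     (AE t in lebesgue. t \<in> ?J n \<longrightarrow> (\<lambda>k. nrm (s k t - u t)) \<longlonglongrightarrow> 0)"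
    using sm unfolding strongly_measurable_def inner_interval_def by simp
  from choice[OF this] obtain S where
    "\<forall>n. (\<forall>k. simple_function (restrict_space lebesgue (?J n)) (S n k) \<and> S n k ` ?J n \<subseteq> X) \<and>
     (AE t in lebesgue. t \<in> ?J n \<longrightarrow> (\<lambda>k. nrm (S n k t - u t)) \<longlonglongrightarrow> 0)" ..
  then have S: "\<And>n k. simple_function (restrict_space lebesgue (?J n)) (S n k)"
    "\<And>n k. S n k ` ?J n \<subseteq> X"
    "\<And>n. AE t in lebesgue. t \<in> ?J n \<longrightarrow> (\<lambda>k. nrm (S n k t - u t)) \<longlonglongrightarrow> 0"
    by blast+
  define R where "R = rec_nat (\<lambda>k t. if t \<in> ?J 0 then S 0 k t else x0)
    (\<lambda>m r k t. if t \<in> ?J m then r k t else if t \<in> ?J (Suc m) then S (Suc m) k t else x0)"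
  have R0: "R 0 = (\<lambda>k t. if t \<in> ?J 0 then S 0 k t else x0)" by (simp add: R_def)
  have RS: "R (Suc m) = (\<lambda>k t. if t \<in> ?J m then R m k t else if t \<in> ?J (Suc m) then S (Suc m) k t else x0)" for m
    unfolding R_def by simp
  have Jm: "?J n \<in> sets lebesgue" for n by (simp add: inner_interval_def)
  have simpR: "simple_function lebesgue (R m k)" for m k
  proof (induction m)
    case 0
    show ?case unfolding R0 by (rule simple_function_extend[OF S(1) Jm])
  next
    case (Suc m)
    show ?case unfolding RS
      by (rule simple_function_If[OF Suc simple_function_extend[OF S(1) Jm]]) (use Jm in simp)
  qed
  have rangeR: "R m k t \<in> X" for m k t
    by (induction m) (use S(2) x0 in \<open>auto simp: R0 RS\<close>)
  \<comment> \<open>At a point first covered at stage n, all later layers keep the approximants of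
    stage n. Hence \<open>R k k\<close> coincides there with \<open>S n k\<close> from k = n
    on.\<close>
  have pick: "R m k t = S n k t" if "t \<in> ?J n" "\<And>i. i < n \<Longrightarrow> t \<notin> ?J i" "n \<le> m" for n m k t
    using that(3)
  proof (induction m)
    case 0
    then show ?case using that(1) by (simp add: R0)
  next
    case (Suc m)
    show ?case
    proof (cases "n \<le> m")
      case True
      then have "t \<in> ?J m" using inner_interval_mono that(1) by blast
      then show ?thesis using Suc.IH[OF True] by (simp add: RS)
    next
      case False
      then have "n = Suc m" using Suc.prems by simp
      then show ?thesis using that(1,2) by (simp add: RS)
    qed
  qed
  have "AE t in lebesgue. t \<in> {a..b} \<longrightarrow> (\<lambda>k. nrm (R k k t - u t)) \<longlonglongrightarrow> 0"
  proof -
    have "AE t in lebesgue. \<forall>n. t \<in> ?J n \<longrightarrow> (\<lambda>k. nrm (S n k t - u t)) \<longlonglongrightarrow> 0"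
      using S(3) by (simp add: AE_all_countable)
    then show ?thesis using AE_not_endpoints[of a b]
    proof eventually_elim
      case (elim t)
      show ?case
      proof
        assume "t \<in> {a..b}"
        then have "a < t" "t < b" using elim(2) by auto
        then have ex: "\<exists>n. t \<in> ?J n" by (rule inner_interval_eventually)
        define n where "n = (LEAST n. t \<in> ?J n)"
        have n: "t \<in> ?J n" "\<And>i. i < n \<Longrightarrow> t \<notin> ?J i"
          using LeastI_ex[OF ex] not_less_Least by (auto simp: n_def)
        have "eventually (\<lambda>k. nrm (S n k t - u t) = nrm (R k k t - u t)) sequentially"
          using eventually_ge_at_top[of n] by eventually_elim (simp add: pick[OF n])
        then show "(\<lambda>k. nrm (R k k t - u t)) \<longlonglongrightarrow> 0"
          using elim(1) n(1) by (blast intro: Lim_transform_eventually)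
      qed
    qed
  qed
  then show ?thesis
    unfolding strongly_measurable_def using simpR rangeR
    by (intro exI[of _ "\<lambda>k. R k k"]) (auto intro: simple_function_restrict_lebesgue)
qed

text \<open>The truncations to the inner intervals converge to \<phi> on \<open>{a..b}\<close>
  except possibly at the two ends, and their integrals are bounded by M; Fatou's lemma gives
  integrability up to the ends.\<close>

lemma set_integrable_exhaust:
  fixes \<phi> :: "real \<Rightarrow> real"
  assumes nn: "\<And>t. 0 \<le> \<phi> t"
    and int: "\<And>c d. a < c \<Longrightarrow> d < b \<Longrightarrow> set_integrable lebesgue {c..d} \<phi>"
    and bd: "\<And>n. (LINT t:inner_interval a b n|lebesgue. \<phi> t) \<le> M"
  shows "set_integrable lebesgue {a..b} \<phi>"
proof -
  have lim: "AE t in lebesgue. (\<lambda>n. indicator (inner_interval a b n) t *\<^sub>R \<phi> t) \<longlonglongrightarrow> indicator {a..b} t *\<^sub>R \<phi> t"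
    using AE_not_endpoints[of a b]
  proof eventually_elim
    case (elim t)
    show ?case
    proof (cases "t \<in> {a..b}")
      case True
      then have "a < t" "t < b" using elim by auto
      then obtain m where m: "t \<in> inner_interval a b m" using inner_interval_eventually by blast
      show ?thesis
        by (rule tendsto_eventually, rule eventually_sequentiallyI[of m])
          (use m inner_interval_mono[of m _ a b] True in \<open>auto simp: indicator_def\<close>)
    next
      case False
      have "t \<notin> inner_interval a b n" for n
      proof
        assume "t \<in> inner_interval a b n"
        moreover have "0 < 1 / real (Suc n)" by simp
        ultimately have "a \<le> t" "t \<le> b"
          unfolding inner_interval_def atLeastAtMost_iff by linarith+
        then show False using False by simp
      qed
      then show ?thesis using False by simp
    qed
  qed

  have "integrable lebesgue (\<lambda>t. indicator (inner_interval a b n) t *\<^sub>R \<phi> t)" for n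
    using int[of "a + 1 / real (Suc n)" "b - 1 / real (Suc n)"] by (simp add: set_integrable_def inner_interval_def)
  from lebesgue_integral_fatou(1)[OF this _ bd[unfolded set_lebesgue_integral_def] lim] show ?thesis
    unfolding set_integrable_def using nn by simp
qed

section \<open>The topology of weakly continuous functions\<close>

lemma gdelta_in_countable_ball:
  assumes "countable A" "\<And>i. i \<in> A \<Longrightarrow> gdelta_in X {u \<in> topspace X. P i u}"
  shows "gdelta_in X {u \<in> topspace X. \<forall>i\<in>A. P i u}"
proof (cases "A = {}")
  case False
  have "{u \<in> topspace X. \<forall>i\<in>A. P i u} = \<Inter> ((\<lambda>i. {u \<in> topspace X. P i u}) ` A)"
    using False by auto
  then show ?thesis
    using assms False by (simp only:) (rule gdelta_in_Inter, auto)
qed simp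

lemma openin_less_continuous_map:
  "continuous_map X euclideanreal F \<Longrightarrow> openin X {u \<in> topspace X. F u < c}"
  using openin_continuous_map_preimage[of X euclideanreal F "{..<c}"] by simp

lemma openin_greater_continuous_map:
  "continuous_map X euclideanreal F \<Longrightarrow> openin X {u \<in> topspace X. c < F u}"
  using openin_continuous_map_preimage[of X euclideanreal F "{c<..}"] by simp

text \<open>The topology on weakly continuous functions is given by a subbase and not by a metric,
  so closedness alone would not yield a G_delta set. For a sublevel set of a continuous function the
  open sets F < c + 1/(n+1) do.\<close>

lemma gdelta_in_le_continuous_map:
  assumes "continuous_map X euclideanreal F"
  shows "gdelta_in X {u \<in> topspace X. F u \<le> c}"
proof -
  have "gdelta_in X {u \<in> topspace X. \<forall>n\<in>UNIV. F u < c + 1 / real (Suc n)}"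
    by (intro gdelta_in_countable_ball open_imp_gdelta_in openin_less_continuous_map assms) simp
  moreover have "F u \<le> c \<longleftrightarrow> (\<forall>n. F u < c + 1 / real (Suc n))" for u
  proof
    assume "F u \<le> c"
    moreover have "0 < 1 / real (Suc n)" for n by simp
    ultimately show "\<forall>n. F u < c + 1 / real (Suc n)" by (metis add_strict_increasing2 less_add_same_cancel1 order_le_less_trans)
  next
    assume *: "\<forall>n. F u < c + 1 / real (Suc n)"
    show "F u \<le> c"
    proof (rule ccontr)
      assume "\<not> F u \<le> c"
      then have "0 < F u - c" by simp
      then obtain n where "1 / real (Suc n) < F u - c" using nat_approx_posE by blast
      then show False using *[rule_format, of n] by linarith
    qed
  qed
  ultimately show ?thesis by simp
qed

lemma continuous_map_powr_nonneg:
  assumes "continuous_map X euclideanreal F" "\<And>u. 0 \<le> F u" "0 < p"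
  shows "continuous_map X euclideanreal (\<lambda>u. F u powr p)"
proof -
  \<comment> \<open>Composition with \<open>max 0\<close> makes the power continuous on the whole
    line and changes nothing for the nonnegative F.\<close>
  have "continuous_on UNIV (\<lambda>x::real. max 0 x powr p)"
    using assms(3) by (intro continuous_on_powr' continuous_intros) auto
  then have "continuous_map X euclideanreal ((\<lambda>x. max 0 x powr p) \<circ> F)"
    using assms(1)
    by (intro continuous_map_compose[OF _ iffD2[OF continuous_map_iff_continuous2]])
  then show ?thesis using assms(2) by (simp add: o_def max_absorb2)
qed

lemma continuous_map_max_abs:
  assumes "\<And>j. continuous_map X euclideanreal (\<lambda>u. F u j)"
  shows "continuous_map X euclideanreal (\<lambda>u. max_abs (F u) k)"
  by (induction k) (auto intro!: continuous_map_real_max continuous_map_real_abs assms)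

lemma continuous_map_grid_power_sum:
  assumes "\<And>i. i < n \<Longrightarrow> continuous_map X euclideanreal (\<lambda>u. F u i)" "\<And>u i. 0 \<le> F u i" "a \<le> b" "0 < p"
  shows "continuous_map X euclideanreal (\<lambda>u. grid_power_sum p a b n (F u))"
  unfolding grid_power_sum_def
proof (intro continuous_map_sum continuous_map_real_mult continuous_map_powr_nonneg)
  fix i assume "i \<in> {..<n}"
  then have "continuous_map X euclideanreal (\<lambda>u. F u i * (1 / ((b - a) / real n)))"
    by (intro continuous_map_real_mult assms(1)) auto
  then show "continuous_map X euclideanreal (\<lambda>u. F u i / ((b - a) / real n))" by simp
  show "0 \<le> F u i / ((b - a) / real n)" for u using assms(2,3) by simp
qed (use assms(4) in auto)

section \<open>Evaluations and norms on the space of weakly continuous functions\<close>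

context
  fixes K assumes K: "admissible K"
begin

lemma topspace_Cloc_Hw: "topspace (Cloc_Hw_top K I) = Cloc_Hw K I"
proof -
  have "u \<in> \<Union>{{u \<in> Cloc_Hw K I. \<forall>t\<in>{a..b}. \<bar>(u t - w t) \<bullet> v\<bar> < e} | w a b v e.
        w \<in> Cloc_Hw K I \<and> {a..b} \<subseteq> I \<and> v \<in> H_space K \<and> 0 < e}" if u: "u \<in> Cloc_Hw K I" for u
  proof (rule UnionI)
    \<comment> \<open>The time interval from 1 to 0 is empty, hence contained in any
      \<open>I\<close>, and the condition on it is vacuous; so this member of the subbase contains
      u.\<close>
    show "{w \<in> Cloc_Hw K I. \<forall>t\<in>{1..0::real}. \<bar>(w t - u t) \<bullet> 0\<bar> < 1} \<in>
      {{u \<in> Cloc_Hw K I. \<forall>t\<in>{a..b}. \<bar>(u t - w t) \<bullet> v\<bar> < e} | w a b v e.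
        w \<in> Cloc_Hw K I \<and> {a..b} \<subseteq> I \<and> v \<in> H_space K \<and> 0 < e}"
      unfolding mem_Collect_eq
      using zero_in_H_space[OF K] u
      by (intro exI[of _ u] exI[of _ "1::real"] exI[of _ "0::real"] exI[of _ 0]) auto
  qed (use u in auto)
  then show ?thesis
    unfolding Cloc_Hw_top_def topology_generated_by_topspace by blast
qed

text \<open>The degenerate time interval \<open>{t..t}\<close> in the subbase yields continuity of
  pointwise weak evaluation. Apart from its underlying set, the topology enters the argument only
  through these evaluations.\<close>

lemma continuous_map_eval:
  assumes t: "t \<in> I" and v: "v \<in> H_space K"
  shows "continuous_map (Cloc_Hw_top K I) euclideanreal (\<lambda>u. u t \<bullet> v)"
  unfolding continuous_map_def
proof (intro conjI allI impI)
  fix U :: "real set" assume "openin euclideanreal U"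
  then have U: "open U" by simp
  show "openin (Cloc_Hw_top K I) {u \<in> topspace (Cloc_Hw_top K I). u t \<bullet> v \<in> U}"
  proof (subst openin_subopen, rule ballI)
    fix w assume "w \<in> {u \<in> topspace (Cloc_Hw_top K I). u t \<bullet> v \<in> U}"
    then have w: "w \<in> Cloc_Hw K I" "w t \<bullet> v \<in> U" by (auto simp: topspace_Cloc_Hw)
    then obtain e where e: "0 < e" "\<And>y. dist y (w t \<bullet> v) < e \<Longrightarrow> y \<in> U" using U by (auto simp: open_dist)
    let ?N = "{u \<in> Cloc_Hw K I. \<forall>s\<in>{t..t}. \<bar>(u s - w s) \<bullet> v\<bar> < e}"
    have "openin (Cloc_Hw_top K I) ?N"
      unfolding Cloc_Hw_top_def
    proof (rule topology_generated_by_Basis, unfold mem_Collect_eq)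
      show "\<exists>w' a b v' e'. ?N = {u \<in> Cloc_Hw K I. \<forall>t\<in>{a..b}. \<bar>(u t - w' t) \<bullet> v'\<bar> < e'} \<and>
          w' \<in> Cloc_Hw K I \<and> {a..b} \<subseteq> I \<and> v' \<in> H_space K \<and> 0 < e'"
        using w t v e by (intro exI[of _ w] exI[of _ t] exI[of _ t] exI[of _ v] exI[of _ e] conjI refl) auto
    qed
    moreover have "w \<in> ?N" using w e by simp
    moreover have "?N \<subseteq> {u \<in> topspace (Cloc_Hw_top K I). u t \<bullet> v \<in> U}"
      using e(2) by (auto simp: topspace_Cloc_Hw dist_real_def inner_diff_left)
    ultimately show "\<exists>T. openin (Cloc_Hw_top K I) T \<and> w \<in> T \<and> T \<subseteq> {u \<in> topspace (Cloc_Hw_top K I). u t \<bullet> v \<in> U}"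
      by blast
  qed
qed simp

text \<open>Members of D approaching x itself turn the inequalities into |x|^2 \<le> c |x|. The
  factor \<open>norm d\<close> on the right makes the tests homogeneous, so that D may be any dense
  set and need not consist of unit vectors.\<close>

lemma norm_le_iff_dense:
  assumes D: "D \<subseteq> H_space K" "\<forall>u\<in>H_space K. \<forall>e>0. \<exists>d\<in>D. norm (u - d) < e"
    and x: "x \<in> H_space K" and c: "0 \<le> c"
  shows "norm x \<le> c \<longleftrightarrow> (\<forall>d\<in>D. x \<bullet> d \<le> c * norm d)"
proof
  assume "norm x \<le> c"
  then show "\<forall>d\<in>D. x \<bullet> d \<le> c * norm d"
    using Cauchy_Schwarz_ineq2[of x] by (meson abs_le_D1 mult_right_mono norm_ge_zero order_trans)
next
  assume *: "\<forall>d\<in>D. x \<bullet> d \<le> c * norm d"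
  have "\<exists>d\<in>D. norm (x - d) < 1 / real (Suc n)" for n using D(2) x by simp
  then obtain d where d: "\<And>n. d n \<in> D" "\<And>n. norm (x - d n) < 1 / real (Suc n)" by metis
  have "d \<longlonglongrightarrow> x"
  proof (rule LIM_zero_cancel, rule Lim_null_comparison)
    show "\<forall>\<^sub>F n in sequentially. norm (d n - x) \<le> 1 / real (Suc n)"
      using d(2) by (intro always_eventually allI) (simp add: norm_minus_commute less_imp_le)
    show "(\<lambda>n. 1 / real (Suc n)) \<longlonglongrightarrow> 0" by (rule LIMSEQ_Suc[OF lim_1_over_n])
  qed
  then have "x \<bullet> x \<le> c * norm x"
    using * d(1) by (intro LIMSEQ_le[of "\<lambda>n. x \<bullet> d n" _ "\<lambda>n. c * norm (d n)"] tendsto_intros) auto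
  then have "norm x * norm x \<le> c * norm x" by (simp add: power2_norm_eq_inner[symmetric] power2_eq_square)
  then show "norm x \<le> c" using c by (cases "norm x = 0") (auto simp: mult_le_cancel_right)
qed

lemma Cloc_Hw_in_H: "u \<in> Cloc_Hw K I \<Longrightarrow> t \<in> I \<Longrightarrow> u t \<in> H_space K"
  by (auto simp: Cloc_Hw_def)

text \<open>The norm is a supremum of countably many weak evaluations: its sublevel sets are
  countable intersections of G_delta half-space conditions, and the opposite strict inequality is a
  union of open ones.\<close>

lemma gdelta_in_norm_le:
  assumes t: "t \<in> I" and c: "0 \<le> c" and U: "U \<subseteq> Cloc_Hw K I"
  defines "X \<equiv> subtopology (Cloc_Hw_top K I) U"
  shows "gdelta_in X {u \<in> topspace X. norm (u t) \<le> c}" "openin X {u \<in> topspace X. c < norm (u t)}"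
proof -
  obtain D where D: "D \<subseteq> H_space K" "countable D" "\<forall>u\<in>H_space K. \<forall>e>0. \<exists>d\<in>D. norm (u - d) < e"
    using countable_dense_H_space[OF K] by blast
  have top: "topspace X \<subseteq> Cloc_Hw K I" using U by (auto simp: X_def topspace_Cloc_Hw)
  have cont: "continuous_map X euclideanreal (\<lambda>u. u t \<bullet> d)" if "d \<in> D" for d
    unfolding X_def using D(1) that by (intro continuous_map_from_subtopology continuous_map_eval t) auto
  have iff: "norm (u t) \<le> c \<longleftrightarrow> (\<forall>d\<in>D. u t \<bullet> d \<le> c * norm d)" if "u \<in> topspace X" for u
    using that top t by (intro norm_le_iff_dense D c Cloc_Hw_in_H) auto
  have "gdelta_in X {u \<in> topspace X. \<forall>d\<in>D. u t \<bullet> d \<le> c * norm d}"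
    by (intro gdelta_in_countable_ball D gdelta_in_le_continuous_map cont)
  moreover have "{u \<in> topspace X. norm (u t) \<le> c} = {u \<in> topspace X. \<forall>d\<in>D. u t \<bullet> d \<le> c * norm d}"
    using iff by blast
  ultimately show "gdelta_in X {u \<in> topspace X. norm (u t) \<le> c}" by simp
  have "{u \<in> topspace X. c < norm (u t)} = (\<Union>d\<in>D. {u \<in> topspace X. c * norm d < u t \<bullet> d})"
    using iff by (auto simp: not_le[symmetric])
  then show "openin X {u \<in> topspace X. c < norm (u t)}"
    by (simp only:) (intro openin_Union ballI, auto intro: openin_greater_continuous_map cont)
qed

text \<open>Both norms are only lower semicontinuous; separating them by a rational number turns the
  inequality into countably many conditions, each closed or open.\<close>

lemma gdelta_in_norm_le_norm:
  assumes t: "t \<in> I" "s \<in> I" and b: "0 \<le> \<beta>" and U: "U \<subseteq> Cloc_Hw K I"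
  defines "X \<equiv> subtopology (Cloc_Hw_top K I) U"
  shows "gdelta_in X {u \<in> topspace X. (norm (u t))\<^sup>2 \<le> (norm (u s))\<^sup>2 + \<beta>}"
proof -
  let ?P = "\<lambda>q u. norm (u t) \<le> q \<or> q\<^sup>2 < (norm (u s))\<^sup>2 + \<beta>"
  have "gdelta_in X {u \<in> topspace X. \<forall>q\<in>\<rat> \<inter> {0..}. ?P q u}"
  proof (rule gdelta_in_countable_ball)
    show "countable (\<rat> \<inter> {0..} :: real set)" using countable_rat by (rule countable_Int1)
    fix q :: real assume "q \<in> \<rat> \<inter> {0..}"
    then have q: "0 \<le> q" by simp
    have o: "openin X {u \<in> topspace X. q\<^sup>2 < (norm (u s))\<^sup>2 + \<beta>}"
    \<comment> \<open>If q^2 < \<beta>, the inequality always holds. Otherwise it says that the norm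
      exceeds sqrt(q^2 - \<beta>), which is open by lower semicontinuity.\<close>
    proof (cases "q\<^sup>2 < \<beta>")
      case True
      then have "{u \<in> topspace X. q\<^sup>2 < (norm (u s))\<^sup>2 + \<beta>} = topspace X" by (auto intro: add_strict_increasing2)
      then show ?thesis by simp
    next
      case False
      then have "(q\<^sup>2 < (norm (u s))\<^sup>2 + \<beta>) = (sqrt (q\<^sup>2 - \<beta>) < norm (u s))" for u :: "real \<Rightarrow> l2vec"
        by (metis add.commute diff_less_eq real_sqrt_less_iff real_sqrt_unique norm_ge_zero)
      moreover have "openin X {u \<in> topspace X. sqrt (q\<^sup>2 - \<beta>) < norm (u s)}"
        unfolding X_def using False by (intro gdelta_in_norm_le(2)[OF t(2) _ U]) simp
      ultimately show ?thesis by simp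
    qed
    have "{u \<in> topspace X. ?P q u} = {u \<in> topspace X. norm (u t) \<le> q} \<union> {u \<in> topspace X. q\<^sup>2 < (norm (u s))\<^sup>2 + \<beta>}"
      by auto
    then show "gdelta_in X {u \<in> topspace X. ?P q u}"
      using gdelta_in_norm_le(1)[OF t(1) q U] open_imp_gdelta_in[OF o]
      by (simp only: X_def gdelta_in_Un)
  qed
  moreover have "(norm x)\<^sup>2 \<le> (norm y)\<^sup>2 + \<beta> \<longleftrightarrow> (\<forall>q\<in>\<rat> \<inter> {0..}. norm x \<le> q \<or> q\<^sup>2 < (norm y)\<^sup>2 + \<beta>)"
    for x y :: l2vec
  proof
    assume le: "(norm x)\<^sup>2 \<le> (norm y)\<^sup>2 + \<beta>"
    show "\<forall>q\<in>\<rat> \<inter> {0..}. norm x \<le> q \<or> q\<^sup>2 < (norm y)\<^sup>2 + \<beta>"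
    proof (intro ballI)
      fix q :: real assume "q \<in> \<rat> \<inter> {0..}"
      then have "q < norm x \<Longrightarrow> q\<^sup>2 < (norm x)\<^sup>2" by (intro power_strict_mono) auto
      then show "norm x \<le> q \<or> q\<^sup>2 < (norm y)\<^sup>2 + \<beta>" using le by linarith
    qed
  next
    assume *: "\<forall>q\<in>\<rat> \<inter> {0..}. norm x \<le> q \<or> q\<^sup>2 < (norm y)\<^sup>2 + \<beta>"
    show "(norm x)\<^sup>2 \<le> (norm y)\<^sup>2 + \<beta>"
    proof (rule ccontr)
      assume "\<not> ?thesis"
      then have "sqrt ((norm y)\<^sup>2 + \<beta>) < sqrt ((norm x)\<^sup>2)" by (intro real_sqrt_less_mono) simp
      then have "sqrt ((norm y)\<^sup>2 + \<beta>) < norm x" by simp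
      then obtain q where q: "q \<in> \<rat>" "sqrt ((norm y)\<^sup>2 + \<beta>) < q" "q < norm x" using Rats_dense_in_real by blast
      have s0: "0 \<le> sqrt ((norm y)\<^sup>2 + \<beta>)" using b by simp
      then have "0 \<le> q" using q(2) by linarith
      then have "q\<^sup>2 < (norm y)\<^sup>2 + \<beta>" using * q by force
      moreover have "(sqrt ((norm y)\<^sup>2 + \<beta>))\<^sup>2 \<le> q\<^sup>2" using q(2) s0 by (intro power_mono) auto
      moreover have "(sqrt ((norm y)\<^sup>2 + \<beta>))\<^sup>2 = (norm y)\<^sup>2 + \<beta>" using b by simp
      ultimately show False by linarith
    qed
  qed
  ultimately show ?thesis by simp
qed

end

section \<open>Restriction to the interior of the time interval\<close>

lemma strongly_measurable_cong:
  assumes "\<And>t. t \<in> J \<Longrightarrow> u t = v t"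
  shows "strongly_measurable J X nrm u \<longleftrightarrow> strongly_measurable J X nrm v"
  unfolding strongly_measurable_def using assms by (auto cong: conj_cong)

lemma Lp_cong:
  assumes "\<And>t. t \<in> J \<Longrightarrow> u t = v t"
  shows "Lp p J X nrm u \<longleftrightarrow> Lp p J X nrm v"
proof -
  have "(\<lambda>t. indicator J t *\<^sub>R (nrm (u t) powr p)) = (\<lambda>t. indicator J t *\<^sub>R (nrm (v t) powr p))"
    using assms by (auto simp: indicator_def)
  then show ?thesis
    unfolding Lp_def set_integrable_def using assms strongly_measurable_cong[of J u v X nrm, OF assms] by simp
qed

lemma Linf_cong:
  assumes "\<And>t. t \<in> J \<Longrightarrow> u t = v t"
  shows "Linf J X nrm u \<longleftrightarrow> Linf J X nrm v"
  unfolding Linf_def using assms strongly_measurable_cong[of J u v X nrm, OF assms] by simp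

lemma Lp_loc_restrict: "Lp_loc p J X nrm (restrict u J) \<longleftrightarrow> Lp_loc p J X nrm u"
proof -
  have "Lp p {a..b} X nrm (restrict u J) \<longleftrightarrow> Lp p {a..b} X nrm u" if "{a..b} \<subseteq> J" for a b
    using that by (intro Lp_cong) auto
  then show ?thesis by (auto simp: Lp_loc_def)
qed

lemma Linf_loc_restrict: "Linf_loc J X nrm (restrict u J) \<longleftrightarrow> Linf_loc J X nrm u"
proof -
  have "Linf {a..b} X nrm (restrict u J) \<longleftrightarrow> Linf {a..b} X nrm u" if "{a..b} \<subseteq> J" for a b
    using that by (intro Linf_cong) auto
  then show ?thesis by (auto simp: Linf_loc_def)
qed

lemma Lp_loc_mono: "I \<subseteq> J \<Longrightarrow> Lp_loc p J X nrm u \<Longrightarrow> Lp_loc p I X nrm u"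
  by (auto simp: Lp_loc_def)

lemma Linf_loc_mono: "I \<subseteq> J \<Longrightarrow> Linf_loc J X nrm u \<Longrightarrow> Linf_loc I X nrm u"
  by (auto simp: Linf_loc_def)

section \<open>From compact subintervals of the interior to closed intervals\<close>

lemma AE_Icc_exhaust:
  fixes a b :: real
  assumes "\<And>c d. a < c \<Longrightarrow> d < b \<Longrightarrow> AE t in lebesgue. t \<in> {c..d} \<longrightarrow> P t"
  shows "AE t in lebesgue. t \<in> {a..b} \<longrightarrow> P t"
proof -
  have "AE t in lebesgue. t \<in> inner_interval a b n \<longrightarrow> P t" for n
    unfolding inner_interval_def by (rule assms) simp_all
  then have "AE t in lebesgue. \<forall>n. t \<in> inner_interval a b n \<longrightarrow> P t"
    unfolding AE_all_countable by blast
  then show ?thesis using AE_not_endpoints[of a b]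
  proof eventually_elim
    case (elim t)
    show ?case
    proof
      assume "t \<in> {a..b}"
      then have "a < t" "t < b" using elim(2) by auto
      then show "P t" using inner_interval_eventually elim(1) by blast
    qed
  qed
qed

text \<open>An open interval of positive length is not a null set. This selects admissible starting
  times of the energy inequality arbitrarily close to \<open>t0\<close>.\<close>

lemma AE_lebesgue_ex:
  assumes "AE t in lebesgue. P t" "a < (b::real)"
  shows "\<exists>t. a < t \<and> t < b \<and> P t"
proof (rule ccontr)
  assume "\<not> ?thesis"
  then have "AE t in lebesgue. t \<notin> {a<..<b}" using assms(1) by (auto elim: eventually_mono)
  then have "{a<..<b} \<in> null_sets lebesgue" by (subst (asm) AE_iff_null_sets[symmetric]) auto
  then have "emeasure lebesgue {a<..<b} = 0" by (rule null_setsD1)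
  then show False using assms(2) by simp
qed

text \<open>Local spaces are defined with closed intervals while cells are half-open; the end points
  form a null set, and completeness of the measure settles measurability.\<close>

lemma set_integrable_lebesgue_Icc_Ico:
  fixes f :: "real \<Rightarrow> real"
  shows "(LINT t:{a..b}|lebesgue. f t) = (LINT t:{a..<b}|lebesgue. f t)"
    and "set_integrable lebesgue {a..b} f \<Longrightarrow> set_integrable lebesgue {a..<b} f"
    and "set_integrable lebesgue {a..<b} f \<Longrightarrow> set_integrable lebesgue {a..b} f"
proof -
  have eq: "AE t in lebesgue. indicator {a..b} t *\<^sub>R f t = indicator {a..<b} t *\<^sub>R f t"
    using AE_not_endpoints[of a b] by eventually_elim (auto simp: indicator_def)
  show i1: "set_integrable lebesgue {a..b} f \<Longrightarrow> set_integrable lebesgue {a..<b} f"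
    by (rule set_integrable_subset) auto
  show i2: "set_integrable lebesgue {a..<b} f \<Longrightarrow> set_integrable lebesgue {a..b} f"
  proof -
    assume i: "set_integrable lebesgue {a..<b} f"
    have "(\<lambda>t. indicator {a..b} t *\<^sub>R f t) \<in> borel_measurable lebesgue"
      by (rule borel_measurable_lebesgue_AE[OF borel_measurable_integrable[OF i[unfolded set_integrable_def]]])
        (use eq in \<open>auto elim: eventually_mono\<close>)
    moreover have "AE t in lebesgue. indicator {a..<b} t *\<^sub>R f t = indicator {a..b} t *\<^sub>R f t"
      using eq by eventually_elim (rule sym)
    ultimately show "set_integrable lebesgue {a..b} f"
      unfolding set_integrable_def by (rule integrable_cong_AE_imp[OF i[unfolded set_integrable_def]])
  qed
  show "(LINT t:{a..b}|lebesgue. f t) = (LINT t:{a..<b}|lebesgue. f t)"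
  proof (cases "set_integrable lebesgue {a..b} f")
    case True
    show ?thesis
      unfolding set_lebesgue_integral_def
      by (rule integral_cong_AE[OF _ _ eq])
        (use borel_measurable_integrable[OF True[unfolded set_integrable_def]]
          borel_measurable_integrable[OF i1[OF True, unfolded set_integrable_def]] in auto)
  next
    \<comment> \<open>Integrability transfers both ways, so here neither function is integrable and
      both integrals are 0 by convention.\<close>
    case False
    then have "\<not> set_integrable lebesgue {a..<b} f" using i2 by blast
    then show ?thesis
      using False by (simp add: set_lebesgue_integral_def set_integrable_def not_integrable_integral_eq)
  qed
qed

text \<open>Values in \<open>X\<close> and strong measurability reach the end points of any interval
  by exhaustion from inside. Only integrability is at stake: on \<open>{t0..c}\<close> it is
  assumed, and beyond \<open>c\<close> every compact piece is interior.\<close>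

lemma Lp_loc_extend:
  assumes x0: "x0 \<in> X" and loc: "Lp_loc p (interior I) X nrm w" and I: "is_interval I"
    and c: "{t0..c} \<subseteq> I" "\<And>b. b \<in> I \<Longrightarrow> c < b \<Longrightarrow> {c..b} \<subseteq> interior I" "\<And>t. t \<in> I \<Longrightarrow> t0 \<le> t"
    and int: "set_integrable lebesgue {t0..c} (\<lambda>t. nrm (w t) powr p)"
  shows "Lp_loc p I X nrm w"
  unfolding Lp_loc_def
proof (intro allI impI)
  fix a b assume ab: "{a..b} \<subseteq> I"
  have inn: "{c'..d'} \<subseteq> interior I" if "a < c'" "d' < b" for c' d'
  proof -
    have "{a<..<b} \<subseteq> interior I" using ab by (intro interior_maximal) auto
    then show ?thesis using that by auto
  qed
  have loc': "Lp p {c'..d'} X nrm w" if "a < c'" "d' < b" for c' d'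
    using loc inn[OF that] by (simp add: Lp_loc_def)
  show "Lp p {a..b} X nrm w"
    unfolding Lp_def
  proof (intro conjI)
    show "AE t in lebesgue. t \<in> {a..b} \<longrightarrow> w t \<in> X"
      by (rule AE_Icc_exhaust) (use loc' in \<open>auto simp: Lp_def\<close>)
    show "strongly_measurable {a..b} X nrm w"
      by (rule strongly_measurable_exhaust[OF x0]) (use loc' in \<open>auto simp: Lp_def\<close>)
    show "set_integrable lebesgue {a..b} (\<lambda>t. nrm (w t) powr p)"
    proof (cases "a \<le> b")
      case True
      then have "a \<in> I" "b \<in> I" using ab by auto
      then have a: "t0 \<le> a" using c(3) by blast
      show ?thesis
      proof (cases "c < b")
        case True
        then have "Lp p {c..b} X nrm w" using c(2)[OF \<open>b \<in> I\<close>] loc by (simp add: Lp_loc_def)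
        then have "set_integrable lebesgue ({t0..c} \<union> {c..b}) (\<lambda>t. nrm (w t) powr p)"
          by (intro set_integrable_Un int) (auto simp: Lp_def)
        then show ?thesis by (rule set_integrable_subset) (use a in auto)
      next
        case False
        then show ?thesis by (intro set_integrable_subset[OF int]) (use a in auto)
      qed
    next
      case False
      then have "{a..b} = {}" by simp
      then show ?thesis by (simp add: set_integrable_def)
    qed
  qed
qed

section \<open>Distributional identities depend only on the interior\<close>

lemma test_function_deriv_zero:
  fixes \<phi> :: "real \<Rightarrow> real"
  assumes "\<phi> \<in> test_functions U" "t \<notin> U"
  shows "\<phi> t = 0" "deriv \<phi> t = 0"
proof -
  obtain K where K: "compact K" "K \<subseteq> U" "\<And>x. x \<notin> K \<Longrightarrow> \<phi> x = 0"
    using assms(1) by (auto simp: test_functions_def)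
  then show "\<phi> t = 0" using assms(2) by blast
  have "(\<phi> has_real_derivative 0) (at t)"
    by (rule has_field_derivative_transform_within_open[of "\<lambda>_. 0" _ _ "- K"])
      (use K assms(2) in \<open>auto simp: compact_imp_closed\<close>)
  then show "deriv \<phi> t = 0" by (rule DERIV_imp_deriv)
qed

lemma regular_dist_interior:
  assumes "\<And>t. t \<notin> interior I \<Longrightarrow> \<phi> t = 0" "\<And>t. t \<in> interior I \<Longrightarrow> G t v = G' t v"
  shows "regular_dist I G \<phi> v = regular_dist (interior I) G' \<phi> v"
proof -
  have "indicator I t *\<^sub>R (\<phi> t * G t v) = indicator (interior I) t *\<^sub>R (\<phi> t * G' t v)" for t
    using assms[of t] interior_subset[of I] by (cases "t \<in> interior I") auto
  then show ?thesis unfolding regular_dist_def set_lebesgue_integral_def by (simp only:)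
qed

text \<open>Test functions and their derivatives vanish off the interior, so integrals over
  \<open>I\<close> and over its interior agree and the restricted function may replace
  \<open>u\<close>. The identity for the time derivative is thus literally the same condition on
  both intervals; the next lemma does this for the equation.\<close>

lemma dist_eq_derivative_interior:
  "dist_eq K I (dist_deriv (regular_dist I (\<lambda>t v. u t \<bullet> v))) (regular_dist I g) \<longleftrightarrow>
   dist_eq K (interior I)
     (dist_deriv (regular_dist (interior I) (\<lambda>t v. restrict u (interior I) t \<bullet> v))) (regular_dist (interior I) g)"
proof -
  have "dist_deriv (regular_dist I (\<lambda>t v. u t \<bullet> v)) \<phi> v =
      dist_deriv (regular_dist (interior I) (\<lambda>t v. restrict u (interior I) t \<bullet> v)) \<phi> v"
    "regular_dist I g \<phi> v = regular_dist (interior I) g \<phi> v"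
    if "\<phi> \<in> test_functions (interior I)" for \<phi> v
    unfolding dist_deriv_def using test_function_deriv_zero[OF that]
    by (auto intro!: regular_dist_interior)
  then show ?thesis by (auto simp: dist_eq_def)
qed

lemma dist_eq_equation_interior:
  "dist_eq K I
     (\<lambda>\<phi> v. dist_deriv (regular_dist I (\<lambda>t v. u t \<bullet> v)) \<phi> v + regular_dist I (\<lambda>t. Q (u t)) \<phi> v)
     (regular_dist I h) \<longleftrightarrow>
   dist_eq K (interior I)
     (\<lambda>\<phi> v. dist_deriv (regular_dist (interior I) (\<lambda>t v. restrict u (interior I) t \<bullet> v)) \<phi> v +
        regular_dist (interior I) (\<lambda>t. Q (restrict u (interior I) t)) \<phi> v)
     (regular_dist (interior I) h)"
proof -
  have "dist_deriv (regular_dist I (\<lambda>t v. u t \<bullet> v)) \<phi> v =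
      dist_deriv (regular_dist (interior I) (\<lambda>t v. restrict u (interior I) t \<bullet> v)) \<phi> v"
    "regular_dist I h \<phi> v = regular_dist (interior I) h \<phi> v"
    "regular_dist I (\<lambda>t. Q (u t)) \<phi> v = regular_dist (interior I) (\<lambda>t. Q (restrict u (interior I) t)) \<phi> v"
    if "\<phi> \<in> test_functions (interior I)" for \<phi> v
    unfolding dist_deriv_def using test_function_deriv_zero[OF that]
    by (auto intro!: regular_dist_interior)
  then show ?thesis by (auto simp: dist_eq_def)
qed

text \<open>Inner products of simple approximants are simple real functions and converge almost
  everywhere. This gives the measurability of the work of the force that is needed to pass to limits
  in the energy inequality.\<close>

lemma strongly_measurable_inner_borel:
  fixes f u :: "real \<Rightarrow> l2vec"
  assumes f: "strongly_measurable I X norm f" and u: "strongly_measurable J Y norm u"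
    and I: "I \<in> sets lebesgue" and J: "J \<in> sets lebesgue" "J \<subseteq> I"
  shows "(\<lambda>t. indicator J t * (f t \<bullet> u t)) \<in> borel_measurable lebesgue"
proof -
  obtain s where s: "\<And>n. simple_function (restrict_space lebesgue I) (s n)"
    "AE t in lebesgue. t \<in> I \<longrightarrow> (\<lambda>n. norm (s n t - f t)) \<longlonglongrightarrow> 0"
    using f unfolding strongly_measurable_def by blast
  obtain r where r: "\<And>n. simple_function (restrict_space lebesgue J) (r n)"
    "AE t in lebesgue. t \<in> J \<longrightarrow> (\<lambda>n. norm (r n t - u t)) \<longlonglongrightarrow> 0"
    using u unfolding strongly_measurable_def by blast
  define F where "F n t = (if t \<in> I then s n t else 0) \<bullet> (if t \<in> J then r n t else 0)" for n t
  have "simple_function lebesgue (F n)" for n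
    unfolding F_def
    by (rule simple_function_compose2[OF simple_function_extend[OF s(1) I] simple_function_extend[OF r(1) J(1)]])
  then have "F n \<in> borel_measurable lebesgue" for n by (rule borel_measurable_simple_function)
  then show ?thesis
  proof (rule borel_measurable_lebesgue_AE_limit)
    show "AE t in lebesgue. (\<lambda>n. F n t) \<longlonglongrightarrow> indicator J t * (f t \<bullet> u t)"
      using s(2) r(2)
    proof eventually_elim
      case (elim t)
      show ?case
      proof (cases "t \<in> J")
        case True
        have "(\<lambda>n. s n t) \<longlonglongrightarrow> f t" "(\<lambda>n. r n t) \<longlonglongrightarrow> u t"
          using elim True J(2) by (auto intro: LIM_zero_cancel tendsto_norm_zero_cancel)
        then have "(\<lambda>n. s n t \<bullet> r n t) \<longlonglongrightarrow> f t \<bullet> u t" by (rule tendsto_inner)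
        then show ?thesis using True J(2) by (auto simp: F_def subset_iff)
      qed (simp add: F_def)
    qed
  qed
qed

section \<open>The dual norm\<close>

context
  fixes K assumes K: "admissible K"
begin

text \<open>The supremum in \<open>V_dual_norm\<close> is meaningful only on
  \<open>V_dual K\<close>. The value 0 elsewhere makes the function nonnegative at every time, as
  the integral estimates require, and changes it only on a null set where \<open>g\<close> is in
  \<open>V_dual K\<close> almost everywhere.\<close>

definition dual_norm0 :: "(real \<Rightarrow> l2vec \<Rightarrow> real) \<Rightarrow> real \<Rightarrow> real" where
  "dual_norm0 g t = (if g t \<in> V_dual K then V_dual_norm K (g t) else 0)"

lemma V_dual_ex_bound: "F \<in> V_dual K \<Longrightarrow> \<exists>C. \<forall>v\<in>V_space K. \<bar>F v\<bar> \<le> C * H1_norm K v"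
  by (simp add: V_dual_def)

lemma V_dual_norm_bdd:
  assumes "F \<in> V_dual K"
  shows "bdd_above ((\<lambda>v. \<bar>F v\<bar>) ` {v \<in> V_space K. H1_norm K v \<le> 1})"
proof -
  obtain C where C: "\<And>v. v \<in> V_space K \<Longrightarrow> \<bar>F v\<bar> \<le> C * H1_norm K v"
    using V_dual_ex_bound[OF assms] by blast
  have "\<bar>F v\<bar> \<le> \<bar>C\<bar>" if "v \<in> V_space K" "H1_norm K v \<le> 1" for v
  proof -
    have "C * H1_norm K v \<le> \<bar>C\<bar> * 1"
      using that(2) H1_norm_nonneg[of K v] by (intro mult_mono) auto
    then show ?thesis using C[OF that(1)] by linarith
  qed
  then show ?thesis by (intro bdd_aboveI[of _ "\<bar>C\<bar>"]) auto
qed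

lemma zero_in_V: "0 \<in> V_space K"
  by (rule subspace_0[OF subspace_V_space[OF K]])

lemma H1_norm_zero: "H1_norm K 0 = 0"
  using H1_norm_scaleR[OF K V_space_H1[OF K zero_in_V], of 0] by simp

lemma V_dual_norm_nonneg:
  assumes "F \<in> V_dual K"
  shows "0 \<le> V_dual_norm K F"
proof -
  have "\<bar>F 0\<bar> \<le> V_dual_norm K F"
    unfolding V_dual_norm_def
    by (rule cSUP_upper[OF _ V_dual_norm_bdd[OF assms]]) (simp add: zero_in_V H1_norm_zero)
  then show ?thesis by linarith
qed

text \<open>Scaling to seminorm one. \<open>H1_norm\<close> is treated as a seminorm, so the case of
  seminorm zero is separate: there the bound contained in the definition of \<open>V_dual\<close>
  forces F v = 0.\<close>

lemma V_dual_bound: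
  assumes F: "F \<in> V_dual K" and v: "v \<in> V_space K"
  shows "\<bar>F v\<bar> \<le> V_dual_norm K F * H1_norm K v"
proof (cases "H1_norm K v = 0")
  case True
  obtain C where "\<And>v. v \<in> V_space K \<Longrightarrow> \<bar>F v\<bar> \<le> C * H1_norm K v"
    using V_dual_ex_bound[OF F] by blast
  then show ?thesis using v True by force
next
  case False
  define r where "r = H1_norm K v"
  have r: "0 < r" using False H1_norm_nonneg[of K v] by (simp add: r_def)
  have rv: "(1 / r) *\<^sub>R v \<in> V_space K" by (rule subspace_scale[OF subspace_V_space[OF K] v])
  have "H1_norm K ((1 / r) *\<^sub>R v) = 1"
    using r by (simp add: H1_norm_scaleR[OF K V_space_H1[OF K v]] r_def)
  then have "\<bar>F ((1 / r) *\<^sub>R v)\<bar> \<le> V_dual_norm K F"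
    unfolding V_dual_norm_def by (intro cSUP_upper V_dual_norm_bdd F) (simp add: rv)
  moreover have "F ((1 / r) *\<^sub>R v) = (1 / r) * F v" using F v by (auto simp: V_dual_def)
  ultimately show ?thesis using r by (simp add: r_def[symmetric] abs_mult field_simps)
qed

lemma V_dual_diff:
  assumes "F \<in> V_dual K" "G \<in> V_dual K"
  shows "F - G \<in> V_dual K"
proof -
  obtain C D where "\<And>v. v \<in> V_space K \<Longrightarrow> \<bar>F v\<bar> \<le> C * H1_norm K v"
    "\<And>v. v \<in> V_space K \<Longrightarrow> \<bar>G v\<bar> \<le> D * H1_norm K v"
    using assms[THEN V_dual_ex_bound] by blast
  then have "\<bar>F v - G v\<bar> \<le> (C + D) * H1_norm K v" if "v \<in> V_space K" for v
    using that by (smt (verit) distrib_right)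
  then have "\<exists>C. \<forall>v\<in>V_space K. \<bar>(F - G) v\<bar> \<le> C * H1_norm K v" by auto
  moreover have "\<forall>u\<in>V_space K. \<forall>v\<in>V_space K. (F - G) (u + v) = (F - G) u + (F - G) v"
    "\<forall>c. \<forall>v\<in>V_space K. (F - G) (c *\<^sub>R v) = c * (F - G) v"
    using assms by (simp_all add: V_dual_def right_diff_distrib)
  ultimately show ?thesis unfolding V_dual_def by blast
qed

lemma zero_in_V_dual: "(\<lambda>v. 0) \<in> V_dual K"
  by (auto simp: V_dual_def intro!: exI[of _ 0])

lemma dual_norm0_nonneg: "0 \<le> dual_norm0 g t"
  by (simp add: dual_norm0_def V_dual_norm_nonneg)

text \<open>Evaluation at a fixed v turns a V'-valued function into a scalar one: the evaluated
  simple approximants converge by \<open>V_dual_bound\<close>, which gives measurability, and the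
  dual norm times the seminorm of v is a majorant, integrable because L^p lies in L^1 on a bounded
  interval.\<close>

lemma Lp_V_dual_apply:
  assumes g: "Lp p {a..b} (V_dual K) (V_dual_norm K) g" and p: "1 < p"
  shows "set_integrable lebesgue {a..b} (\<lambda>t. dual_norm0 g t powr p)"
    and "AE t in lebesgue. t \<in> {a..b} \<longrightarrow> g t \<in> V_dual K"
    and "v \<in> V_space K \<Longrightarrow> set_integrable lebesgue {a..b} (\<lambda>t. g t v)"
proof -
  show ae: "AE t in lebesgue. t \<in> {a..b} \<longrightarrow> g t \<in> V_dual K" using g by (simp add: Lp_def)
  have i: "integrable lebesgue (\<lambda>t. indicator {a..b} t *\<^sub>R (V_dual_norm K (g t) powr p))"
    using g by (simp add: Lp_def set_integrable_def)
  have eq: "AE t in lebesgue. indicator {a..b} t *\<^sub>R (V_dual_norm K (g t) powr p) =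
      indicator {a..b} t *\<^sub>R (dual_norm0 g t powr p)"
    using ae by eventually_elim (auto simp: dual_norm0_def indicator_def)
  show int: "set_integrable lebesgue {a..b} (\<lambda>t. dual_norm0 g t powr p)"
    unfolding set_integrable_def
    by (rule integrable_cong_AE_imp[OF i borel_measurable_lebesgue_AE[OF borel_measurable_integrable[OF i] eq]])
      (use eq in \<open>auto elim: eventually_mono\<close>)
  have int1: "set_integrable lebesgue {a..b} (dual_norm0 g)"
    by (rule set_integrable_lebesgue_Icc_Ico(3)[OF
      set_integrable_of_powr[OF dual_norm0_nonneg p set_integrable_lebesgue_Icc_Ico(2)[OF int]]])
  assume v: "v \<in> V_space K"
  obtain s where s: "\<And>n. simple_function (restrict_space lebesgue {a..b}) (s n)" "\<And>n. s n ` {a..b} \<subseteq> V_dual K"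
    "AE t in lebesgue. t \<in> {a..b} \<longrightarrow> (\<lambda>n. V_dual_norm K (s n t - g t)) \<longlonglongrightarrow> 0"
    using g unfolding Lp_def strongly_measurable_def by blast
  define F where "F n t = (if t \<in> {a..b} then s n t else (\<lambda>v. 0)) v" for n t
  have "simple_function lebesgue (F n)" for n
    unfolding F_def by (rule simple_function_compose1[OF simple_function_extend[OF s(1)]]) simp
  then have "F n \<in> borel_measurable lebesgue" for n by (rule borel_measurable_simple_function)
  then have m: "(\<lambda>t. indicator {a..b} t *\<^sub>R g t v) \<in> borel_measurable lebesgue"
  proof (rule borel_measurable_lebesgue_AE_limit)
    show "AE t in lebesgue. (\<lambda>n. F n t) \<longlonglongrightarrow> indicator {a..b} t *\<^sub>R g t v"
      using s(3) ae
    proof eventually_elim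
      case (elim t)
      show ?case
      proof (cases "t \<in> {a..b}")
        case True
        then have gt: "g t \<in> V_dual K" and st: "s n t \<in> V_dual K" for n using elim(2) s(2)[of n] by auto
        have "(\<lambda>n. s n t v - g t v) \<longlonglongrightarrow> 0"
        proof (rule Lim_null_comparison[OF always_eventually, rotated])
          show "\<forall>n. norm (s n t v - g t v) \<le> V_dual_norm K (s n t - g t) * H1_norm K v"
            using V_dual_bound[OF V_dual_diff[OF st gt] v] by simp
          show "(\<lambda>n. V_dual_norm K (s n t - g t) * H1_norm K v) \<longlonglongrightarrow> 0"
            using elim(1) True by (intro tendsto_mult_left_zero) auto
        qed
        then show ?thesis using True by (simp add: F_def LIM_zero_iff)
      next
        case False
        have "F n t = 0" for n unfolding F_def if_not_P[OF False] ..
        then show ?thesis using False by (simp del: atLeastAtMost_iff)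
      qed
    qed
  qed
  show "set_integrable lebesgue {a..b} (\<lambda>t. g t v)"
    unfolding set_integrable_def
  proof (rule Bochner_Integration.integrable_bound[OF _ m])
    show "integrable lebesgue (\<lambda>t. indicator {a..b} t *\<^sub>R (dual_norm0 g t * H1_norm K v))"
      using set_integrable_mult_left[OF int1, of "H1_norm K v"] by (simp add: set_integrable_def)
    show "AE t in lebesgue. norm (indicator {a..b} t *\<^sub>R g t v) \<le> norm (indicator {a..b} t *\<^sub>R (dual_norm0 g t * H1_norm K v))"
      using ae
    proof eventually_elim
      case (elim t)
      then show ?case
        using V_dual_bound[OF _ v, of "g t"] V_dual_norm_nonneg[of "g t"] H1_norm_nonneg[of K v]
        by (auto simp: indicator_def dual_norm0_def abs_mult)
    qed
  qed
qed

text \<open>A nearly optimal v in the ball is replaced by a nearby member d j of the sequence. From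
  k = j on the maximum is within e of the supremum, which it never exceeds.\<close>

lemma max_abs_tendsto_V_dual_norm:
  assumes d: "range d \<subseteq> {v \<in> V_space K. H1_norm K v \<le> 1}"
    and dense: "\<forall>v\<in>V_space K. H1_norm K v \<le> 1 \<longrightarrow> (\<forall>e>0. \<exists>x\<in>range d. H1_norm K (v - x) < e)"
    and F: "F \<in> V_dual K"
  shows "(\<lambda>k. max_abs (\<lambda>j. F (d j)) k) \<longlonglongrightarrow> V_dual_norm K F"
proof (rule LIMSEQ_I)
  fix e :: real assume e: "0 < e"
  let ?S = "{v \<in> V_space K. H1_norm K v \<le> 1}" and ?N = "V_dual_norm K F"
  have up: "max_abs (\<lambda>j. F (d j)) k \<le> ?N" for k
  proof (rule max_abs_le)
    fix j
    show "\<bar>F (d j)\<bar> \<le> ?N"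
      unfolding V_dual_norm_def using d by (intro cSUP_upper V_dual_norm_bdd F) auto
  qed
  have "?S \<noteq> {}" using zero_in_V H1_norm_zero by auto
  then have "\<exists>v\<in>?S. ?N - e / 2 < \<bar>F v\<bar>"
    unfolding V_dual_norm_def using e
    by (intro less_cSUP_iff[THEN iffD1] V_dual_norm_bdd F) auto
  then obtain v where v: "v \<in> V_space K" "H1_norm K v \<le> 1" "?N - e / 2 < \<bar>F v\<bar>" by auto
  \<comment> \<open>Makes the dual norm times \<delta> at most e/2; the summand 1 covers a vanishing
    dual norm.\<close>
  define \<delta> where "\<delta> = e / (2 * (?N + 1))"
  have N0: "0 \<le> ?N" by (rule V_dual_norm_nonneg[OF F])
  have \<delta>: "0 < \<delta>" using e N0 by (simp add: \<delta>_def)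
  then obtain j where j: "H1_norm K (v - d j) < \<delta>" using dense v by blast
  have dj: "d j \<in> V_space K" using d by auto
  have vd: "v - d j \<in> V_space K" by (rule subspace_diff[OF subspace_V_space[OF K] v(1) dj])
  have "F ((v - d j) + d j) = F (v - d j) + F (d j)" using F vd dj unfolding V_dual_def by blast
  then have "\<bar>F v\<bar> \<le> \<bar>F (v - d j)\<bar> + \<bar>F (d j)\<bar>" by simp
  moreover have "\<bar>F (v - d j)\<bar> \<le> ?N * H1_norm K (v - d j)" by (rule V_dual_bound[OF F vd])
  moreover have "?N * H1_norm K (v - d j) \<le> ?N * \<delta>" using j N0 by (intro mult_left_mono) auto
  moreover have "?N * \<delta> \<le> e / 2" using e N0 by (simp add: \<delta>_def field_simps)
  ultimately have "?N - e < \<bar>F (d j)\<bar>" using v(3) by linarith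
  then have "norm (max_abs (\<lambda>j. F (d j)) k - ?N) < e" if "j \<le> k" for k
    using up[of k] max_abs_ge[OF that, of "\<lambda>j. F (d j)"] by simp
  then show "\<exists>no. \<forall>n\<ge>no. norm (max_abs (\<lambda>j. F (d j)) n - ?N) < e" by blast
qed

end

section \<open>Weak solutions up to the initial time\<close>

text \<open>A function that is not integrable has integral 0 by convention, so the bound holds in
  both cases and can be applied to the work of the force directly from pointwise estimates.\<close>

lemma set_integral_abs_bound:
  fixes p :: "real \<Rightarrow> real"
  assumes "s \<le> t" "0 \<le> C" "AE r in lebesgue. r \<in> {s..t} \<longrightarrow> \<bar>p r\<bar> \<le> C"
  shows "\<bar>LINT r:{s..t}|lebesgue. p r\<bar> \<le> C * (t - s)"
proof (cases "set_integrable lebesgue {s..t} p")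
  case True
  have "\<bar>LINT r:{s..t}|lebesgue. p r\<bar> \<le> (LINT r|lebesgue. \<bar>indicator {s..t} r *\<^sub>R p r\<bar>)"
    unfolding set_lebesgue_integral_def by (rule integral_abs_bound)
  also have "\<dots> \<le> (LINT r|lebesgue. indicator {s..t} r * C)"
  proof (rule integral_mono_AE)
    show "integrable lebesgue (\<lambda>r. \<bar>indicator {s..t} r *\<^sub>R p r\<bar>)"
      using True unfolding set_integrable_def by (rule integrable_abs)
    show "integrable lebesgue (\<lambda>r. indicator {s..t} r * C)"
      using set_integrable_lebesgue_Icc_Ico(3)[OF set_integral_const_Ico(1)[of s t C]] by (simp add: set_integrable_def)
    show "AE r in lebesgue. \<bar>indicator {s..t} r *\<^sub>R p r\<bar> \<le> indicator {s..t} r * C"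
      using assms(3) by eventually_elim (auto simp: indicator_def)
  qed
  also have "\<dots> = C * (t - s)"
  proof -
    have "(LINT r:{s..t}|lebesgue. C) = (t - s) * C"
      unfolding set_integrable_lebesgue_Icc_Ico(1) by (rule set_integral_const_Ico(2)[OF assms(1)])
    then show ?thesis unfolding set_lebesgue_integral_def real_scaleR_def by (simp only: mult.commute)
  qed
  finally show ?thesis .
next
  case False
  then show ?thesis
    using assms(1,2) by (simp add: set_lebesgue_integral_def set_integrable_def not_integrable_integral_eq)
qed

text \<open>c is the right end point of \<open>I\<close> if it belongs to \<open>I\<close>; then no
  point of \<open>I\<close> lies beyond it. Otherwise c is any point of \<open>I\<close> to the
  right of \<open>t0\<close>, and everything between c and a later point is interior. The degenerate
  interval consisting of \<open>t0\<close> alone falls under the first case with c =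
  \<open>t0\<close>.\<close>

lemma exhausting_endpoint:
  fixes I :: "real set"
  assumes I: "is_interval I" "t0 \<in> I" "\<forall>t\<in>I. t0 \<le> t"
  shows "\<exists>c\<in>I. t0 \<le> c \<and> {t0..c} \<subseteq> I \<and> {t0<..<c} \<subseteq> interior I \<and> (\<forall>b\<in>I. c < b \<longrightarrow> {c..b} \<subseteq> interior I)"
proof -
  have sub: "{x..y} \<subseteq> I" if "x \<in> I" "y \<in> I" for x y
    using mem_is_interval_1_I[OF I(1) that] by auto
  have int: "{t0<..<y} \<subseteq> interior I" if "y \<in> I" for y
    using sub[OF I(2) that] by (intro interior_maximal) auto
  show ?thesis
  proof (cases "\<exists>T\<in>I. \<forall>t\<in>I. t \<le> T")
    case True
    then obtain T where T: "T \<in> I" "\<forall>t\<in>I. t \<le> T" by blast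
    then show ?thesis using I sub[OF I(2) T(1)] int[OF T(1)] by (intro bexI[of _ T]) force+
  next
    case False
    then obtain c where c: "c \<in> I" "t0 < c" using I(2) by (meson not_le)
    have "{c..b} \<subseteq> interior I" if b: "b \<in> I" "c < b" for b
    proof -
      obtain b' where b': "b' \<in> I" "b < b'" using False b(1) by (meson not_le)
      then show ?thesis using int[OF b'(1)] c by fastforce
    qed
    then show ?thesis using c sub[OF I(2) c(1)] int[OF c(1)] by (intro bexI[of _ c]) auto
  qed
qed

section \<open>The fixed setting, and weak solutions on the interval and on its interior\<close>

context
  fixes K :: flow_case and \<nu> t0 c :: real and I :: "real set" and f :: "real \<Rightarrow> l2vec"
    and d :: "nat \<Rightarrow> l2vec"
  assumes K: "admissible K" and \<nu>: "0 < \<nu>"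
    and I: "is_interval I" "t0 \<in> I" "\<And>t. t \<in> I \<Longrightarrow> t0 \<le> t"
    and f: "Linf I (H_space K) norm f"
    and c: "c \<in> I" "t0 \<le> c" "{t0..c} \<subseteq> I" "{t0<..<c} \<subseteq> interior I"
      "\<And>b. b \<in> I \<Longrightarrow> c < b \<Longrightarrow> {c..b} \<subseteq> interior I"
    and d: "range d \<subseteq> {v \<in> V_space K. H1_norm K v \<le> 1}"
      "\<forall>v\<in>V_space K. H1_norm K v \<le> 1 \<longrightarrow> (\<forall>e>0. \<exists>x\<in>range d. H1_norm K (v - x) < e)"
begin

lemma interior_interval:
  "x \<in> interior I \<Longrightarrow> y \<in> interior I \<Longrightarrow> {x..y} \<subseteq> interior I"
proof -
  assume xy: "x \<in> interior I" "y \<in> interior I"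
  have "is_interval (interior I)" using I(1) by (simp add: is_interval_convex_1 convex_interior)
  from mem_is_interval_1_I[OF this xy] show "{x..y} \<subseteq> interior I" by auto
qed

lemma interval_sub:
  assumes "x \<in> I" "y \<in> I"
  shows "{x..y} \<subseteq> I"
  using mem_is_interval_1_I[OF I(1) assms] by auto

lemma t0_notin_interior: "t0 \<notin> interior I"
proof
  assume "t0 \<in> interior I"
  then obtain e where e: "0 < e" "cball t0 e \<subseteq> interior I"
    using open_interior open_contains_cball by blast
  then have "t0 - e \<in> I" using interior_subset[of I] by (auto simp: dist_real_def subset_iff)
  then show False using I(3) e(1) by force
qed

definition energy_inequality :: "(real \<Rightarrow> l2vec) \<Rightarrow> real \<Rightarrow> real \<Rightarrow> bool" where
  "energy_inequality u t' t \<longleftrightarrow>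
     (norm (u t))\<^sup>2 / 2 + \<nu> * (LINT s:{t'..t}|lebesgue. (H1_norm K (u s))\<^sup>2)
       \<le> (norm (u t'))\<^sup>2 / 2 + (LINT s:{t'..t}|lebesgue. f s \<bullet> u s)"

definition energy_holds :: "real set \<Rightarrow> (real \<Rightarrow> l2vec) \<Rightarrow> bool" where
  "energy_holds J u \<longleftrightarrow>
     (AE t' in lebesgue. t' \<in> J \<longrightarrow> (\<forall>t\<in>J. t' < t \<longrightarrow> energy_inequality u t' t))"

lemma energy_holds_restrict:
  "energy_holds (interior I) (restrict u (interior I)) \<longleftrightarrow> energy_holds (interior I) u"
proof -
  have "energy_inequality (restrict u (interior I)) t' t \<longleftrightarrow> energy_inequality u t' t"
    if "t' \<in> interior I" "t \<in> interior I" for t t'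
  proof -
    have r: "restrict u (interior I) s = u s" if "s \<in> {t'..t}" for s
      using interior_interval[OF \<open>t' \<in> interior I\<close> \<open>t \<in> interior I\<close>] that by (auto simp: restrict_def)
    have "(LINT s:{t'..t}|lebesgue. (H1_norm K (restrict u (interior I) s))\<^sup>2) = (LINT s:{t'..t}|lebesgue. (H1_norm K (u s))\<^sup>2)"
      "(LINT s:{t'..t}|lebesgue. f s \<bullet> restrict u (interior I) s) = (LINT s:{t'..t}|lebesgue. f s \<bullet> u s)"
      using r by (auto intro!: set_lebesgue_integral_cong)
    then show ?thesis using that by (simp add: energy_inequality_def)
  qed
  then have eq: "(t' \<in> interior I \<longrightarrow> (\<forall>t\<in>interior I. t' < t \<longrightarrow> energy_inequality (restrict u (interior I)) t' t)) \<longleftrightarrow>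
      (t' \<in> interior I \<longrightarrow> (\<forall>t\<in>interior I. t' < t \<longrightarrow> energy_inequality u t' t))" for t'
    by blast
  show ?thesis unfolding energy_holds_def eq ..
qed

definition has_V_dual_derivative :: "(real \<Rightarrow> l2vec) \<Rightarrow> (real \<Rightarrow> l2vec \<Rightarrow> real) \<Rightarrow> bool" where
  "has_V_dual_derivative u g \<longleftrightarrow>
     dist_eq K I (dist_deriv (regular_dist I (\<lambda>t v. u t \<bullet> v))) (regular_dist I g)"

definition satisfies_equation :: "(real \<Rightarrow> l2vec) \<Rightarrow> bool" where
  "satisfies_equation u \<longleftrightarrow> dist_eq K I
       (\<lambda>\<phi> v. dist_deriv (regular_dist I (\<lambda>t v. u t \<bullet> v)) \<phi> v +
          regular_dist I (\<lambda>t v. \<nu> * A_op K (u t) v + B_op K (u t) (u t) v) \<phi> v)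
       (regular_dist I (\<lambda>t v. f t \<bullet> v))"

text \<open>\<open>t0\<close> is the only smallest element of \<open>I\<close>, so the quantifier
  over initial times in the definition collapses to \<open>t0\<close>.\<close>

lemma weak_solution_iff:
  assumes u: "u \<in> Cloc_Hw K I"
  shows "weak_solution K \<nu> f I u \<longleftrightarrow>
     Linf_loc I (H_space K) norm u \<and> Lp_loc 2 I (V_space K) (H1_norm K) u \<and>
     (\<exists>g. Lp_loc (4/3) I (V_dual K) (V_dual_norm K) g \<and> has_V_dual_derivative u g) \<and>
     satisfies_equation u \<and> energy_holds I u \<and> (u \<longlongrightarrow> u t0) (at t0 within I)"
proof -
  have "t = t0" if "t \<in> I" "\<forall>s\<in>I. t \<le> s" for t
    using that I(2) I(3)[OF that(1)] by force
  then have "(\<forall>t0. t0 \<in> I \<and> (\<forall>t\<in>I. t0 \<le> t) \<longrightarrow> (u \<longlongrightarrow> u t0) (at t0 within I)) \<longleftrightarrow> (u \<longlongrightarrow> u t0) (at t0 within I)"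
    using I by blast
  then show ?thesis
    using u unfolding weak_solution_def has_V_dual_derivative_def satisfies_equation_def energy_holds_def
      energy_inequality_def
    by simp
qed

lemma Cloc_Hw_restrict: "u \<in> Cloc_Hw K I \<Longrightarrow> restrict u (interior I) \<in> Cloc_Hw K (interior I)"
proof -
  assume u: "u \<in> Cloc_Hw K I"
  have "continuous_on (interior I) (\<lambda>t. restrict u (interior I) t \<bullet> v)" if "v \<in> H_space K" for v
  proof -
    have "continuous_on (interior I) (\<lambda>t. u t \<bullet> v)"
      using u that interior_subset[of I] unfolding Cloc_Hw_def by (blast intro: continuous_on_subset)
    then show ?thesis by (rule continuous_on_eq) simp
  qed
  then show ?thesis using Cloc_Hw_in_H[OF K u] interior_subset[of I] by (auto simp: Cloc_Hw_def)
qed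

text \<open>The interior has no smallest element, so strong continuity at an initial time is void
  there. All remaining conditions can be stated for \<open>u\<close> itself in place of its
  restriction, and the two distributional ones take the same form as on \<open>I\<close>.\<close>

lemma interior_weak_solution_iff:
  assumes u: "u \<in> Cloc_Hw K I"
  shows "u \<in> interior_weak_solutions K \<nu> f I \<longleftrightarrow>
     Linf_loc (interior I) (H_space K) norm u \<and> Lp_loc 2 (interior I) (V_space K) (H1_norm K) u \<and>
     (\<exists>g. Lp_loc (4/3) (interior I) (V_dual K) (V_dual_norm K) g \<and> has_V_dual_derivative u g) \<and>
     satisfies_equation u \<and> energy_holds (interior I) u"
proof -
  have no_min: "\<not> (t \<in> interior I \<and> (\<forall>s\<in>interior I. t \<le> s))" for t
  proof
    assume t: "t \<in> interior I \<and> (\<forall>s\<in>interior I. t \<le> s)"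
    then obtain e where e: "0 < e" "cball t e \<subseteq> interior I"
      using open_interior open_contains_cball by blast
    then have "t - e \<in> interior I" by (auto simp: dist_real_def subset_iff)
    then show False using t e(1) by force
  qed
  show ?thesis
    unfolding interior_weak_solutions_def weak_solution_def mem_Collect_eq Linf_loc_restrict Lp_loc_restrict
      has_V_dual_derivative_def satisfies_equation_def dist_eq_derivative_interior[where I = I]
      dist_eq_equation_interior[where I = I and Q = "\<lambda>x v. \<nu> * A_op K x v + B_op K x x v"]
      energy_holds_restrict[of u, symmetric]
    unfolding energy_holds_def energy_inequality_def
    using u Cloc_Hw_restrict[OF u] no_min by blast
qed

lemma weak_solutions_subset_interior: "weak_solutions K \<nu> f I \<subseteq> interior_weak_solutions K \<nu> f I"
proof
  fix u assume "u \<in> weak_solutions K \<nu> f I"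
  then have u: "u \<in> Cloc_Hw K I" "weak_solution K \<nu> f I u" by (auto simp: weak_solutions_def)
  have "energy_holds (interior I) u"
    using u interior_subset[of I] unfolding weak_solution_iff[OF u(1)] energy_holds_def
    by (auto elim!: eventually_mono)
  then show "u \<in> interior_weak_solutions K \<nu> f I"
    using u(2) interior_subset[of I] unfolding weak_solution_iff[OF u(1)] interior_weak_solution_iff[OF u(1)]
    by (blast intro: Lp_loc_mono Linf_loc_mono)
qed

section \<open>The countable family of conditions\<close>

text \<open>The indices for which shortening \<open>{t0..c}\<close> by 1/(m+1) at both ends leaves
  an interval of positive length.\<close>

definition grid_set :: "nat set" where
  "grid_set = {m. t0 + 1 / real (Suc m) < c - 1 / real (Suc m)}"

text \<open>m fixes the distance from the ends, n + 1 is the number of cells, and k + 1 is the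
  number of functionals. Taking finitely many functionals keeps the sum a continuous function of
  \<open>u\<close>.\<close>

definition grid_sum :: "(real \<Rightarrow> l2vec) \<Rightarrow> nat \<Rightarrow> nat \<Rightarrow> nat \<Rightarrow> real" where
  "grid_sum u m n k = (let a = t0 + 1 / real (Suc m); b = c - 1 / real (Suc m) in
     grid_power_sum (4/3) a b (Suc n)
       (\<lambda>i. max_abs (\<lambda>j. (u (grid a b (Suc n) (Suc i)) - u (grid a b (Suc n) i)) \<bullet> d j) k))"

text \<open>The two ends are added because they may be irrational, and because points inside are
  approached by rationals from the right, which is impossible at c.\<close>

definition times :: "real set" where
  "times = (\<rat> \<inter> {t0..c}) \<union> {t0, c}"

definition good :: "nat \<Rightarrow> (real \<Rightarrow> l2vec) \<Rightarrow> bool" where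
  "good M u \<longleftrightarrow> (\<forall>t\<in>times. (norm (u t))\<^sup>2 \<le> (norm (u t0))\<^sup>2 + real M * (t - t0)) \<and>
     (\<forall>(m, n, k)\<in>grid_set \<times> UNIV \<times> UNIV. grid_sum u m n k \<le> real M)"

lemma grid_interval:
  assumes "m \<in> grid_set"
  shows "{t0 + 1 / real (Suc m)..c - 1 / real (Suc m)} \<subseteq> interior I"
    "t0 + 1 / real (Suc m) < c - 1 / real (Suc m)"
proof -
  show "t0 + 1 / real (Suc m) < c - 1 / real (Suc m)" using assms by (simp add: grid_set_def)
  have "0 < 1 / real (Suc m)" by simp
  then have "t0 < x \<and> x < c" if "x \<in> {t0 + 1 / real (Suc m)..c - 1 / real (Suc m)}" for x
    using that unfolding atLeastAtMost_iff by linarith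
  then have "{t0 + 1 / real (Suc m)..c - 1 / real (Suc m)} \<subseteq> {t0<..<c}" by auto
  then show "{t0 + 1 / real (Suc m)..c - 1 / real (Suc m)} \<subseteq> interior I" using c(4) by blast
qed

lemma V_in_H: "v \<in> V_space K \<Longrightarrow> v \<in> H_space K"
  using V_space_subset_H_space[OF K] by blast

lemma d_in: "d j \<in> V_space K" "H1_norm K (d j) \<le> 1"
  using d(1) by auto

lemma gdelta_good:
  "gdelta_in (subtopology (Cloc_Hw_top K I) (interior_weak_solutions K \<nu> f I))
     {u \<in> interior_weak_solutions K \<nu> f I. good M u}"
proof -
  let ?U = "interior_weak_solutions K \<nu> f I"
  let ?X = "subtopology (Cloc_Hw_top K I) ?U"
  have UC: "?U \<subseteq> Cloc_Hw K I" by (auto simp: interior_weak_solutions_def)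
  have top: "topspace ?X = ?U" using UC by (auto simp: topspace_Cloc_Hw[OF K])
  have tI: "times \<subseteq> I" using c(1,2,3) I(2) by (auto simp: times_def)
  have "gdelta_in ?X {u \<in> topspace ?X. \<forall>t\<in>times. (norm (u t))\<^sup>2 \<le> (norm (u t0))\<^sup>2 + real M * (t - t0)}"
  proof (rule gdelta_in_countable_ball)
    show "countable times" unfolding times_def by (intro countable_Un countable_Int1 countable_rat) auto
    fix t assume t: "t \<in> times"
    then have "t \<in> I" "0 \<le> real M * (t - t0)" using tI I(3) by auto
    then show "gdelta_in ?X {u \<in> topspace ?X. (norm (u t))\<^sup>2 \<le> (norm (u t0))\<^sup>2 + real M * (t - t0)}"
      by (intro gdelta_in_norm_le_norm[OF K] I(2) UC)
  qed
  moreover have "gdelta_in ?X {u \<in> topspace ?X. \<forall>z\<in>grid_set \<times> UNIV \<times> UNIV. (case z of (m, n, k) \<Rightarrow> grid_sum u m n k \<le> real M)}"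
  proof (rule gdelta_in_countable_ball)
    fix z assume "z \<in> grid_set \<times> (UNIV :: nat set) \<times> (UNIV :: nat set)"
    then obtain m n k where z: "z = (m, n, k)" and m: "m \<in> grid_set" by auto
    have "continuous_map ?X euclideanreal (\<lambda>u. grid_sum u m n k)"
      unfolding grid_sum_def Let_def
    proof (intro continuous_map_grid_power_sum continuous_map_max_abs)
      fix i j assume i: "i < Suc n"
      have g: "grid (t0 + 1 / real (Suc m)) (c - 1 / real (Suc m)) (Suc n) i' \<in> I" if "i' \<le> Suc n" for i'
        using grid_in[OF less_imp_le[OF grid_interval(2)[OF m]] that] grid_interval(1)[OF m] interior_subset[of I] by blast
      show "continuous_map ?X euclideanreal (\<lambda>u. (u (grid (t0 + 1 / real (Suc m)) (c - 1 / real (Suc m)) (Suc n) (Suc i)) -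
          u (grid (t0 + 1 / real (Suc m)) (c - 1 / real (Suc m)) (Suc n) i)) \<bullet> d j)"
        unfolding inner_diff_left
        using i by (intro continuous_map_diff continuous_map_from_subtopology continuous_map_eval[OF K] g V_in_H d_in) auto
    qed (use grid_interval(2)[OF m] in \<open>auto simp: max_abs_nonneg\<close>)
    then show "gdelta_in ?X {u \<in> topspace ?X. (case z of (m, n, k) \<Rightarrow> grid_sum u m n k \<le> real M)}"
      unfolding z prod.case by (rule gdelta_in_le_continuous_map)
  qed simp
  ultimately have "gdelta_in ?X ({u \<in> topspace ?X. \<forall>t\<in>times. (norm (u t))\<^sup>2 \<le> (norm (u t0))\<^sup>2 + real M * (t - t0)} \<inter>
     {u \<in> topspace ?X. \<forall>z\<in>grid_set \<times> UNIV \<times> UNIV. (case z of (m, n, k) \<Rightarrow> grid_sum u m n k \<le> real M)})"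
    by (rule gdelta_in_Int)
  moreover have "{u \<in> topspace ?X. \<forall>t\<in>times. (norm (u t))\<^sup>2 \<le> (norm (u t0))\<^sup>2 + real M * (t - t0)} \<inter>
     {u \<in> topspace ?X. \<forall>z\<in>grid_set \<times> UNIV \<times> UNIV. (case z of (m, n, k) \<Rightarrow> grid_sum u m n k \<le> real M)} =
     {u \<in> ?U. good M u}"
    unfolding top good_def by auto
  ultimately show ?thesis by simp
qed

text \<open>The scalar identity is applied to \<open>u t \<bullet> v\<close> with derivative
  \<open>g t v\<close>. It lets integrals of the derivative be read off from weak evaluations of
  \<open>u\<close>, on which the topology has a direct hold.\<close>

lemma increment_identity:
  assumes u: "u \<in> Cloc_Hw K I" and g: "Lp_loc (4/3) (interior I) (V_dual K) (V_dual_norm K) g"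
    and der: "has_V_dual_derivative u g" and v: "v \<in> V_space K"
    and ab: "a \<le> b" "{a..b} \<subseteq> interior I"
  shows "(u b - u a) \<bullet> v = (LINT t:{a..<b}|lebesgue. g t v)"
proof -
  have "u b \<bullet> v - u a \<bullet> v = (LINT t:{a..<b}|lebesgue. g t v)"
  proof (rule increment_eq_integral_of_distributional_derivative[OF _ _ _ ab])
    show "continuous_on (interior I) (\<lambda>t. u t \<bullet> v)"
      using u V_in_H[OF v] interior_subset[of I] unfolding Cloc_Hw_def by (blast intro: continuous_on_subset)
    show "set_integrable lebesgue {a..b} (\<lambda>t. g t v)" if "{a..b} \<subseteq> interior I" for a b
      using g that by (intro Lp_V_dual_apply(3)[OF K, where p = "4/3"] v) (auto simp: Lp_loc_def)
    show "- (LINT t:I|lebesgue. deriv \<phi> t * (u t \<bullet> v)) = (LINT t:I|lebesgue. \<phi> t * g t v)"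
      if "\<phi> \<in> test_functions (interior I)" for \<phi>
      using der that v by (simp add: has_V_dual_derivative_def dist_eq_def dist_deriv_def regular_dist_def)
  qed
  then show ?thesis by (simp add: inner_diff_left)
qed

lemma grid_sum_eq:
  assumes u: "u \<in> Cloc_Hw K I" and g: "Lp_loc (4/3) (interior I) (V_dual K) (V_dual_norm K) g"
    and der: "has_V_dual_derivative u g" and m: "m \<in> grid_set"
  defines "a \<equiv> t0 + 1 / real (Suc m)" and "b \<equiv> c - 1 / real (Suc m)"
  shows "grid_sum u m n k =
    grid_power_sum (4/3) a b (Suc n) (\<lambda>i. max_abs (\<lambda>j. LINT t:cell a b (Suc n) i|lebesgue. g t (d j)) k)"
proof -
  have ab: "a \<le> b" "{a..b} \<subseteq> interior I" using grid_interval[OF m] by (auto simp: a_def b_def)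
  have "(u (grid a b (Suc n) (Suc i)) - u (grid a b (Suc n) i)) \<bullet> d j = (LINT t:cell a b (Suc n) i|lebesgue. g t (d j))"
    if "i < Suc n" for i j
    unfolding cell_def
  proof (rule increment_identity[OF u g der d_in(1)])
    show "grid a b (Suc n) i \<le> grid a b (Suc n) (Suc i)" by (rule grid_mono[OF ab(1)]) simp
    have "grid a b (Suc n) i \<in> {a..b}" "grid a b (Suc n) (Suc i) \<in> {a..b}"
      using that by (auto intro!: grid_in[OF ab(1)] simp del: atLeastAtMost_iff)
    then show "{grid a b (Suc n) i..grid a b (Suc n) (Suc i)} \<subseteq> interior I" using ab(2) by fastforce
  qed
  then show ?thesis
    unfolding grid_sum_def Let_def a_def[symmetric] b_def[symmetric] grid_power_sum_def
    by (intro sum.cong) simp_all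
qed

section \<open>Weak solutions satisfy the conditions\<close>

lemma f_bounded: "\<exists>F\<ge>0. AE t in lebesgue. t \<in> I \<longrightarrow> norm (f t) \<le> F"
proof -
  obtain C where C: "AE t in lebesgue. t \<in> I \<longrightarrow> norm (f t) \<le> C" using f by (auto simp: Linf_def)
  have "AE t in lebesgue. t \<in> I \<longrightarrow> norm (f t) \<le> max 0 C"
    using C by eventually_elim auto
  then show ?thesis by (intro exI[of _ "max 0 C"]) simp
qed

lemma work_bound:
  assumes F: "0 \<le> F" "AE t in lebesgue. t \<in> I \<longrightarrow> norm (f t) \<le> F"
    and R: "0 \<le> R" "AE r in lebesgue. r \<in> {s..t} \<longrightarrow> norm (u r) \<le> R"
    and st: "s \<le> t" "{s..t} \<subseteq> I"
  shows "\<bar>LINT r:{s..t}|lebesgue. f r \<bullet> u r\<bar> \<le> F * R * (t - s)"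
proof (rule set_integral_abs_bound[OF st(1)])
  show "0 \<le> F * R" using F R by simp
  show "AE r in lebesgue. r \<in> {s..t} \<longrightarrow> \<bar>f r \<bullet> u r\<bar> \<le> F * R"
    using F(2) R(2)
  proof eventually_elim
    case (elim r)
    show ?case
    proof
      assume r: "r \<in> {s..t}"
      then have "norm (f r) * norm (u r) \<le> F * R"
        using elim st(2) F(1) by (intro mult_mono) auto
      then show "\<bar>f r \<bullet> u r\<bar> \<le> F * R" using Cauchy_Schwarz_ineq2[of "f r" "u r"] by linarith
    qed
  qed
qed

lemma dissipation_nonneg: "0 \<le> (LINT s:S|lebesgue. (H1_norm K (u s))\<^sup>2)"
  unfolding set_lebesgue_integral_def by (intro integral_nonneg_AE AE_I2) simp

text \<open>The energy inequality is available for almost every starting time only, so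
  \<open>t0\<close> itself may be exceptional. Admissible times \<tau> n decreasing to
  \<open>t0\<close> are used instead, and strong continuity at \<open>t0\<close> makes the initial
  energies converge.\<close>

lemma weak_solution_initial_bound:
  assumes "u \<in> weak_solutions K \<nu> f I"
  shows "\<exists>M. \<forall>t\<in>{t0..c}. (norm (u t))\<^sup>2 \<le> (norm (u t0))\<^sup>2 + M * (t - t0)"
proof -
  have uC: "u \<in> Cloc_Hw K I" and ws: "weak_solution K \<nu> f I u" using assms by (auto simp: weak_solutions_def)
  note w = ws[unfolded weak_solution_iff[OF uC]]
  obtain F where F: "0 \<le> F" "AE t in lebesgue. t \<in> I \<longrightarrow> norm (f t) \<le> F" using f_bounded by blast
  have "Linf {t0..c} (H_space K) norm u" using w c(3) by (simp add: Linf_loc_def)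
  then obtain C where C: "AE t in lebesgue. t \<in> {t0..c} \<longrightarrow> norm (u t) \<le> C" by (auto simp: Linf_def)
  define R where "R = max 0 C"
  have R: "0 \<le> R" "AE t in lebesgue. t \<in> {t0..c} \<longrightarrow> norm (u t) \<le> R"
    using C by (auto simp: R_def elim!: eventually_mono)
  \<comment> \<open>F bounds the force and R bounds \<open>u\<close> almost everywhere; the factor 2
    comes from the halves in the energy inequality.\<close>
  have "(norm (u t))\<^sup>2 \<le> (norm (u t0))\<^sup>2 + 2 * F * R * (t - t0)" if t: "t \<in> {t0..c}" for t
  proof (cases "t = t0")
    case False
    then have lt: "t0 < t" "t \<le> c" using t by auto
    have tI: "t \<in> I" using t c(3) by blast
    have E: "energy_holds I u" using w by blast
    have "\<forall>n. \<exists>t'. t0 < t' \<and> t' < min t (t0 + 1 / real (Suc n)) \<and> (t' \<in> I \<longrightarrow> (\<forall>t\<in>I. t' < t \<longrightarrow> energy_inequality u t' t))"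
    proof
      fix n
      have "t0 < min t (t0 + 1 / real (Suc n))" using lt by simp
      with E[unfolded energy_holds_def]
      show "\<exists>t'. t0 < t' \<and> t' < min t (t0 + 1 / real (Suc n)) \<and> (t' \<in> I \<longrightarrow> (\<forall>t\<in>I. t' < t \<longrightarrow> energy_inequality u t' t))"
        by (rule AE_lebesgue_ex)
    qed
    from choice[OF this]
    obtain \<tau> where "\<forall>n. t0 < \<tau> n \<and> \<tau> n < min t (t0 + 1 / real (Suc n)) \<and> (\<tau> n \<in> I \<longrightarrow> (\<forall>t\<in>I. \<tau> n < t \<longrightarrow> energy_inequality u (\<tau> n) t))" ..
    then have \<tau>: "\<And>n. t0 < \<tau> n" "\<And>n. \<tau> n < min t (t0 + 1 / real (Suc n))"
      "\<And>n. \<tau> n \<in> I \<longrightarrow> (\<forall>t\<in>I. \<tau> n < t \<longrightarrow> energy_inequality u (\<tau> n) t)"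
      by simp_all
    have \<tau>I: "\<tau> n \<in> I" for n using \<tau>(1,2)[of n] lt c(3) by auto
    have \<tau>lim: "\<tau> \<longlonglongrightarrow> t0"
    proof (rule tendsto_sandwich)
      show "\<forall>\<^sub>F n in sequentially. t0 \<le> \<tau> n" using \<tau>(1) by (intro always_eventually) (simp add: less_imp_le)
      show "\<forall>\<^sub>F n in sequentially. \<tau> n \<le> t0 + 1 / real (Suc n)" using \<tau>(2) by (intro always_eventually) (simp add: less_imp_le)
      have "(\<lambda>n. t0 + 1 / real (Suc n)) \<longlonglongrightarrow> t0 + 0" by (intro tendsto_intros LIMSEQ_Suc[OF lim_1_over_n])
      then show "(\<lambda>n. t0 + 1 / real (Suc n)) \<longlonglongrightarrow> t0" by simp
    qed simp
    have "filterlim \<tau> (at t0 within I) sequentially"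
      unfolding filterlim_at using \<tau>lim \<tau>I \<tau>(1) by (auto intro!: always_eventually simp: less_imp_neq[symmetric])
    then have "(\<lambda>n. u (\<tau> n)) \<longlonglongrightarrow> u t0" using w by (blast intro: filterlim_compose)
    then have lim: "(\<lambda>n. (norm (u (\<tau> n)))\<^sup>2 + 2 * F * R * (t - \<tau> n)) \<longlonglongrightarrow> (norm (u t0))\<^sup>2 + 2 * F * R * (t - t0)"
      by (intro tendsto_intros \<tau>lim)
    have "(norm (u t))\<^sup>2 \<le> (norm (u (\<tau> n)))\<^sup>2 + 2 * F * R * (t - \<tau> n)" for n
    proof -
      have lt': "\<tau> n < t" using \<tau>(2)[of n] by simp
      have "AE r in lebesgue. r \<in> {\<tau> n..t} \<longrightarrow> norm (u r) \<le> R"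
        using R(2) by eventually_elim (use \<tau>(1)[of n] lt in auto)
      then have "\<bar>LINT r:{\<tau> n..t}|lebesgue. f r \<bullet> u r\<bar> \<le> F * R * (t - \<tau> n)"
        by (rule work_bound[OF F R(1) _ less_imp_le[OF lt'] interval_sub[OF \<tau>I tI]])
      moreover have "0 \<le> \<nu> * (LINT s:{\<tau> n..t}|lebesgue. (H1_norm K (u s))\<^sup>2)"
        by (intro mult_nonneg_nonneg dissipation_nonneg less_imp_le[OF \<nu>])
      moreover have "energy_inequality u (\<tau> n) t"
        using \<tau>(3)[of n] \<tau>I lt' tI by blast
      ultimately show ?thesis unfolding energy_inequality_def by linarith
    qed
    then show ?thesis using LIMSEQ_le_const[OF lim] by blast
  qed simp
  then show ?thesis by blast
qed

text \<open>Since the functionals d j lie in the unit ball, each increment is at most the integral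
  of the dual norm over its cell. Jensen's inequality then bounds every grid sum by one integral
  over all of \<open>{t0..c}\<close>, independent of m, n and k.\<close>

lemma weak_solution_grid_bound:
  assumes "u \<in> weak_solutions K \<nu> f I"
  shows "\<exists>M. \<forall>m\<in>grid_set. \<forall>n k. grid_sum u m n k \<le> M"
proof -
  have uC: "u \<in> Cloc_Hw K I" and ws: "weak_solution K \<nu> f I u" using assms by (auto simp: weak_solutions_def)
  obtain g where g: "Lp_loc (4/3) I (V_dual K) (V_dual_norm K) g" "has_V_dual_derivative u g"
    using ws[unfolded weak_solution_iff[OF uC]] by blast
  have g': "Lp_loc (4/3) (interior I) (V_dual K) (V_dual_norm K) g"
    using g(1) interior_subset by (rule Lp_loc_mono[rotated])
  define \<Gamma> where "\<Gamma> = dual_norm0 K g"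
  have \<Gamma>0: "0 \<le> \<Gamma> t" for t unfolding \<Gamma>_def by (rule dual_norm0_nonneg[OF K])
  have Lg: "Lp (4/3) {t0..c} (V_dual K) (V_dual_norm K) g" using g(1) c(3) by (simp add: Lp_loc_def)
  note i\<Gamma> = Lp_V_dual_apply(1)[OF K Lg, folded \<Gamma>_def]
  have "grid_sum u m n k \<le> (LINT t:{t0..c}|lebesgue. \<Gamma> t powr (4/3))" if m: "m \<in> grid_set" for m n k
  proof -
    define a b where "a = t0 + 1 / real (Suc m)" and "b = c - 1 / real (Suc m)"
    have ab: "a < b" "{a..b} \<subseteq> interior I" using grid_interval[OF m] by (auto simp: a_def b_def)
    have "0 < 1 / real (Suc m)" by simp
    then have tc: "t0 \<le> a" "b \<le> c" unfolding a_def b_def by linarith+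
    have sub: "{a..<b} \<subseteq> {t0..c}" using tc by auto
    have iab: "set_integrable lebesgue {a..<b} (\<lambda>t. \<Gamma> t powr (4/3))"
      by (rule set_integrable_subset[OF i\<Gamma>]) (use sub in auto)
    have i\<Gamma>1: "set_integrable lebesgue {a..<b} \<Gamma>" by (rule set_integrable_of_powr[OF \<Gamma>0 _ iab]) simp
    have "grid_sum u m n k \<le> (LINT t:{a..<b}|lebesgue. \<Gamma> t powr (4/3))"
      unfolding grid_sum_eq[OF uC g' g(2) m, folded a_def b_def]
    proof (rule grid_power_sum_le_integral[OF ab(1) _ _ \<Gamma>0 iab])
      fix i assume i: "i < Suc n"
      show "max_abs (\<lambda>j. LINT t:cell a b (Suc n) i|lebesgue. g t (d j)) k \<le> (LINT t:cell a b (Suc n) i|lebesgue. \<Gamma> t)"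
      proof (rule max_abs_le)
        fix j
        have csub: "cell a b (Suc n) i \<subseteq> {a..<b}" by (rule cell_sub[OF less_imp_le[OF ab(1)] i])
        have "\<bar>LINT t:cell a b (Suc n) i|lebesgue. g t (d j)\<bar> \<le>
            (LINT t|lebesgue. \<bar>indicator (cell a b (Suc n) i) t *\<^sub>R g t (d j)\<bar>)"
          unfolding set_lebesgue_integral_def by (rule integral_abs_bound)
        also have "\<dots> \<le> (LINT t|lebesgue. indicator (cell a b (Suc n) i) t *\<^sub>R \<Gamma> t)"
        proof (rule integral_mono_AE)
          have "set_integrable lebesgue (cell a b (Suc n) i) (\<lambda>t. g t (d j))"
            by (rule set_integrable_subset[OF Lp_V_dual_apply(3)[OF K Lg _ d_in(1)]])
              (use csub sub in \<open>auto simp: cell_def\<close>)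
          then show "integrable lebesgue (\<lambda>t. \<bar>indicator (cell a b (Suc n) i) t *\<^sub>R g t (d j)\<bar>)"
            unfolding set_integrable_def by (rule integrable_abs)
          have "set_integrable lebesgue (cell a b (Suc n) i) \<Gamma>"
            by (rule set_integrable_subset[OF i\<Gamma>1 _ csub]) (simp add: cell_def)
          then show "integrable lebesgue (\<lambda>t. indicator (cell a b (Suc n) i) t *\<^sub>R \<Gamma> t)"
            by (simp add: set_integrable_def)
          have "AE t in lebesgue. t \<in> {t0..c} \<longrightarrow> g t \<in> V_dual K"
            by (rule Lp_V_dual_apply(2)[OF K Lg]) simp
          then show "AE t in lebesgue. \<bar>indicator (cell a b (Suc n) i) t *\<^sub>R g t (d j)\<bar> \<le> indicator (cell a b (Suc n) i) t *\<^sub>R \<Gamma> t"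
          proof eventually_elim
            case (elim t)
            show ?case
            proof (cases "t \<in> cell a b (Suc n) i")
              case True
              then have gt: "g t \<in> V_dual K" using elim csub sub by blast
              have "\<bar>g t (d j)\<bar> \<le> V_dual_norm K (g t) * H1_norm K (d j)" by (rule V_dual_bound[OF K gt d_in(1)])
              also have "\<dots> \<le> V_dual_norm K (g t) * 1"
                by (intro mult_left_mono d_in V_dual_norm_nonneg[OF K gt])
              finally show ?thesis using True gt by (simp add: \<Gamma>_def dual_norm0_def[OF K])
            qed simp
          qed
        qed
        finally show "\<bar>LINT t:cell a b (Suc n) i|lebesgue. g t (d j)\<bar> \<le> (LINT t:cell a b (Suc n) i|lebesgue. \<Gamma> t)"
          by (simp only: set_lebesgue_integral_def)
      qed
    qed (auto simp: max_abs_nonneg)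
    also have "\<dots> \<le> (LINT t:{t0..c}|lebesgue. \<Gamma> t powr (4/3))"
      unfolding set_lebesgue_integral_def
      by (rule integral_mono[OF iab[unfolded set_integrable_def] i\<Gamma>[unfolded set_integrable_def]])
        (use sub in \<open>auto simp: indicator_def\<close>)
    finally show ?thesis .
  qed
  then show ?thesis by blast
qed

lemma weak_solution_good:
  assumes "u \<in> weak_solutions K \<nu> f I"
  shows "\<exists>M. good M u"
proof -
  obtain M1 where M1: "\<And>t. t \<in> {t0..c} \<Longrightarrow> (norm (u t))\<^sup>2 \<le> (norm (u t0))\<^sup>2 + M1 * (t - t0)"
    using weak_solution_initial_bound[OF assms] by blast
  obtain M2 where M2: "\<And>m n k. m \<in> grid_set \<Longrightarrow> grid_sum u m n k \<le> M2"
    using weak_solution_grid_bound[OF assms] by blast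
  obtain M where M: "max M1 M2 \<le> real M" using real_arch_simple by blast
  have "(norm (u t))\<^sup>2 \<le> (norm (u t0))\<^sup>2 + real M * (t - t0)" if "t \<in> times" for t
  proof -
    have t: "t \<in> {t0..c}" using that c(2) by (auto simp: times_def)
    then have "M1 * (t - t0) \<le> real M * (t - t0)" using M by (intro mult_right_mono) auto
    then show ?thesis using M1[OF t] by linarith
  qed
  moreover have "grid_sum u m n k \<le> real M" if "m \<in> grid_set" for m n k using M2[OF that, of n k] M by linarith
  ultimately show ?thesis unfolding good_def by blast
qed

section \<open>The conditions imply a weak solution up to the initial time\<close>

lemma times_approx:
  assumes t: "t \<in> {t0..c}"
  shows "\<exists>q. (\<forall>n. q n \<in> times) \<and> q \<longlonglongrightarrow> t"
proof (cases "t = t0 \<or> t = c")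
  case True
  then show ?thesis by (intro exI[of _ "\<lambda>_. t"]) (auto simp: times_def)
next
  case False
  then have lt: "t0 < t" "t < c" using t by auto
  have "\<exists>r\<in>\<rat>. t < r \<and> r < min c (t + 1 / real (Suc n))" for n
    by (rule Rats_dense_in_real) (use lt in simp)
  then obtain q where q: "\<And>n. q n \<in> \<rat>" "\<And>n. t < q n" "\<And>n. q n < min c (t + 1 / real (Suc n))" by metis
  have "q \<longlonglongrightarrow> t"
  proof (rule tendsto_sandwich)
    show "\<forall>\<^sub>F n in sequentially. t \<le> q n" using q(2) by (intro always_eventually) (simp add: less_imp_le)
    show "\<forall>\<^sub>F n in sequentially. q n \<le> t + 1 / real (Suc n)" using q(3) by (intro always_eventually) (simp add: less_imp_le)
    have "(\<lambda>n. t + 1 / real (Suc n)) \<longlonglongrightarrow> t + 0" by (intro tendsto_intros LIMSEQ_Suc[OF lim_1_over_n])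
    then show "(\<lambda>n. t + 1 / real (Suc n)) \<longlonglongrightarrow> t" by simp
  qed simp
  moreover have "q n \<in> times" for n using q(1)[of n] q(2)[of n] q(3)[of n] lt by (auto simp: times_def)
  ultimately show ?thesis by blast
qed

text \<open>Weak lower semicontinuity of the norm along a sequence of times:
  \<open>u (s n) \<bullet> u t\<close> is at most half of b n + |u(t)|^2, and in the limit |u(t)|^2
  \<le> (B + |u(t)|^2) / 2.\<close>

lemma norm_le_weak_limit:
  assumes uC: "u \<in> Cloc_Hw K I" and s: "\<And>n. s n \<in> I" "s \<longlonglongrightarrow> t" "t \<in> I"
    and b: "\<And>n. (norm (u (s n)))\<^sup>2 \<le> b n" "b \<longlonglongrightarrow> B"
  shows "(norm (u t))\<^sup>2 \<le> B"
proof -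
  have "continuous_on I (\<lambda>r. u r \<bullet> u t)" using uC Cloc_Hw_in_H[OF K uC s(3)] by (simp add: Cloc_Hw_def)
  then have "(\<lambda>n. u (s n) \<bullet> u t) \<longlonglongrightarrow> u t \<bullet> u t"
    by (rule continuous_on_tendsto_compose[OF _ s(2,3)]) (use s(1) in simp)
  moreover have "(\<lambda>n. (b n + (norm (u t))\<^sup>2) / 2) \<longlonglongrightarrow> (B + (norm (u t))\<^sup>2) / 2" by (intro tendsto_intros b) simp
  moreover have "u (s n) \<bullet> u t \<le> (b n + (norm (u t))\<^sup>2) / 2" for n
  proof -
    have "2 * (u (s n) \<bullet> u t) \<le> 2 * (norm (u (s n)) * norm (u t))"
      by (intro mult_left_mono norm_cauchy_schwarz) simp
    also have "\<dots> \<le> (norm (u (s n)))\<^sup>2 + (norm (u t))\<^sup>2"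
      using sum_squares_bound[of "norm (u (s n))" "norm (u t)"] by simp
    also have "\<dots> \<le> b n + (norm (u t))\<^sup>2" using b(1) by simp
    finally show ?thesis by simp
  qed
  ultimately have "u t \<bullet> u t \<le> (B + (norm (u t))\<^sup>2) / 2" by (intro LIMSEQ_le) auto
  then show ?thesis by (simp add: power2_norm_eq_inner)
qed

text \<open>The bound is imposed at the countable set \<open>times\<close>; lower semicontinuity
  along approximating times extends it to all of \<open>{t0..c}\<close>.\<close>

lemma good_bound:
  assumes uC: "u \<in> Cloc_Hw K I" and good: "good M u" and t: "t \<in> {t0..c}"
  shows "(norm (u t))\<^sup>2 \<le> (norm (u t0))\<^sup>2 + real M * (t - t0)"
proof -
  obtain q where q: "\<And>n. q n \<in> times" "q \<longlonglongrightarrow> t" using times_approx[OF t] by blast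
  have "q n \<in> I" for n using q(1)[of n] c(1,3) I(2) by (auto simp: times_def)
  then show ?thesis
    using good q t c(3)
    by (intro norm_le_weak_limit[OF uC _ q(2), where b = "\<lambda>n. (norm (u t0))\<^sup>2 + real M * (q n - t0)"] tendsto_intros)
      (auto simp: good_def)
qed

text \<open>Weak convergence together with an upper bound on the limiting norms gives strong
  convergence: expanding the square, |u(r) - u(t0)|^2 is at most 2 |u(t0)|^2 + M (r - t0) - 2
  u(r).u(t0), which tends to zero.\<close>

lemma good_imp_continuous_at_start:
  assumes uC: "u \<in> Cloc_Hw K I" and good: "good M u"
  shows "(u \<longlongrightarrow> u t0) (at t0 within I)"
proof -
  have "continuous_on I (\<lambda>r. u r \<bullet> u t0)" using uC Cloc_Hw_in_H[OF K uC I(2)] by (simp add: Cloc_Hw_def)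
  then have lim: "((\<lambda>r. u r \<bullet> u t0) \<longlongrightarrow> u t0 \<bullet> u t0) (at t0 within I)" using I(2) by (simp add: continuous_on_def)
  have "((\<lambda>r. 2 * (norm (u t0))\<^sup>2 + real M * (r - t0) - 2 * (u r \<bullet> u t0)) \<longlongrightarrow>
      2 * (norm (u t0))\<^sup>2 + real M * (t0 - t0) - 2 * (u t0 \<bullet> u t0)) (at t0 within I)"
    by (intro tendsto_intros lim)
  then have lim0: "((\<lambda>r. 2 * (norm (u t0))\<^sup>2 + real M * (r - t0) - 2 * (u r \<bullet> u t0)) \<longlongrightarrow> 0) (at t0 within I)"
    by (simp add: power2_norm_eq_inner)
  have ev: "\<forall>\<^sub>F r in at t0 within I. r \<in> {t0..c}"
  proof (cases "t0 < c")
    case True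
    have "\<forall>\<^sub>F r in at t0 within I. r < c"
      using order_tendstoD(2)[OF tendsto_ident_at True] .
    moreover have "\<forall>\<^sub>F r in at t0 within I. r \<in> I" by (simp add: eventually_at_filter)
    ultimately show ?thesis by eventually_elim (use I(3) in auto)
  next
    \<comment> \<open>With c = \<open>t0\<close> the interval is a single point, and the punctured
      neighbourhood filter is trivial.\<close>
    case False
    then have "c = t0" using c(2) by simp
    have "b = t0" if "b \<in> I" for b
    proof (rule ccontr)
      assume "b \<noteq> t0"
      then have "c < b" using I(3)[OF that] \<open>c = t0\<close> by simp
      then have "{c..b} \<subseteq> interior I" by (rule c(5)[OF that])
      moreover have "t0 \<in> {c..b}" using \<open>c < b\<close> \<open>c = t0\<close> by simp
      ultimately show False using t0_notin_interior by blast
    qed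
    then have "I = {t0}" using I(2) by blast
    then show ?thesis by (simp add: eventually_at_filter)
  qed
  have "((\<lambda>r. (norm (u r - u t0))\<^sup>2) \<longlongrightarrow> 0) (at t0 within I)"
  proof (rule Lim_null_comparison[OF _ lim0])
    show "\<forall>\<^sub>F r in at t0 within I. norm ((norm (u r - u t0))\<^sup>2) \<le>
        2 * (norm (u t0))\<^sup>2 + real M * (r - t0) - 2 * (u r \<bullet> u t0)"
      using ev
    proof eventually_elim
      case (elim r)
      have "(norm (u r - u t0))\<^sup>2 = (norm (u r))\<^sup>2 - 2 * (u r \<bullet> u t0) + (norm (u t0))\<^sup>2"
        by (simp add: power2_norm_eq_inner inner_diff_left inner_diff_right inner_commute)
      moreover have "norm ((norm (u r - u t0))\<^sup>2) = (norm (u r - u t0))\<^sup>2" by simp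
      ultimately show ?case using good_bound[OF uC good elim] by linarith
    qed
  qed
  then have "((\<lambda>r. sqrt ((norm (u r - u t0))\<^sup>2)) \<longlongrightarrow> sqrt 0) (at t0 within I)" by (rule tendsto_real_sqrt)
  then have "((\<lambda>r. norm (u r - u t0)) \<longlongrightarrow> 0) (at t0 within I)" by simp
  then show ?thesis by (rule LIM_zero_cancel[OF tendsto_norm_zero_cancel])
qed

definition radius :: "nat \<Rightarrow> (real \<Rightarrow> l2vec) \<Rightarrow> real" where
  "radius M u = sqrt ((norm (u t0))\<^sup>2 + real M * (c - t0))"

lemma good_radius:
  assumes uC: "u \<in> Cloc_Hw K I" and good: "good M u" and t: "t \<in> {t0..c}"
  shows "norm (u t) \<le> radius M u"
  unfolding radius_def
proof (rule real_le_rsqrt)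
  have "real M * (t - t0) \<le> real M * (c - t0)" using t by (intro mult_left_mono) auto
  then show "(norm (u t))\<^sup>2 \<le> (norm (u t0))\<^sup>2 + real M * (c - t0)" using good_bound[OF uC good t] by linarith
qed

lemma radius_nonneg: "0 \<le> radius M u"
  unfolding radius_def using c(2) by simp

lemma good_Linf_loc:
  assumes u: "u \<in> interior_weak_solutions K \<nu> f I" and uC: "u \<in> Cloc_Hw K I" and good: "good M u"
  shows "Linf_loc I (H_space K) norm u"
  unfolding Linf_loc_def
proof (intro allI impI)
  fix a b assume ab: "{a..b} \<subseteq> I"
  have loc: "Linf_loc (interior I) (H_space K) norm u" using u unfolding interior_weak_solution_iff[OF uC] by blast
  have loc': "Linf {c'..d'} (H_space K) norm u" if "a < c'" "d' < b" for c' d'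
  proof -
    have "{a<..<b} \<subseteq> interior I" using ab by (intro interior_maximal) auto
    then have "{c'..d'} \<subseteq> interior I" using that by auto
    then show ?thesis using loc by (simp add: Linf_loc_def)
  qed
  show "Linf {a..b} (H_space K) norm u"
    unfolding Linf_def
  proof (intro conjI)
    show "AE t in lebesgue. t \<in> {a..b} \<longrightarrow> u t \<in> H_space K"
      using Cloc_Hw_in_H[OF K uC] ab by (intro AE_I2) blast
    show "strongly_measurable {a..b} (H_space K) norm u"
      by (rule strongly_measurable_exhaust[OF zero_in_H_space[OF K]]) (use loc' in \<open>auto simp: Linf_def\<close>)
    \<comment> \<open>If b lies beyond c, this part is interior. Otherwise it is empty or consists
      of c alone, and the norm at c serves as the bound.\<close>
    obtain C where C: "AE t in lebesgue. t \<in> {max a c..b} \<longrightarrow> norm (u t) \<le> C"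
    proof (cases "a \<le> b \<and> c < b")
      case True
      then have "b \<in> I" using ab by auto
      then have "{c..b} \<subseteq> interior I" using c(5) True by blast
      moreover have "{max a c..b} \<subseteq> {c..b}" by auto
      ultimately have "{max a c..b} \<subseteq> interior I" by blast
      then have "Linf {max a c..b} (H_space K) norm u" using loc by (simp only: Linf_loc_def)
      then show ?thesis using that by (auto simp: Linf_def)
    next
      case False
      have "AE t in lebesgue. t \<in> {max a c..b} \<longrightarrow> norm (u t) \<le> norm (u c)"
      proof (intro AE_I2 impI)
        fix t assume "t \<in> {max a c..b}"
        then have "t = c" using False by auto
        then show "norm (u t) \<le> norm (u c)" by simp
      qed
      then show ?thesis using that by blast
    qed
    have "AE t in lebesgue. t \<in> {a..b} \<longrightarrow> norm (u t) \<le> max C (radius M u)"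
      using C
    proof eventually_elim
      case (elim t)
      show ?case
      proof
        assume t: "t \<in> {a..b}"
        then have "t0 \<le> t" using ab I(3) by blast
        then show "norm (u t) \<le> max C (radius M u)"
          using elim t good_radius[OF uC good, of t] by (cases "t \<le> c") auto
      qed
    qed
    then show "\<exists>C. AE t in lebesgue. t \<in> {a..b} \<longrightarrow> norm (u t) \<le> C" by blast
  qed
qed

text \<open>The dissipation bound follows from the interior energy inequality: an admissible
  starting time between \<open>t0\<close> and a bounds the dissipation on \<open>{a..b}\<close> by a
  constant independent of a and b, and exhaustion extends it to \<open>{t0..c}\<close>.\<close>

lemma good_Lp_loc_V:
  assumes u: "u \<in> interior_weak_solutions K \<nu> f I" and uC: "u \<in> Cloc_Hw K I" and good: "good M u"
  shows "Lp_loc 2 I (V_space K) (H1_norm K) u"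
proof -
  note w = u[unfolded interior_weak_solution_iff[OF uC]]
  have loc: "Lp_loc 2 (interior I) (V_space K) (H1_norm K) u" using w by blast
  have E: "energy_holds (interior I) u" using w by blast
  have pw: "H1_norm K x powr 2 = (H1_norm K x)\<^sup>2" for x using H1_norm_nonneg[of K x] by simp
  have si: "set_integrable lebesgue {a..b} (\<lambda>t. (H1_norm K (u t))\<^sup>2)" if "{a..b} \<subseteq> interior I" for a b
    using loc that by (simp add: Lp_loc_def Lp_def pw)
  obtain F where F: "0 \<le> F" "AE t in lebesgue. t \<in> I \<longrightarrow> norm (f t) \<le> F" using f_bounded by blast
  define R where "R = radius M u"
  \<comment> \<open>The initial energy is at most R^2 / 2 and the work at most F R (c - t0);
    division by \<nu> leaves the dissipation.\<close>
  define B where "B = (R\<^sup>2 / 2 + F * R * (c - t0)) / \<nu>"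
  have R0: "0 \<le> R" by (simp add: R_def radius_nonneg)
  have B0: "0 \<le> B" unfolding B_def using F(1) R0 c(2) \<nu> by (intro divide_nonneg_pos add_nonneg_nonneg mult_nonneg_nonneg) auto
  have RA: "AE t in lebesgue. t \<in> {x..y} \<longrightarrow> norm (u t) \<le> R" if "{x..y} \<subseteq> {t0..c}" for x y
    using good_radius[OF uC good] that unfolding R_def by (intro AE_I2) blast
  have bound: "(LINT t:{a..b}|lebesgue. (H1_norm K (u t))\<^sup>2) \<le> B" if ab: "t0 < a" "b < c" for a b
  proof (cases "a \<le> b")
    case True
    have "\<exists>t'. t0 < t' \<and> t' < a \<and> (t' \<in> interior I \<longrightarrow> (\<forall>t\<in>interior I. t' < t \<longrightarrow> energy_inequality u t' t))"
      by (rule AE_lebesgue_ex[OF E[unfolded energy_holds_def] ab(1)])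
    then obtain t' where t': "t0 < t'" "t' < a" "t' \<in> interior I \<longrightarrow> (\<forall>t\<in>interior I. t' < t \<longrightarrow> energy_inequality u t' t)" by blast
    have in_int: "t' \<in> interior I" "b \<in> interior I" using t' ab True c(4) by auto
    have sub: "{t'..b} \<subseteq> interior I" by (rule interior_interval[OF in_int])
    have lt: "t' < b" using t' True by simp
    have e: "energy_inequality u t' b" using t'(3) in_int lt by blast
    have "\<bar>LINT r:{t'..b}|lebesgue. f r \<bullet> u r\<bar> \<le> F * R * (b - t')"
      by (rule work_bound[OF F R0 RA less_imp_le[OF lt]]) (use t' ab sub interior_subset[of I] in auto)
    also have "\<dots> \<le> F * R * (c - t0)" using F(1) R0 t' ab by (intro mult_left_mono) auto
    finally have p: "(LINT s:{t'..b}|lebesgue. f s \<bullet> u s) \<le> F * R * (c - t0)" by linarith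
    have "norm (u t') \<le> R" using good_radius[OF uC good] t' ab True unfolding R_def by auto
    then have "(norm (u t'))\<^sup>2 \<le> R\<^sup>2" by (intro power_mono) auto
    then have "\<nu> * (LINT s:{t'..b}|lebesgue. (H1_norm K (u s))\<^sup>2) \<le> R\<^sup>2 / 2 + F * R * (c - t0)"
      using e p zero_le_power2[of "norm (u b)"] unfolding energy_inequality_def by linarith
    then have "(LINT s:{t'..b}|lebesgue. (H1_norm K (u s))\<^sup>2) \<le> B"
      unfolding B_def using \<nu> by (simp add: pos_le_divide_eq mult.commute)
    moreover have "(LINT t:{a..b}|lebesgue. (H1_norm K (u t))\<^sup>2) \<le> (LINT s:{t'..b}|lebesgue. (H1_norm K (u s))\<^sup>2)"
      unfolding set_lebesgue_integral_def
    proof (rule integral_mono)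
      have "{a..b} \<subseteq> interior I" using sub t' by auto
      then show "integrable lebesgue (\<lambda>t. indicator {a..b} t *\<^sub>R (H1_norm K (u t))\<^sup>2)"
        using si by (simp add: set_integrable_def)
      show "integrable lebesgue (\<lambda>t. indicator {t'..b} t *\<^sub>R (H1_norm K (u t))\<^sup>2)"
        using si[OF sub] by (simp add: set_integrable_def)
      show "indicator {a..b} t *\<^sub>R (H1_norm K (u t))\<^sup>2 \<le> indicator {t'..b} t *\<^sub>R (H1_norm K (u t))\<^sup>2" for t
        using t' by (auto simp: indicator_def)
    qed
    ultimately show ?thesis by linarith
  next
    case False
    then have "{a..b} = {}" by simp
    then show ?thesis using B0 by (simp add: set_lebesgue_integral_def)
  qed
  have "set_integrable lebesgue {t0..c} (\<lambda>t. (H1_norm K (u t))\<^sup>2)"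
  proof (rule set_integrable_exhaust)
    show "set_integrable lebesgue {x..y} (\<lambda>t. (H1_norm K (u t))\<^sup>2)" if "t0 < x" "y < c" for x y
      using that c(4) by (intro si) auto
    show "(LINT t:inner_interval t0 c n|lebesgue. (H1_norm K (u t))\<^sup>2) \<le> B" for n
      unfolding inner_interval_def by (rule bound) simp_all
  qed simp
  then have int: "set_integrable lebesgue {t0..c} (\<lambda>t. H1_norm K (u t) powr 2)" by (simp only: pw)
  show ?thesis
    by (rule Lp_loc_extend[OF zero_in_V[OF K] loc I(1) c(3) _ _ int]) (fact c(5), fact I(3))
qed

text \<open>The derivative g given on the interior is kept. The bounds on the grid sums yield the
  same bound M for the integral over each inner interval, uniformly in m, and exhaustion gives
  integrability up to the ends.\<close>

lemma good_Lp_loc_derivative: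
  assumes u: "u \<in> interior_weak_solutions K \<nu> f I" and uC: "u \<in> Cloc_Hw K I" and good: "good M u"
  shows "\<exists>g. Lp_loc (4/3) I (V_dual K) (V_dual_norm K) g \<and> has_V_dual_derivative u g"
proof -
  obtain g where g: "Lp_loc (4/3) (interior I) (V_dual K) (V_dual_norm K) g" "has_V_dual_derivative u g"
    using u[unfolded interior_weak_solution_iff[OF uC]] by blast
  define \<Gamma> where "\<Gamma> = dual_norm0 K g"
  have Lg: "Lp (4/3) {x..y} (V_dual K) (V_dual_norm K) g" if "{x..y} \<subseteq> interior I" for x y
    using g(1) that by (simp add: Lp_loc_def)
  have i\<Gamma>: "set_integrable lebesgue {t0..c} (\<lambda>t. \<Gamma> t powr (4/3))"
  proof (rule set_integrable_exhaust)
    show "set_integrable lebesgue {x..y} (\<lambda>t. \<Gamma> t powr (4/3))" if "t0 < x" "y < c" for x y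
      unfolding \<Gamma>_def
      using that c(4) by (intro Lp_V_dual_apply(1)[OF K Lg]) auto
    show "(LINT t:inner_interval t0 c m|lebesgue. \<Gamma> t powr (4/3)) \<le> real M" for m
    proof (cases "m \<in> grid_set")
      case True
      define a b where "a = t0 + 1 / real (Suc m)" and "b = c - 1 / real (Suc m)"
      have ab: "a < b" "{a..b} \<subseteq> interior I" using grid_interval[OF True] by (auto simp: a_def b_def)
      have "(LINT t:{a..<b}|lebesgue. \<Gamma> t powr (4/3)) \<le> real M"
      proof (rule integral_powr_le_of_grid_power_sums[OF ab(1)])
        show "set_integrable lebesgue {a..<b} (\<lambda>t. g t (d j))" for j
          by (rule set_integrable_lebesgue_Icc_Ico(2)[OF Lp_V_dual_apply(3)[OF K Lg[OF ab(2)] _ d_in(1)]]) simp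
        show "grid_power_sum (4/3) a b (Suc n) (\<lambda>i. max_abs (\<lambda>j. LINT t:cell a b (Suc n) i|lebesgue. g t (d j)) k) \<le> real M" for n k
          using good True unfolding grid_sum_eq[OF uC g True, folded a_def b_def, symmetric] good_def by blast
        have "AE t in lebesgue. t \<in> {a..b} \<longrightarrow> g t \<in> V_dual K"
          by (rule Lp_V_dual_apply(2)[OF K Lg[OF ab(2)]]) simp
        then show "AE t in lebesgue. t \<in> {a..<b} \<longrightarrow> (\<lambda>k. max_abs (\<lambda>j. g t (d j)) k) \<longlonglongrightarrow> \<Gamma> t"
        proof eventually_elim
          case (elim t)
          show ?case
          proof
            assume "t \<in> {a..<b}"
            then have gt: "g t \<in> V_dual K" using elim by auto
            have "\<Gamma> t = V_dual_norm K (g t)" using gt by (simp add: \<Gamma>_def dual_norm0_def[OF K])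
            then show "(\<lambda>k. max_abs (\<lambda>j. g t (d j)) k) \<longlonglongrightarrow> \<Gamma> t"
              using max_abs_tendsto_V_dual_norm[OF K d gt] by simp
          qed
        qed
      qed simp
      then show ?thesis
        unfolding inner_interval_def a_def[symmetric] b_def[symmetric]
        by (simp only: set_integrable_lebesgue_Icc_Ico(1))
    next
      \<comment> \<open>Here the inner interval has at most one point, so its integral is
        zero.\<close>
      case False
      then have le: "c - 1 / real (Suc m) \<le> t0 + 1 / real (Suc m)" by (simp add: grid_set_def)
      have "(LINT t:inner_interval t0 c m|lebesgue. \<Gamma> t powr (4/3)) = 0"
      proof -
        have "{t0 + 1 / real (Suc m)..<c - 1 / real (Suc m)} = {}" using le by (simp only: atLeastLessThan_empty)
        then show ?thesis
          unfolding inner_interval_def set_integrable_lebesgue_Icc_Ico(1) by (simp add: set_lebesgue_integral_def)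
      qed
      then show ?thesis by simp
    qed
  qed simp
  have ae: "AE t in lebesgue. t \<in> {t0..c} \<longrightarrow> g t \<in> V_dual K"
  proof (rule AE_Icc_exhaust)
    show "AE t in lebesgue. t \<in> {x..y} \<longrightarrow> g t \<in> V_dual K" if "t0 < x" "y < c" for x y
      using that c(4) by (intro Lp_V_dual_apply(2)[OF K Lg]) auto
  qed
  have eq: "AE t in lebesgue. indicator {t0..c} t *\<^sub>R (\<Gamma> t powr (4/3)) = indicator {t0..c} t *\<^sub>R (V_dual_norm K (g t) powr (4/3))"
    using ae by eventually_elim (auto simp: indicator_def \<Gamma>_def dual_norm0_def[OF K])
  note i = i\<Gamma>[unfolded set_integrable_def]
  have int: "set_integrable lebesgue {t0..c} (\<lambda>t. V_dual_norm K (g t) powr (4/3))"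
    unfolding set_integrable_def
    by (rule integrable_cong_AE_imp[OF i borel_measurable_lebesgue_AE[OF borel_measurable_integrable[OF i] eq] eq])

  have "Lp_loc (4/3) I (V_dual K) (V_dual_norm K) g"
    by (rule Lp_loc_extend[where nrm = "V_dual_norm K" and w = g, OF zero_in_V_dual[OF K] g(1) I(1) c(3) _ _ int])
      (fact c(5), fact I(3))
  then show ?thesis using g(2) by blast
qed

text \<open>What the interior does not give is the inequality at a final time t that is the right
  end point of \<open>I\<close>. It is reached through interior times increasing to t: the integrals
  converge because both integrands are integrable up to t, and the final energy can only decrease in
  the weak limit.\<close>

lemma good_energy:
  assumes u: "u \<in> interior_weak_solutions K \<nu> f I" and uC: "u \<in> Cloc_Hw K I" and good: "good M u"
  shows "energy_holds I u"
proof -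
  have E: "energy_holds (interior I) u" using u unfolding interior_weak_solution_iff[OF uC] by blast
  have LV: "Lp_loc 2 I (V_space K) (H1_norm K) u" by (rule good_Lp_loc_V[OF assms])
  have LH: "Linf_loc I (H_space K) norm u" by (rule good_Linf_loc[OF assms])
  have pw: "H1_norm K x powr 2 = (H1_norm K x)\<^sup>2" for x using H1_norm_nonneg[of K x] by simp
  obtain F where F: "0 \<le> F" "AE t in lebesgue. t \<in> I \<longrightarrow> norm (f t) \<le> F" using f_bounded by blast
  have Im: "I \<in> sets lebesgue" using real_interval_borel_measurable[OF I(1)] by simp
  have limit: "energy_inequality u t' t"
    if t': "t' \<in> interior I" and t: "t \<in> I" "t' < t"
      and en: "\<And>s. s \<in> interior I \<Longrightarrow> t' < s \<Longrightarrow> energy_inequality u t' s" for t t'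
  proof -
    have t'I: "t' \<in> I" using t' interior_subset by blast
    have sub: "{t'..t} \<subseteq> I" by (rule interval_sub[OF t'I t(1)])
    have io: "{t'<..<t} \<subseteq> interior I" using sub by (intro interior_maximal) auto
    have ih: "set_integrable lebesgue {t'..t} (\<lambda>s. (H1_norm K (u s))\<^sup>2)"
      using LV sub by (simp add: Lp_loc_def Lp_def pw)
    have LH': "Linf {t'..t} (H_space K) norm u" using LH sub by (simp add: Linf_loc_def)
    then obtain C where C: "AE s in lebesgue. s \<in> {t'..t} \<longrightarrow> norm (u s) \<le> C" by (auto simp: Linf_def)
    have ip: "set_integrable lebesgue {t'..t} (\<lambda>s. f s \<bullet> u s)"
      unfolding set_integrable_def
    proof (rule Bochner_Integration.integrable_bound)
      show "integrable lebesgue (\<lambda>s. indicator {t'..t} s *\<^sub>R (F * C))"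
        using set_integrable_lebesgue_Icc_Ico(3)[OF set_integral_const_Ico(1)[of t' t "F * C"]] by (simp add: set_integrable_def)
      have "(\<lambda>s. indicator {t'..t} s * (f s \<bullet> u s)) \<in> borel_measurable lebesgue"
        by (rule strongly_measurable_inner_borel[of I "H_space K" f _ "H_space K"])
          (use f LH' Im sub in \<open>auto simp: Linf_def\<close>)
      then show "(\<lambda>s. indicator {t'..t} s *\<^sub>R (f s \<bullet> u s)) \<in> borel_measurable lebesgue" by simp
      show "AE s in lebesgue. norm (indicator {t'..t} s *\<^sub>R (f s \<bullet> u s)) \<le> norm (indicator {t'..t} s *\<^sub>R (F * C))"
        using C F(2)
      proof eventually_elim
        case (elim s)
        show ?case
        proof (cases "s \<in> {t'..t}")
          case True
          then have "norm (f s) * norm (u s) \<le> F * C"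
            using elim sub F(1) by (intro mult_mono) auto
          then have "\<bar>f s \<bullet> u s\<bar> \<le> \<bar>F * C\<bar>" using Cauchy_Schwarz_ineq2[of "f s" "u s"] by linarith
          then show ?thesis using True by simp
        qed simp
      qed
    qed
    \<comment> \<open>The denominator n + 2 keeps even the first time strictly to the right of
      t'.\<close>
    define \<sigma> where "\<sigma> n = t - (t - t') / real (Suc (Suc n))" for n
    have \<sigma>: "t' < \<sigma> n" "\<sigma> n < t" for n
    proof -
      define e where "e = (t - t') / real (Suc (Suc n))"
      have "0 < e" using t(2) by (simp add: e_def)
      moreover have "e < (t - t') / 1"
        unfolding e_def using t(2) by (intro divide_strict_left_mono) auto
      ultimately show "t' < \<sigma> n" "\<sigma> n < t" unfolding \<sigma>_def e_def[symmetric] by simp_all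
    qed
    have \<sigma>i: "\<sigma> n \<in> interior I" for n using \<sigma>[of n] io by auto
    have \<sigma>lim: "\<sigma> \<longlonglongrightarrow> t" unfolding \<sigma>_def by real_asymp
    have conv: "(\<lambda>n. LINT s:{t'..\<sigma> n}|lebesgue. p s) \<longlonglongrightarrow> (LINT s:{t'..t}|lebesgue. p s)"
      if p: "set_integrable lebesgue {t'..t} p" for p :: "real \<Rightarrow> real"
      unfolding set_lebesgue_integral_def
    proof (rule integral_dominated_convergence)
      show "integrable lebesgue (\<lambda>s. norm (indicator {t'..t} s *\<^sub>R p s))"
        using p unfolding set_integrable_def by (rule integrable_norm)
      show "(\<lambda>s. indicator {t'..t} s *\<^sub>R p s) \<in> borel_measurable lebesgue"
        using p unfolding set_integrable_def by (rule borel_measurable_integrable)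
      have "set_integrable lebesgue {t'..\<sigma> n} p" for n
        by (rule set_integrable_subset[OF p]) (use \<sigma>[of n] in auto)
      then show "(\<lambda>s. indicator {t'..\<sigma> n} s *\<^sub>R p s) \<in> borel_measurable lebesgue" for n
        unfolding set_integrable_def by (rule borel_measurable_integrable)
      show "AE s in lebesgue. norm (indicator {t'..\<sigma> n} s *\<^sub>R p s) \<le> norm (indicator {t'..t} s *\<^sub>R p s)" for n
        using \<sigma>[of n] by (intro AE_I2) (auto simp: indicator_def)
      show "AE s in lebesgue. (\<lambda>n. indicator {t'..\<sigma> n} s *\<^sub>R p s) \<longlonglongrightarrow> indicator {t'..t} s *\<^sub>R p s"
        using AE_not_endpoints[of t' t]
      proof eventually_elim
        case (elim s)
        have "\<forall>\<^sub>F n in sequentially. indicator {t'..\<sigma> n} s *\<^sub>R p s = indicator {t'..t} s *\<^sub>R p s"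
        proof (cases "s < t")
          case True
          have "\<forall>\<^sub>F n in sequentially. s < \<sigma> n" using order_tendstoD(1)[OF \<sigma>lim True] .
          then show ?thesis by eventually_elim (use True in \<open>simp add: indicator_def\<close>)
        next
          case False
          then have "t < s" using elim by simp
          then have "s \<notin> {t'..\<sigma> n}" "s \<notin> {t'..t}" for n using \<sigma>(2)[of n] by auto
          then show ?thesis by simp
        qed
        then show ?case by (rule tendsto_eventually)
      qed
    qed
    define b where "b n = (norm (u t'))\<^sup>2 + 2 * (LINT s:{t'..\<sigma> n}|lebesgue. f s \<bullet> u s) -
        2 * \<nu> * (LINT s:{t'..\<sigma> n}|lebesgue. (H1_norm K (u s))\<^sup>2)" for n
    have "(norm (u t))\<^sup>2 \<le> (norm (u t'))\<^sup>2 + 2 * (LINT s:{t'..t}|lebesgue. f s \<bullet> u s) -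
        2 * \<nu> * (LINT s:{t'..t}|lebesgue. (H1_norm K (u s))\<^sup>2)"
    proof (rule norm_le_weak_limit[OF uC _ \<sigma>lim t(1)])
      show "\<sigma> n \<in> I" for n using \<sigma>i interior_subset by blast
      show "(norm (u (\<sigma> n)))\<^sup>2 \<le> b n" for n
        using en[OF \<sigma>i \<sigma>(1), of n] unfolding b_def energy_inequality_def by linarith
      show "b \<longlonglongrightarrow> (norm (u t'))\<^sup>2 + 2 * (LINT s:{t'..t}|lebesgue. f s \<bullet> u s) -
        2 * \<nu> * (LINT s:{t'..t}|lebesgue. (H1_norm K (u s))\<^sup>2)"
        unfolding b_def by (intro tendsto_intros conv ip ih)
    qed
    then show ?thesis unfolding energy_inequality_def by linarith
  qed
  \<comment> \<open>The starting time \<open>t0\<close> is discarded as a null set; every other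
    starting time with a later point in \<open>I\<close> is interior.\<close>
  show ?thesis
    unfolding energy_holds_def
    using E[unfolded energy_holds_def] AE_not_endpoints[of t0 t0]
  proof eventually_elim
    case (elim t')
    show ?case
    proof (intro impI ballI)
      fix t assume t': "t' \<in> I" and t: "t \<in> I" "t' < t"
      have "t0 < t'" using I(3)[OF t'] elim(2) by simp
      have "{t0..t} \<subseteq> I" by (rule interval_sub[OF I(2) t(1)])
      then have "{t0<..<t} \<subseteq> interior I" by (intro interior_maximal) auto
      then have in_int: "t' \<in> interior I" using \<open>t0 < t'\<close> t by auto
      show "energy_inequality u t' t"
        by (rule limit[OF in_int t]) (use elim(1) in_int in blast)
    qed
  qed
qed

section \<open>The countable union and the conclusion\<close>

lemma weak_solutions_eq_Union:
  "weak_solutions K \<nu> f I = (\<Union>M. {u \<in> interior_weak_solutions K \<nu> f I. good M u})"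
proof (intro equalityI subsetI)
  fix u assume "u \<in> weak_solutions K \<nu> f I"
  then show "u \<in> (\<Union>M. {u \<in> interior_weak_solutions K \<nu> f I. good M u})"
    using weak_solutions_subset_interior weak_solution_good by blast
next
  fix u assume "u \<in> (\<Union>M. {u \<in> interior_weak_solutions K \<nu> f I. good M u})"
  then obtain M where u: "u \<in> interior_weak_solutions K \<nu> f I" and good: "good M u" by blast
  have uC: "u \<in> Cloc_Hw K I" using u by (simp add: interior_weak_solutions_def)
  have "satisfies_equation u" using u unfolding interior_weak_solution_iff[OF uC] by blast
  then have "weak_solution K \<nu> f I u"
    unfolding weak_solution_iff[OF uC]
    using good_Linf_loc[OF u uC good] good_Lp_loc_V[OF u uC good] good_Lp_loc_derivative[OF u uC good]
      good_energy[OF u uC good] good_imp_continuous_at_start[OF uC good] by blast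
  then show "u \<in> weak_solutions K \<nu> f I" using uC by (simp add: weak_solutions_def)
qed

lemma weak_solutions_gdelta_sigma:
  "(countable union_of gdelta_in (subtopology (Cloc_Hw_top K I) (interior_weak_solutions K \<nu> f I)))
     (weak_solutions K \<nu> f I)"
  unfolding weak_solutions_eq_Union
  by (intro countable_union_of_Union countable_image countable_union_of_inc) (auto intro: gdelta_good countable_union_of_inc)

end

theorem corollary2p1:
  fixes K :: flow_case and \<nu> t0 :: real and I :: "real set" and f :: "real \<Rightarrow> l2vec"
  assumes "admissible K"
    and "0 < \<nu>"
    and "is_interval I" and "t0 \<in> I" and "\<forall>t\<in>I. t0 \<le> t"
    and "Linf I (H_space K) norm f"
  shows "(countable union_of
      gdelta_in (subtopology (Cloc_Hw_top K I) (interior_weak_solutions K \<nu> f I)))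
      (weak_solutions K \<nu> f I)"
proof -
  obtain c where c: "c \<in> I" "t0 \<le> c" "{t0..c} \<subseteq> I" "{t0<..<c} \<subseteq> interior I"
    "\<forall>b\<in>I. c < b \<longrightarrow> {c..b} \<subseteq> interior I"
    using exhausting_endpoint[OF assms(3-5)] by blast
  obtain D where D: "D \<subseteq> {v \<in> V_space K. H1_norm K v \<le> 1}" "countable D"
    "\<forall>v\<in>V_space K. H1_norm K v \<le> 1 \<longrightarrow> (\<forall>e>0. \<exists>d\<in>D. H1_norm K (v - d) < e)"
    using countable_dense_V_ball[OF assms(1)] by blast
  \<comment> \<open>The zero field belongs to the ball and must be approximated from D, so D is
    nonempty and can be enumerated as a sequence.\<close>
  have "H1_norm K 0 \<le> 1" using H1_norm_zero[OF assms(1)] by simp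
  then have "D \<noteq> {}" using D(3) zero_in_V[OF assms(1)] zero_less_one by blast
  then have r: "range (from_nat_into D) = D" using D(2) by (rule range_from_nat_into)
  show ?thesis
    by (rule weak_solutions_gdelta_sigma[of K \<nu> I t0 f c "from_nat_into D"])
      (use assms c D(1,3) r in auto)
qed

end
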